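(* Let $0<\Delta<1$ and $\alpha=1-\Delta$. Let $A=(A[1],\dots,A[D])$ be a vector with nonnegative entries, not all zero, and let $F_{(\alpha)}=\sum_{i=1}^D A[i]^\alpha$. Let $v_{ij}\sim \mathrm{Uniform}(0,\pi)$ and $w_{ij}\sim \mathrm{Exp}(1)$ (mean $1$), $i=1,\dots,D$, $j=1,\dots,k$, all mutually independent, and set $$r_{ij}=\frac{\sin(\alpha v_{ij})}{[\sin v_{ij}]^{1/\alpha}}\left[\frac{\sin(v_{ij}\Delta)}{w_{ij}}\right]^{\Delta/\alpha},\qquad x_j=\sum_{i=1}^D r_{ij}A[i],\quad j=1,\dots,k.$$ Define the estimator $$\hat F_{(\alpha)}=\frac{1}{\Delta^\Delta}\left[\frac{k}{\sum_{j=1}^k x_j^{-\alpha/\Delta}}\right]^\Delta.$$ Then $$E\big(\hat F_{(\alpha)}\big)=F_{(\alpha)}\left(1+O\!\left(\frac{\Delta}{k}\right)\right),\qquad \mathrm{Var}\big(\hat F_{(\alpha)}\big)=\frac{\Delta^2}{k}F_{(\alpha)}^2\left(3-2\Delta+O\!\left(\frac1k\right)\right).$$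
   Context: The variables $x_j$ are i.i.d. positive maximally-skewed $\alpha$-stable random variables; equivalently, each $x_j$ has Laplace transform $E(e^{-s x_j})=\exp(-F_{(\alpha)} s^\alpha)$ for $s\ge 0$ (denoted $S(\alpha,\beta=1,\cos(\frac{\pi\alpha}{2})F_{(\alpha)})$ in the paper). *)

theory Defs
  imports "HOL-Probability.Probability"
begin

definition stable_weight :: "real \<Rightarrow> real \<Rightarrow> real \<Rightarrow> real" where
  "stable_weight \<Delta> v w =
     (let \<alpha> = 1 - \<Delta> in
        sin (\<alpha> * v) / (sin v powr (1 / \<alpha>)) * (sin (v * \<Delta>) / w) powr (\<Delta> / \<alpha>))"

definition frequency_moment :: "real \<Rightarrow> nat \<Rightarrow> (nat \<Rightarrow> real) \<Rightarrow> real" where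
  "frequency_moment \<alpha> D A = (\<Sum>i=1..D. A i powr \<alpha>)"

definition projection ::
    "real \<Rightarrow> nat \<Rightarrow> (nat \<Rightarrow> real) \<Rightarrow> (nat \<Rightarrow> nat \<Rightarrow> 'a \<Rightarrow> real) \<Rightarrow> (nat \<Rightarrow> nat \<Rightarrow> 'a \<Rightarrow> real) \<Rightarrow>
      nat \<Rightarrow> 'a \<Rightarrow> real" where
  "projection \<Delta> D A v w j \<omega> = (\<Sum>i=1..D. stable_weight \<Delta> (v i j \<omega>) (w i j \<omega>) * A i)"

definition moment_estimator ::
    "real \<Rightarrow> nat \<Rightarrow> nat \<Rightarrow> (nat \<Rightarrow> real) \<Rightarrow> (nat \<Rightarrow> nat \<Rightarrow> 'a \<Rightarrow> real) \<Rightarrow> (nat \<Rightarrow> nat \<Rightarrow> 'a \<Rightarrow> real) \<Rightarrow>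
      'a \<Rightarrow> real" where
  "moment_estimator \<Delta> D k A v w \<omega> =
     1 / (\<Delta> powr \<Delta>) *
     (real k / (\<Sum>j=1..k. projection \<Delta> D A v w j \<omega> powr (- (1 - \<Delta>) / \<Delta>))) powr \<Delta>"

(* The joint family is indexed by a disjoint sum, so that all the v i j and w i j
   together (not just each array separately) are independent. *)
definition uniform_exponential_arrays ::
    "'a measure \<Rightarrow> nat \<Rightarrow> nat \<Rightarrow> (nat \<Rightarrow> nat \<Rightarrow> 'a \<Rightarrow> real) \<Rightarrow> (nat \<Rightarrow> nat \<Rightarrow> 'a \<Rightarrow> real) \<Rightarrow> bool" where
  "uniform_exponential_arrays M D k v w \<longleftrightarrow>
     prob_space M \<and>
     prob_space.indep_vars M (\<lambda>_. borel) (case_sum (\<lambda>(i, j). v i j) (\<lambda>(i, j). w i j))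
       (({1..D} \<times> {1..k}) <+> ({1..D} \<times> {1..k})) \<and>
     (\<forall>i\<in>{1..D}. \<forall>j\<in>{1..k}.
        distributed M lborel (v i j) (\<lambda>x. indicator {0<..<pi} x / ennreal pi) \<and>
        distributed M lborel (w i j) (\<lambda>x. ennreal (exponential_density 1 x)))"

end

theory Submission imports Defs begin

text \<open>Write \<open>\<alpha> = 1 - \<Delta>\<close> and \<open>Y\<^sub>j = \<Delta> F powr (1 / \<Delta>) x\<^sub>j powr (- \<alpha> / \<Delta>)\<close>, so that the
  estimator is \<open>F\<close> times the \<open>- \<Delta>\<close>-th power of the mean of the \<open>Y\<^sub>j\<close>.

  Each weight has Laplace transform \<open>exp (- s powr \<alpha>)\<close> (Kanter): if \<open>w'\<close> is an independent standard
  exponential, then \<open>(w' / r) powr \<alpha>\<close> has the moments \<open>n!\<close>, which characterise the exponential law,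
  and its tail is that Laplace transform. The moments come from Zolotarev's integral, evaluated through
  \<open>(1 + z) ^ n / z powr (\<alpha> n)\<close> along the curve on which this function is real. Hence
  \<open>x\<^sub>j\<close> has the law of \<open>F powr (1 / \<alpha>)\<close> times a single weight, and \<open>Y\<^sub>j\<close> has the moments
  \<open>\<Prod>l<m. m - l \<Delta>\<close>; in particular mean \<open>1\<close> and variance \<open>3 - 2 \<Delta>\<close>.

  The expansion is then a Taylor expansion at \<open>1\<close> of \<open>y powr (- \<Delta>)\<close>. Uniformity in \<open>\<Delta>\<close> is delicate near \<open>0\<close>,
  since \<open>E (Y powr (- q))\<close> is infinite for \<open>q \<ge> \<Delta>\<close>; but \<open>(Y powr (- \<Delta>) - 1) / \<Delta>\<close> has a fractional moment bounded
  uniformly in \<open>\<Delta>\<close>, so eight samples suffice to control the mean near \<open>0\<close>, and a Chernoff bound makes that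
  event negligible.\<close>

section \<open>Zolotarev's integral\<close>

text \<open>Expanding along the curve reaches only the moments of order
  \<open>- \<alpha> * n\<close> of a weight with integer \<open>n\<close>, while the scores need the
  real exponents \<open>m / \<Delta>\<close> and the sum over \<open>i\<close> needs a Laplace
  transform. Identifying the law of \<open>(w' / r) powr \<alpha>\<close> supplies both. For
  \<open>q = m / \<Delta>\<close> one has \<open>\<alpha> * q = q - m\<close>, so Gamma quotients
  become polynomials in \<open>\<Delta>\<close>.

  Powers of the mean are studied through \<open>(1 - x powr (- \<Delta>)) / \<Delta>\<close>, which
  tends to \<open>ln x\<close> as \<open>\<Delta>\<close> tends to 0 and so admits bounds free of
  \<open>\<Delta>\<close>; undoing the division produces the factors \<open>\<Delta>\<close> and
  \<open>\<Delta>\<^sup>2\<close> of the errors. The variance needs the second moment of this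
  quotient, but for one score only a moment of order 1/4 of its negative part is at hand, hence
  \<open>2 / (1 / 4) = 8\<close> samples. The cubic Taylor term is kept with its sign: its mean is
  O(1/k^2), whereas its absolute value has a mean of order k^(-3/2), too large for the error
  term.\<close>

definition pi_sinc :: "real \<Rightarrow> real" where
  "pi_sinc x = (if x = 0 then pi else sin (pi * x) / x)"

text \<open>\<open>rGamma\<close> is entire and vanishes at the poles of Gamma, so the reflection
  formula and the closed form of the binomial sum carry no side conditions at integers.\<close>

lemma rGamma_reflection_real:
  "rGamma x * rGamma (1 - x) = sin (pi * x) / (pi :: real)"
proof -
  have "complex_of_real (rGamma x * rGamma (1 - x)) = complex_of_real (sin (pi * x) / pi)"
    using rGamma_reflection_complex[of "of_real x"]
    by (simp add: rGamma_complex_of_real[symmetric] sin_of_real[symmetric] del: sin_of_real)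
  then show ?thesis
    by (simp only: of_real_eq_iff)
qed

lemma pi_sinc_rGamma: "pi_sinc (- x) = pi * (rGamma (1 + x) * rGamma (1 - x))"
proof (cases "x = 0")
  case True
  then show ?thesis by (simp add: pi_sinc_def rGamma_inverse_Gamma)
next
  case False
  have "x * rGamma (1 + x) * rGamma (1 - x) = sin (pi * x) / pi"
    using rGamma_plus1[of x] rGamma_reflection_real[of x] by (simp add: add.commute)
  with False show ?thesis
    by (simp add: pi_sinc_def field_simps)
qed

text \<open>\<open>pi_sinc c\<close> is the integral of \<open>cos (c * \<theta>)\<close> over
  \<open>{0..pi}\<close>. Pascal's rule splits the sum for \<open>Suc n\<close> at \<open>x\<close>
  into those for \<open>n\<close> at \<open>x - 1\<close> and at \<open>x\<close>, which is why the
  induction generalises over \<open>x\<close>; the recurrence of \<open>rGamma\<close> merges the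
  two closed forms because \<open>x + (1 + n - x) = Suc n\<close>.\<close>

lemma sum_choose_pi_sinc:
  fixes x :: real
  shows "(\<Sum>l\<le>n. real (n choose l) * pi_sinc (real l - x))
           = pi * fact n * (rGamma (1 + x) * rGamma (1 + real n - x))"
proof (induction n arbitrary: x)
  case 0
  then show ?case by (simp add: pi_sinc_rGamma)
next
  case (Suc n)
  let ?g = "\<lambda>n x l. real (n choose l) * pi_sinc (real l - x)"
  have "(\<Sum>l\<le>Suc n. ?g (Suc n) x l) = ?g (Suc n) x 0 + (\<Sum>l\<le>n. ?g (Suc n) x (Suc l))"
    by (rule sum.atMost_Suc_shift)
  also have "(\<Sum>l\<le>n. ?g (Suc n) x (Suc l)) =
      (\<Sum>l\<le>n. ?g n (x - 1) l) + (\<Sum>l\<le>n. ?g n x (Suc l))"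
    by (simp add: sum.distrib[symmetric] algebra_simps)
  also have "?g (Suc n) x 0 + ((\<Sum>l\<le>n. ?g n (x - 1) l) + (\<Sum>l\<le>n. ?g n x (Suc l)))
      = (\<Sum>l\<le>n. ?g n (x - 1) l) + (\<Sum>l\<le>Suc n. ?g n x l)"
    unfolding sum.atMost_Suc_shift[of "?g n x"] by simp
  also have "(\<Sum>l\<le>Suc n. ?g n x l) = (\<Sum>l\<le>n. ?g n x l)"
    by simp
  finally have "(\<Sum>l\<le>Suc n. ?g (Suc n) x l) =
      pi * fact n * (rGamma x * rGamma (2 + real n - x) + rGamma (1 + x) * rGamma (1 + real n - x))"
    by (simp only: Suc.IH) (simp add: algebra_simps)
  also have "rGamma x = x * rGamma (1 + x)"
    using rGamma_plus1[of x] by (simp add: add.commute)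
  also have "rGamma (1 + real n - x) = (1 + real n - x) * rGamma (2 + real n - x)"
    using rGamma_plus1[of "1 + real n - x"] by (simp add: algebra_simps)
  finally show ?case
    by (simp add: algebra_simps)
qed

text \<open>A power of Zolotarev's function for the one-sided stable law: the real value of
  \<open>(1 + z) / z powr \<alpha>\<close> at \<open>z = r * cis \<theta>\<close> with \<open>r =
  sin (\<alpha> * \<theta>) / sin ((1 - \<alpha>) * \<theta>)\<close>.\<close>

definition zolotarev :: "real \<Rightarrow> real \<Rightarrow> real" where
  "zolotarev \<alpha> \<theta> = sin \<theta> / (sin (\<alpha> * \<theta>) powr \<alpha> * sin ((1 - \<alpha>) * \<theta>) powr (1 - \<alpha>))"

lemma sin_scaled_pos:
  fixes c \<theta> :: real
  assumes "0 < c" "c < 1" "0 < \<theta>" "\<theta> \<le> pi"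
  shows "sin (c * \<theta>) > 0"
proof (rule sin_gt_zero)
  show "0 < c * \<theta>" using assms by simp
  have "c * \<theta> < 1 * \<theta>" using assms by (intro mult_strict_right_mono) auto
  then show "c * \<theta> < pi" using assms by linarith
qed

text \<open>By the law of sines \<open>1 + z\<close> has argument \<open>\<alpha> * \<theta>\<close>
  at \<open>z = r * cis \<theta>\<close>, the same as \<open>z powr \<alpha>\<close>, so the
  quotient is real. In the binomial expansion of its \<open>n\<close>-th power the real part gives
  the value, and the imaginary part gives the relation that later removes the derivative of
  \<open>r\<close>.\<close>

lemma zolotarev_binomial:
  fixes \<alpha> \<theta> :: real
  assumes "0 < \<alpha>" "\<alpha> < 1" "0 < \<theta>" "\<theta> < pi"
  defines "r \<equiv> sin (\<alpha> * \<theta>) / sin ((1 - \<alpha>) * \<theta>)"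
  shows "(\<Sum>l\<le>n. real (n choose l) * (r powr (real l - \<alpha> * n) * cos ((real l - \<alpha> * n) * \<theta>)))
           = zolotarev \<alpha> \<theta> ^ n"
    and "(\<Sum>l\<le>n. real (n choose l) * (r powr (real l - \<alpha> * n) * sin ((real l - \<alpha> * n) * \<theta>))) = 0"
proof -
  have sa: "sin (\<alpha> * \<theta>) > 0" and sd: "sin ((1 - \<alpha>) * \<theta>) > 0" and st: "sin \<theta> > 0"
    using sin_scaled_pos[of \<alpha> \<theta>] sin_scaled_pos[of "1 - \<alpha>" \<theta>] assms
    by (auto simp: sin_gt_zero)
  have r: "r > 0" using sa sd by (simp add: r_def)
  define w where "w = complex_of_real r * cis \<theta>"
  \<comment> \<open>\<open>b\<close> is \<open>w powr (- \<alpha>)\<close> in an explicit branch, so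
    that its powers follow from de Moivre.\<close>
  define b where "b = complex_of_real (r powr (- \<alpha>)) * cis (- \<alpha> * \<theta>)"
  have tri: "1 + w = complex_of_real (sin \<theta> / sin ((1 - \<alpha>) * \<theta>)) * cis (\<alpha> * \<theta>)"
  proof -
    have s: "sin ((1 - \<alpha>) * \<theta>) = sin \<theta> * cos (\<alpha> * \<theta>) - cos \<theta> * sin (\<alpha> * \<theta>)"
      by (simp add: left_diff_distrib sin_diff)
    have t: "sin ((1 - \<alpha>) * \<theta>) + sin (\<alpha> * \<theta>) * cos \<theta> = sin \<theta> * cos (\<alpha> * \<theta>)"
      using s by simp
    have "1 + sin (\<alpha> * \<theta>) / sin ((1 - \<alpha>) * \<theta>) * cos \<theta> = sin \<theta> / sin ((1 - \<alpha>) * \<theta>) * cos (\<alpha> * \<theta>)"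
      unfolding times_divide_eq_left t[symmetric] using sd by (simp add: add_divide_distrib)
    then show ?thesis
      unfolding w_def r_def by (simp add: complex_eq_iff)
  qed
  have bw: "b ^ n * w ^ l = complex_of_real (r powr (real l - \<alpha> * n)) * cis ((real l - \<alpha> * n) * \<theta>)" for l
  proof -
    have rn: "(r powr - \<alpha>) ^ n = r powr (- \<alpha> * n)"
      using r by (subst powr_realpow[symmetric]) (auto simp: powr_powr)
    have "b ^ n = complex_of_real (r powr (- \<alpha> * n)) * cis (- \<alpha> * n * \<theta>)"
      unfolding b_def power_mult_distrib Complex.DeMoivre
      by (simp add: rn mult_ac flip: of_real_power)
    moreover have "w ^ l = complex_of_real (r powr l) * cis (real l * \<theta>)"
      unfolding w_def power_mult_distrib Complex.DeMoivre
      using r by (simp add: powr_realpow)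
    ultimately have "b ^ n * w ^ l = complex_of_real (r powr (- \<alpha> * n) * r powr l)
        * (cis (- \<alpha> * n * \<theta>) * cis (real l * \<theta>))"
      by simp
    also have "r powr (- \<alpha> * n) * r powr l = r powr (real l - \<alpha> * n)"
      by (simp add: powr_add[symmetric])
    also have "cis (- \<alpha> * n * \<theta>) * cis (real l * \<theta>) = cis ((real l - \<alpha> * n) * \<theta>)"
      by (simp add: cis_mult algebra_simps)
    finally show ?thesis .
  qed
  have "b * (1 + w) = complex_of_real (r powr (- \<alpha>) * (sin \<theta> / sin ((1 - \<alpha>) * \<theta>)))"
    unfolding tri b_def by (simp add: cis_mult mult.assoc mult.left_commute[of "cis _"])
  also have "r powr (- \<alpha>) * (sin \<theta> / sin ((1 - \<alpha>) * \<theta>)) = zolotarev \<alpha> \<theta>"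
  proof -
    have "sin ((1 - \<alpha>) * \<theta>) powr (1 - \<alpha>) = sin ((1 - \<alpha>) * \<theta>) / sin ((1 - \<alpha>) * \<theta>) powr \<alpha>"
      using sd by (simp add: powr_diff)
    then show ?thesis
      using sa sd by (simp add: r_def zolotarev_def powr_divide powr_minus field_simps)
  qed
  finally have "complex_of_real (zolotarev \<alpha> \<theta> ^ n) = (b * (1 + w)) ^ n"
    by simp
  also have "\<dots> = (\<Sum>l\<le>n. of_nat (n choose l) * (b ^ n * w ^ l))"
    using binomial_ring[of w 1 n]
    by (simp add: power_mult_distrib add.commute sum_distrib_left mult_ac)
  also have "\<dots> = (\<Sum>l\<le>n. of_nat (n choose l) *
      (complex_of_real (r powr (real l - \<alpha> * n)) * cis ((real l - \<alpha> * n) * \<theta>)))"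
    by (simp only: bw)
  finally have eq: "complex_of_real (zolotarev \<alpha> \<theta> ^ n) = \<dots>" .
  show "(\<Sum>l\<le>n. real (n choose l) * (r powr (real l - \<alpha> * n) * cos ((real l - \<alpha> * n) * \<theta>)))
           = zolotarev \<alpha> \<theta> ^ n"
    using arg_cong[OF eq, of Re] by (simp only: Re_sum) simp
  show "(\<Sum>l\<le>n. real (n choose l) * (r powr (real l - \<alpha> * n) * sin ((real l - \<alpha> * n) * \<theta>))) = 0"
    using arg_cong[OF eq, of Im] by (simp only: Im_sum) simp
qed

text \<open>The imaginary part of \<open>z powr c / c\<close> along the curve. At
  \<open>c = 0\<close>, which occurs when \<open>l = \<alpha> * n\<close>, it is replaced by its
  limit, the argument \<open>\<theta>\<close> of \<open>z\<close>.\<close>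

definition zolotarev_prim :: "real \<Rightarrow> real \<Rightarrow> real \<Rightarrow> real" where
  "zolotarev_prim \<alpha> c \<theta> =
     (if c = 0 then \<theta> else (sin (\<alpha> * \<theta>) / sin ((1 - \<alpha>) * \<theta>)) powr c * sin (c * \<theta>) / c)"

text \<open>The second summand stems from the motion of the radius. Its factor
  \<open>deriv r \<theta> / r \<theta>\<close> is the same for all \<open>c\<close>, so the binomial
  sum of these terms vanishes by the imaginary part of the expansion.\<close>

lemma zolotarev_prim_deriv:
  fixes \<alpha> \<theta> c :: real
  assumes "0 < \<alpha>" "\<alpha> < 1" "0 < \<theta>" "\<theta> < pi"
  defines "r \<equiv> \<lambda>\<theta>. sin (\<alpha> * \<theta>) / sin ((1 - \<alpha>) * \<theta>)"
  shows "(zolotarev_prim \<alpha> c has_real_derivative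
           r \<theta> powr c * cos (c * \<theta>) + deriv r \<theta> / r \<theta> * (r \<theta> powr c * sin (c * \<theta>))) (at \<theta>)"
proof (cases "c = 0")
  case True
  have sa: "sin (\<alpha> * \<theta>) > 0" and sd: "sin ((1 - \<alpha>) * \<theta>) > 0"
    using sin_scaled_pos[of \<alpha> \<theta>] sin_scaled_pos[of "1 - \<alpha>" \<theta>] assms by auto
  have "(\<lambda>\<theta>. zolotarev_prim \<alpha> c \<theta>) = (\<lambda>\<theta>. \<theta>)"
    using True by (simp add: zolotarev_prim_def fun_eq_iff)
  then show ?thesis using True sa sd by (simp add: r_def)
next
  case False
  have sa: "sin (\<alpha> * \<theta>) > 0" and sd: "sin ((1 - \<alpha>) * \<theta>) > 0"
    using sin_scaled_pos[of \<alpha> \<theta>] sin_scaled_pos[of "1 - \<alpha>" \<theta>] assms by auto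
  then have r: "r \<theta> > 0" by (simp add: r_def)
  have "\<exists>D. (r has_real_derivative D) (at \<theta>)"
    unfolding r_def using sd by (intro exI) (rule derivative_eq_intros refl | simp)+
  then have dr: "(r has_real_derivative deriv r \<theta>) (at \<theta>)"
    by (auto dest: DERIV_imp_deriv)
  have "((\<lambda>\<theta>. r \<theta> powr c * sin (c * \<theta>) / c) has_real_derivative
          (r \<theta> powr c * (0 * ln (r \<theta>) + deriv r \<theta> * c / r \<theta>) * sin (c * \<theta>) + cos (c * \<theta>) * c * r \<theta> powr c) / c) (at \<theta>)"
  proof (intro DERIV_cdivide DERIV_mult DERIV_powr dr r)
    show "((\<lambda>\<theta>. c) has_real_derivative 0) (at \<theta>)" by simp
    show "((\<lambda>\<theta>. sin (c * \<theta>)) has_real_derivative cos (c * \<theta>) * c) (at \<theta>)"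
      by (auto intro!: derivative_eq_intros)
  qed
  moreover have "(r \<theta> powr c * (0 * ln (r \<theta>) + deriv r \<theta> * c / r \<theta>) * sin (c * \<theta>) + cos (c * \<theta>) * c * r \<theta> powr c) / c
     = r \<theta> powr c * cos (c * \<theta>) + deriv r \<theta> / r \<theta> * (r \<theta> powr c * sin (c * \<theta>))"
    using False r by (simp add: field_simps)
  moreover have "zolotarev_prim \<alpha> c = (\<lambda>\<theta>. r \<theta> powr c * sin (c * \<theta>) / c)"
    using False by (simp add: zolotarev_prim_def fun_eq_iff r_def)
  ultimately show ?thesis by simp
qed

text \<open>At \<open>\<theta> = 0\<close> the ratio of sines is \<open>0 / 0 = 0\<close> and hence
  discontinuous. The primitive still has the right value 0 there: the ratio has the positive limit
  \<open>\<alpha> / (1 - \<alpha>)\<close> and the factor \<open>sin (c * \<theta>)\<close> tends to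
  0.\<close>

lemma zolotarev_prim_continuous:
  assumes "0 < \<alpha>" "\<alpha> < 1"
  shows "continuous_on {0..pi} (zolotarev_prim \<alpha> c)"
proof (cases "c = 0")
  case True
  then show ?thesis by (simp add: zolotarev_prim_def[abs_def])
next
  case False
  let ?r = "\<lambda>\<theta>. sin (\<alpha> * \<theta>) / sin ((1 - \<alpha>) * \<theta>)"
  have lim: "(zolotarev_prim \<alpha> c \<longlongrightarrow> 0) (at_right 0)"
  proof -
    have "((\<lambda>\<theta>. sin (a * \<theta>) / \<theta>) \<longlongrightarrow> a) (at_right 0)" for a :: real
    proof -
      have "((\<lambda>\<theta>. sin (a * \<theta>)) has_real_derivative a) (at 0)"
        by (auto intro!: derivative_eq_intros)
      then have "((\<lambda>\<theta>. sin (a * \<theta>) / \<theta>) \<longlongrightarrow> a) (at 0)"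
        by (simp add: DERIV_def)
      then show ?thesis by (rule filterlim_mono) (auto simp: at_within_le_at)
    qed
    then have "((\<lambda>\<theta>. (sin (\<alpha> * \<theta>) / \<theta>) / (sin ((1 - \<alpha>) * \<theta>) / \<theta>)) \<longlongrightarrow> \<alpha> / (1 - \<alpha>)) (at_right 0)"
      using assms by (intro tendsto_divide) auto
    then have "(?r \<longlongrightarrow> \<alpha> / (1 - \<alpha>)) (at_right 0)"
      by (rule Lim_transform_eventually)
         (auto simp: eventually_at_filter)
    then have "((\<lambda>\<theta>. ?r \<theta> powr c * sin (c * \<theta>) / c) \<longlongrightarrow> (\<alpha> / (1 - \<alpha>)) powr c * sin (c * 0) / c) (at_right 0)"
      using assms False \<open>(?r \<longlongrightarrow> \<alpha> / (1 - \<alpha>)) (at_right 0)\<close>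
      by (intro tendsto_divide[where b = c] tendsto_mult tendsto_powr tendsto_sin tendsto_const tendsto_ident_at) auto
    then show ?thesis using False by (simp add: zolotarev_prim_def[abs_def])
  qed
  have "continuous_on {0<..pi} (zolotarev_prim \<alpha> c)"
  proof -
    have *: "sin ((1 - \<alpha>) * \<theta>) \<noteq> 0" "sin (\<alpha> * \<theta>) \<noteq> 0" if "\<theta> \<in> {0<..pi}" for \<theta>
      using sin_scaled_pos[of \<alpha> \<theta>] sin_scaled_pos[of "1 - \<alpha>" \<theta>] assms that by auto
    show ?thesis unfolding zolotarev_prim_def[abs_def] using False *
      by (auto intro!: continuous_intros)
  qed
  then have "isCont (\<lambda>x. x) 0 \<and> (\<forall>x\<in>{0<..pi}. (zolotarev_prim \<alpha> c \<longlongrightarrow> zolotarev_prim \<alpha> c x) (at x within {0<..pi}))"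
    by (auto simp: continuous_on_def)
  moreover have "at x within {0<..pi} = at x within {0..pi}" if "x \<in> {0<..pi}" for x
    using that by (intro at_within_nhd[of _ "{0<..}"]) auto
  moreover have "at 0 within {0..pi} = at_right (0::real)"
    by (rule at_within_Icc_at_right) simp
  moreover have "zolotarev_prim \<alpha> c 0 = 0" by (simp add: zolotarev_prim_def)
  ultimately show ?thesis
    unfolding continuous_on_def using lim
    by (metis atLeastAtMost_iff greaterThanAtMost_iff order_le_less)
qed

lemma zolotarev_nonneg:
  assumes "0 < \<alpha>" "\<alpha> < 1" "0 \<le> \<theta>" "\<theta> \<le> pi"
  shows "0 \<le> zolotarev \<alpha> \<theta>"
  using assms by (simp add: zolotarev_def sin_ge_zero)

text \<open>Only the endpoint \<open>pi\<close> contributes. The ratio of sines equals 1 there, so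
  each primitive becomes a \<open>pi_sinc\<close> and the binomial sum has its closed form.\<close>

lemma zolotarev_integral:
  assumes "0 < \<alpha>" "\<alpha> < 1"
  shows "((\<lambda>\<theta>. zolotarev \<alpha> \<theta> ^ n) has_integral
           pi * fact n / (Gamma (1 + \<alpha> * n) * Gamma (1 + (1 - \<alpha>) * n))) {0..pi}"
proof -
  define f where "f \<theta> = (\<Sum>l\<le>n. real (n choose l) * zolotarev_prim \<alpha> (real l - \<alpha> * n) \<theta>)" for \<theta>
  have "((\<lambda>\<theta>. zolotarev \<alpha> \<theta> ^ n) has_integral (f pi - f 0)) {0..pi}"
  proof (rule fundamental_theorem_of_calculus_interior)
    show "continuous_on {0..pi} f"
      unfolding f_def by (intro continuous_intros zolotarev_prim_continuous assms)
    fix \<theta> assume \<theta>: "\<theta> \<in> {0<..<pi}"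
    let ?r = "\<lambda>\<theta>. sin (\<alpha> * \<theta>) / sin ((1 - \<alpha>) * \<theta>)"
    let ?c = "\<lambda>l. real l - \<alpha> * n"
    have "(f has_real_derivative (\<Sum>l\<le>n. real (n choose l) * 
            (?r \<theta> powr ?c l * cos (?c l * \<theta>) + deriv ?r \<theta> / ?r \<theta> * (?r \<theta> powr ?c l * sin (?c l * \<theta>))))) (at \<theta>)"
      unfolding f_def using assms \<theta>
      by (intro DERIV_sum DERIV_cmult zolotarev_prim_deriv) auto
    also have "(\<Sum>l\<le>n. real (n choose l) * 
            (?r \<theta> powr ?c l * cos (?c l * \<theta>) + deriv ?r \<theta> / ?r \<theta> * (?r \<theta> powr ?c l * sin (?c l * \<theta>))))
       = (\<Sum>l\<le>n. real (n choose l) * (?r \<theta> powr ?c l * cos (?c l * \<theta>)))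
         + deriv ?r \<theta> / ?r \<theta> * (\<Sum>l\<le>n. real (n choose l) * (?r \<theta> powr ?c l * sin (?c l * \<theta>)))"
      unfolding sum_distrib_left sum.distrib[symmetric]
      by (intro sum.cong refl) (simp only: distrib_left mult.left_commute)
    also have "\<dots> = zolotarev \<alpha> \<theta> ^ n"
      using zolotarev_binomial[of \<alpha> \<theta> n] assms \<theta> by simp
    finally show "(f has_vector_derivative zolotarev \<alpha> \<theta> ^ n) (at \<theta>)"
      by (simp add: has_real_derivative_iff_has_vector_derivative)
  qed simp
  also have "f 0 = 0"
    by (auto simp: f_def zolotarev_prim_def intro!: sum.neutral)
  also have "f pi = (\<Sum>l\<le>n. real (n choose l) * pi_sinc (real l - \<alpha> * n))"
  proof -
    have "sin ((1 - \<alpha>) * pi) = sin (\<alpha> * pi)"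
      by (simp add: left_diff_distrib)
    moreover have "sin (\<alpha> * pi) > 0"
      using assms by (intro sin_scaled_pos) auto
    ultimately have "zolotarev_prim \<alpha> c pi = pi_sinc c" for c
      by (simp add: zolotarev_prim_def pi_sinc_def mult.commute)
    then show ?thesis by (simp add: f_def)
  qed
  also have "\<dots> = pi * fact n * (rGamma (1 + \<alpha> * n) * rGamma (1 + real n - \<alpha> * n))"
    by (rule sum_choose_pi_sinc)
  also have "1 + real n - \<alpha> * n = 1 + (1 - \<alpha>) * n"
    by (simp add: algebra_simps)
  finally show ?thesis
    by (simp add: rGamma_inverse_Gamma divide_inverse)
qed

section \<open>Laws determined by Laplace transforms and factorial moments\<close>

lemma summable_power_div_fact: "summable (\<lambda>n. (x::real) ^ n / fact n)"
  using summable_exp[of x] by (simp add: divide_inverse mult.commute)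

text \<open>Boundedness lets the exponential series be integrated termwise, so such a law is
  determined by its moments.\<close>

lemma char_sums_moments:
  assumes "real_distribution \<mu>" and b: "AE x in \<mu>. \<bar>x\<bar> \<le> 1"
  shows "(\<lambda>n. (\<i> * of_real t) ^ n / fact n * complex_of_real (\<integral>x. x ^ n \<partial>\<mu>)) sums char \<mu> t"
proof -
  interpret real_distribution \<mu> by fact
  let ?f = "\<lambda>n x. (\<i> * of_real t) ^ n / fact n * complex_of_real (x ^ n)"
  have int: "integrable \<mu> (\<lambda>x. x ^ n)" for n :: nat
    using b by (intro integrable_const_bound[of _ 1]) (auto elim!: eventually_mono simp: power_le_one power_abs)
  have bnd: "\<integral>x. norm (?f n x) \<partial>\<mu> \<le> \<bar>t\<bar> ^ n / fact n" for n
  proof -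
    have "(\<integral>x. norm (?f n x) \<partial>\<mu>) \<le> (\<integral>x. \<bar>t\<bar> ^ n / fact n \<partial>\<mu>)"
      using b int[of n]
      by (intro integral_mono_AE integrable_norm integrable_mult_right integrable_of_real)
         (auto elim!: eventually_mono simp: norm_mult norm_divide norm_power power_abs
           intro!: divide_right_mono mult_left_le power_le_one)
    also have "\<dots> = \<bar>t\<bar> ^ n / fact n"
      using prob_space by simp
    finally show ?thesis .
  qed
  have "(\<lambda>n. integral\<^sup>L \<mu> (?f n)) sums (\<integral>x. (\<Sum>n. ?f n x) \<partial>\<mu>)"
  proof (rule sums_integral)
    show "integrable \<mu> (?f n)" for n
      by (intro integrable_mult_right integrable_of_real int)
    show "AE x in \<mu>. summable (\<lambda>n. norm (?f n x))"
    proof (rule AE_I2)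
      fix x
      have "norm (?f n x) = \<bar>t * x\<bar> ^ n / fact n" for n
        by (simp add: norm_mult norm_divide norm_power abs_mult power_mult_distrib)
      then show "summable (\<lambda>n. norm (?f n x))"
        by (simp only: summable_power_div_fact)
    qed
    show "summable (\<lambda>n. \<integral>x. norm (?f n x) \<partial>\<mu>)"
      using bnd by (intro summable_comparison_test'[OF summable_power_div_fact[of "\<bar>t\<bar>"], of 0]) simp
  qed
  moreover have "(\<Sum>n. ?f n x) = iexp (t * x)" for x
    by (simp add: exp_def scaleR_conv_of_real power_mult_distrib divide_inverse mult_ac)
  moreover have "integral\<^sup>L \<mu> (?f n) = (\<i> * of_real t) ^ n / fact n * complex_of_real (\<integral>x. x ^ n \<partial>\<mu>)" for n
    using integral_of_real[of \<mu> "\<lambda>x. x ^ n", where 'a = complex] by (simp del: of_real_power)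
  ultimately show ?thesis unfolding char_def by (simp only:)
qed

text \<open>Under \<open>exp (- x)\<close> both laws move to \<open>{0..1}\<close>, where the
  Laplace transforms at natural numbers become the moments; bounded laws with equal moments have
  equal characteristic functions.\<close>

lemma laplace_unique:
  fixes \<mu> \<nu> :: "real measure"
  assumes "real_distribution \<mu>" "real_distribution \<nu>"
    and nn: "AE x in \<mu>. 0 \<le> x" "AE x in \<nu>. 0 \<le> x"
    and eq: "\<And>n::nat. (\<integral>x. exp (- (real n * x)) \<partial>\<mu>) = (\<integral>x. exp (- (real n * x)) \<partial>\<nu>)"
  shows "\<mu> = \<nu>"
proof -
  let ?e = "\<lambda>x::real. exp (- x)"
  let ?D = "\<lambda>M. distr M borel ?e"
  have rd: "real_distribution (?D M)" if "real_distribution M" for M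
  proof -
    interpret real_distribution M by fact
    show ?thesis by (rule real_distribution_distr) simp
  qed
  have bd: "AE x in ?D M. \<bar>x\<bar> \<le> 1" if "real_distribution M" "AE x in M. 0 \<le> x" for M
  proof -
    interpret real_distribution M by fact
    show ?thesis using that(2) by (subst AE_distr_iff) (auto elim: eventually_mono)
  qed
  have mom: "(\<integral>x. x ^ n \<partial>?D M) = (\<integral>x. exp (- (real n * x)) \<partial>M)" if "real_distribution M" for M n
  proof -
    interpret real_distribution M by fact
    show ?thesis by (subst integral_distr) (auto simp: exp_of_nat_mult[symmetric])
  qed
  have "char (?D \<mu>) t = char (?D \<nu>) t" for t
  proof -
    have "(\<lambda>n. (\<i> * of_real t) ^ n / fact n * complex_of_real (\<integral>x. x ^ n \<partial>?D \<mu>)) sums char (?D \<mu>) t"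
      by (intro char_sums_moments rd bd assms)
    moreover have "(\<lambda>n. (\<i> * of_real t) ^ n / fact n * complex_of_real (\<integral>x. x ^ n \<partial>?D \<nu>)) sums char (?D \<nu>) t"
      by (intro char_sums_moments rd bd assms)
    ultimately show ?thesis
      unfolding mom[OF assms(1)] mom[OF assms(2)] eq by (rule sums_unique2)
  qed
  then have D: "?D \<mu> = ?D \<nu>"
    by (intro Levy_uniqueness rd assms ext)
  have inv_e: "distr (?D M) borel (\<lambda>x. - ln x) = M" if "real_distribution M" for M
  proof -
    interpret real_distribution M by fact
    have "distr (?D M) borel (\<lambda>x. - ln x) = distr M borel (\<lambda>x. x)"
      by (subst distr_distr) (auto simp: comp_def)
    also have "\<dots> = M" by (rule distr_id2) simp
    finally show ?thesis .
  qed
  show ?thesis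
    by (subst inv_e[OF assms(1), symmetric], subst D) (rule inv_e[OF assms(2)])
qed

text \<open>With moments \<open>fact n\<close> the power series of the characteristic function
  converges only for \<open>\<bar>t\<bar> < 1\<close>. Replacing \<open>x\<close> by
  \<open>sqrt x\<close> and keeping even powers gives coefficients
  \<open>fact n / fact (2 * n) \<le> 1 / fact n\<close>, so this transform is determined for every
  \<open>t\<close> at once.\<close>

lemma factorial_moments_cos:
  fixes \<mu> :: "real measure"
  assumes "real_distribution \<mu>" and nn: "AE x in \<mu>. 0 \<le> x"
    and int: "\<And>n::nat. integrable \<mu> (\<lambda>x. x ^ n)"
    and mom: "\<And>n::nat. (\<integral>x. x ^ n \<partial>\<mu>) = fact n"
  shows "(\<lambda>n. (- 1) ^ n * t ^ (2 * n) * fact n / fact (2 * n)) sums (\<integral>x. cos (t * sqrt x) \<partial>\<mu>)"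
proof -
  interpret real_distribution \<mu> by fact
  let ?f = "\<lambda>n x. (- 1) ^ n * t ^ (2 * n) / fact (2 * n) * x ^ n :: real"
  have "(\<lambda>n. integral\<^sup>L \<mu> (?f n)) sums (\<integral>x. (\<Sum>n. ?f n x) \<partial>\<mu>)"
  proof (rule sums_integral)
    show "integrable \<mu> (?f n)" for n
      by (intro integrable_mult_right int)
    show "AE x in \<mu>. summable (\<lambda>n. norm (?f n x))"
    proof (rule AE_I2)
      fix x
      have "norm (?f n x) \<le> (t\<^sup>2 * \<bar>x\<bar>) ^ n / fact n" for n
      proof -
        have "norm (?f n x) = (t\<^sup>2 * \<bar>x\<bar>) ^ n / fact (2 * n)"
          by (simp add: abs_mult power_mult_distrib power_mult[of _ 2 n] power_abs)
        also have "\<dots> \<le> (t\<^sup>2 * \<bar>x\<bar>) ^ n / fact n"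
          by (intro divide_left_mono fact_mono mult_pos_pos zero_le_power) auto
        finally show ?thesis .
      qed
      then show "summable (\<lambda>n. norm (?f n x))"
        by (intro summable_comparison_test'[OF summable_power_div_fact[of "t\<^sup>2 * \<bar>x\<bar>"], of 0]) simp
    qed
    have "(\<integral>x. norm (?f n x) \<partial>\<mu>) \<le> (t\<^sup>2) ^ n / fact n" for n
    proof -
      have "(\<integral>x. norm (?f n x) \<partial>\<mu>) = (\<integral>x. (t\<^sup>2) ^ n / fact (2 * n) * x ^ n \<partial>\<mu>)"
      proof (intro integral_cong_AE)
        show "AE x in \<mu>. norm (?f n x) = (t\<^sup>2) ^ n / fact (2 * n) * x ^ n"
          using nn by eventually_elim (simp add: abs_mult power_mult[of t 2 n] power_abs)
      qed auto
      also have "\<dots> = (t\<^sup>2) ^ n * (fact n / fact (2 * n))"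
        by (simp add: mom)
      also have "\<dots> \<le> (t\<^sup>2) ^ n * (1 / fact n)"
      proof (intro mult_left_mono)
        have "(fact n * fact n :: real) \<le> fact (2 * n)"
          using fact_fact_dvd_fact[of n n, where 'a = nat]
          by (metis dvd_imp_le fact_nonzero mult_2 neq0_conv of_nat_fact of_nat_le_iff of_nat_mult)
        then show "fact n / fact (2 * n) \<le> (1 / fact n :: real)"
          by (simp add: field_simps)
      qed auto
      finally show ?thesis by simp
    qed
    then show "summable (\<lambda>n. \<integral>x. norm (?f n x) \<partial>\<mu>)"
      by (intro summable_comparison_test'[OF summable_power_div_fact[of "t\<^sup>2"], of 0]) simp
  qed
  moreover have "(\<integral>x. (\<Sum>n. ?f n x) \<partial>\<mu>) = (\<integral>x. cos (t * sqrt x) \<partial>\<mu>)"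
  proof (intro integral_cong_AE)
    show "AE x in \<mu>. (\<Sum>n. ?f n x) = cos (t * sqrt x)"
      using nn
    proof eventually_elim
      case (elim x)
      have "(\<lambda>n. ?f n x) sums cos (t * sqrt x)"
        using cos_paired[of "t * sqrt x"] elim
        by (simp add: power_mult_distrib power_mult[of _ 2] mult.assoc)
      then show ?case by (rule sums_unique[symmetric])
    qed
  qed auto
  moreover have "integral\<^sup>L \<mu> (?f n) = (- 1) ^ n * t ^ (2 * n) * fact n / fact (2 * n)" for n
    by (simp add: mom)
  ultimately show ?thesis by (simp add: mom)
qed

lemma gaussian_cos: "(\<integral>s. cos (s * y) \<partial>std_normal_distribution) = exp (- y\<^sup>2 / 2)"
proof -
  interpret real_distribution std_normal_distribution by (rule real_dist_normal_dist)
  have "complex_of_real (exp (- y\<^sup>2 / 2)) = (\<integral>s. iexp (y * s) \<partial>std_normal_distribution)"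
    using fun_cong[OF char_std_normal_distribution, of y] by (simp add: char_def)
  then have "exp (- y\<^sup>2 / 2) = Re (\<integral>s. iexp (y * s) \<partial>std_normal_distribution)"
    by (metis Re_complex_of_real)
  also have "\<dots> = (\<integral>s. Re (iexp (y * s)) \<partial>std_normal_distribution)"
    by (rule integral_Re[symmetric]) (rule integrable_iexp, auto)
  also have "\<dots> = (\<integral>s. cos (s * y) \<partial>std_normal_distribution)"
    by (simp add: Re_exp mult.commute)
  finally show ?thesis by simp
qed

lemma factorial_moments_unique:
  fixes \<mu> \<nu> :: "real measure"
  assumes "real_distribution \<mu>" "real_distribution \<nu>"
    and nn: "AE x in \<mu>. 0 \<le> x" "AE x in \<nu>. 0 \<le> x"
    and int: "\<And>n::nat. integrable \<mu> (\<lambda>x. x ^ n)" "\<And>n::nat. integrable \<nu> (\<lambda>x. x ^ n)"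
    and mom: "\<And>n::nat. (\<integral>x. x ^ n \<partial>\<mu>) = fact n" "\<And>n::nat. (\<integral>x. x ^ n \<partial>\<nu>) = fact n"
  shows "\<mu> = \<nu>"
proof (rule laplace_unique[OF assms(1-4)])
  fix n :: nat
  define c where "c = sqrt (2 * real n)"
  have cos: "(\<integral>x. cos (t * sqrt x) \<partial>\<mu>) = (\<integral>x. cos (t * sqrt x) \<partial>\<nu>)" for t
    by (intro sums_unique2[OF factorial_moments_cos factorial_moments_cos] assms)
  \<comment> \<open>Averaging cos(s y) over a standard Gaussian s gives exp(-y^2/2), here with y^2 = 2 n x.\<close>
  have "(\<integral>x. exp (- (real n * x)) \<partial>M) = (\<integral>s. (\<integral>x. cos (s * c * sqrt x) \<partial>M) \<partial>std_normal_distribution)"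
    if "real_distribution M" "AE x in M. 0 \<le> x" for M
  proof -
    interpret M: real_distribution M by fact
    interpret G: real_distribution std_normal_distribution by (rule real_dist_normal_dist)
    interpret pair_prob_space M std_normal_distribution ..
    have "(\<integral>x. exp (- (real n * x)) \<partial>M) = (\<integral>x. (\<integral>s. cos (s * c * sqrt x) \<partial>std_normal_distribution) \<partial>M)"
    proof (intro integral_cong_AE)
      show "AE x in M. exp (- (real n * x)) = (\<integral>s. cos (s * c * sqrt x) \<partial>std_normal_distribution)"
        using that(2)
      proof eventually_elim
        case (elim x)
        then show ?case
          using gaussian_cos[of "c * sqrt x"] by (simp add: c_def power_mult_distrib mult.assoc)
      qed
    qed auto
    also have "\<dots> = (\<integral>s. (\<integral>x. cos (s * c * sqrt x) \<partial>M) \<partial>std_normal_distribution)"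
      by (intro Fubini_integral[symmetric] P.integrable_const_bound[of _ 1]) auto
    finally show ?thesis .
  qed
  from this[OF assms(1,3)] this[OF assms(2,4)] cos
  show "(\<integral>x. exp (- (real n * x)) \<partial>\<mu>) = (\<integral>x. exp (- (real n * x)) \<partial>\<nu>)"
    by simp
qed

section \<open>The law of a weight\<close>

lemma pair_prob_spaceI: "prob_space M \<Longrightarrow> prob_space N \<Longrightarrow> pair_prob_space M N"
  by (simp add: pair_prob_space_def pair_sigma_finite_def prob_space_imp_sigma_finite)

section \<open>Laws of the angle and of the exponential variable\<close>

definition angle_law :: "real measure" where
  "angle_law = density lborel (\<lambda>x. indicator {0<..<pi} x / ennreal pi)"

definition exp_law :: "real measure" where
  "exp_law = density lborel (\<lambda>x. ennreal (exponential_density 1 x))"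

lemma sets_angle_law [simp, measurable_cong]: "sets angle_law = sets borel"
  by (simp add: angle_law_def)

lemma sets_exp_law [simp, measurable_cong]: "sets exp_law = sets borel"
  by (simp add: exp_law_def)

lemma space_angle_law [simp]: "space angle_law = UNIV"
  by (simp add: angle_law_def)

lemma space_exp_law [simp]: "space exp_law = UNIV"
  by (simp add: exp_law_def)

lemma nn_integral_angle_law:
  assumes [measurable]: "f \<in> borel_measurable borel"
  shows "(\<integral>\<^sup>+x. f x \<partial>angle_law) = (\<integral>\<^sup>+x. f x * indicator {0<..<pi} x \<partial>lborel) / ennreal pi"
proof -
  have "(\<integral>\<^sup>+x. f x \<partial>angle_law)
      = (\<integral>\<^sup>+x. (f x * indicator {0<..<pi} x) * inverse (ennreal pi) \<partial>lborel)"
    unfolding angle_law_def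
    by (subst nn_integral_density) (auto simp: divide_ennreal_def mult_ac intro!: nn_integral_cong)
  also have "\<dots> = (\<integral>\<^sup>+x. f x * indicator {0<..<pi} x \<partial>lborel) * inverse (ennreal pi)"
    by (rule nn_integral_multc) simp
  finally show ?thesis by (simp add: divide_ennreal_def)
qed

lemma nn_integral_angle_law_has_integral:
  assumes [measurable]: "f \<in> borel_measurable borel"
    and nn: "\<And>x. 0 \<le> x \<Longrightarrow> x \<le> pi \<Longrightarrow> 0 \<le> f x" and int: "(f has_integral I) {0..pi}"
  shows "(\<integral>\<^sup>+x. ennreal (f x) \<partial>angle_law) = ennreal (I / pi)"
proof -
  have I: "I \<ge> 0" using has_integral_nonneg[OF int] nn by auto
  have "AE x in lborel. x \<noteq> (0::real)" "AE x in lborel. x \<noteq> pi"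
    using AE_lborel_singleton by auto
  then have "AE x in lborel. ennreal (f x) * indicator {0<..<pi} x = ennreal (f x) * indicator {0..pi} x"
    by eventually_elim (auto simp: indicator_def)
  then have "(\<integral>\<^sup>+x. ennreal (f x) * indicator {0<..<pi} x \<partial>lborel)
      = (\<integral>\<^sup>+x. ennreal (f x) * indicator {0..pi} x \<partial>lborel)"
    by (rule nn_integral_cong_AE)
  also have "\<dots> = ennreal I"
    by (rule nn_integral_has_integral_lebesgue') (use nn int in auto)
  finally show ?thesis
    using I by (simp add: nn_integral_angle_law divide_ennreal)
qed

lemma prob_space_angle_law: "prob_space angle_law"
proof
  have "((\<lambda>x::real. 1::real) has_integral 1 * (pi - 0)) {0..pi}"
    using has_integral_const_real[of "1::real" 0 pi] by simp
  from nn_integral_angle_law_has_integral[OF _ _ this]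
  have "(\<integral>\<^sup>+x. ennreal 1 \<partial>angle_law) = ennreal (1 * (pi - 0) / pi)" by simp
  then show "emeasure angle_law (space angle_law) = 1"
    by (simp add: nn_integral_const)
qed

lemma prob_space_exp_law: "prob_space exp_law"
  unfolding exp_law_def by (rule prob_space_exponential_density) simp

lemma AE_angle_law: "AE x in angle_law. 0 < x \<and> x < pi"
  unfolding angle_law_def by (subst AE_density) (auto simp: indicator_def)

lemma AE_exp_law: "AE x in exp_law. 0 < x"
proof -
  have "AE x in lborel. x \<noteq> (0::real)"
    using AE_lborel_singleton by auto
  then show ?thesis
    unfolding exp_law_def
    by (subst AE_density) (auto simp: exponential_density_def elim: eventually_mono)
qed

lemma nn_integral_exp_law_powr:
  assumes "c > -1"
  shows "(\<integral>\<^sup>+x. ennreal (x powr c) \<partial>exp_law) = ennreal (Gamma (1 + c))"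
proof -
  have "(\<integral>\<^sup>+x. ennreal (x powr c) \<partial>exp_law)
      = (\<integral>\<^sup>+x. ennreal (exponential_density 1 x) * ennreal (x powr c) \<partial>lborel)"
    unfolding exp_law_def by (subst nn_integral_density) auto
  also have "\<dots> = (\<integral>\<^sup>+x. ennreal (indicator {0..} x * x powr ((1 + c) - 1) / exp x) \<partial>lborel)"
    by (intro nn_integral_cong)
       (auto simp: exponential_density_def indicator_def exp_minus divide_inverse mult.commute simp flip: ennreal_mult')
  also have "\<dots> = ennreal (Gamma (1 + c))"
    using assms by (intro Gamma_conv_nn_integral_real[symmetric]) simp
  finally show ?thesis .
qed

lemma emeasure_exp_law_gt:
  assumes "0 \<le> a"
  shows "emeasure exp_law {a<..} = ennreal (exp (- a))"
proof -
  interpret prob_space exp_law by (rule prob_space_exp_law)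
  have "distributed exp_law lborel (\<lambda>x. x) (exponential_density 1)"
    unfolding distributed_def
    by (auto simp: exp_law_def intro!: distr_id2)
  from exponential_distributedD_gt[OF this assms]
  show ?thesis
    by (simp add: emeasure_eq_measure greaterThan_def)
qed

section \<open>The weight as a function of its angle and its exponential variable\<close>

lemma stable_weight_pos:
  assumes "0 < \<Delta>" "\<Delta> < 1" "0 < \<theta>" "\<theta> < pi" "0 < w"
  shows "0 < stable_weight \<Delta> \<theta> w"
proof -
  have "sin ((1 - \<Delta>) * \<theta>) > 0" "sin (\<theta> * \<Delta>) > 0" "sin \<theta> > 0"
    using sin_scaled_pos[of "1 - \<Delta>" \<theta>] sin_scaled_pos[of \<Delta> \<theta>] sin_gt_zero[of \<theta>] assms
    by (auto simp: mult.commute)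
  then show ?thesis
    using assms unfolding stable_weight_def Let_def by (intro mult_pos_pos divide_pos_pos) auto
qed

text \<open>The exponent \<open>- (1 - \<Delta>)\<close> clears the exponents
  \<open>1 / \<alpha>\<close> and \<open>\<Delta> / \<alpha>\<close> inside the weight and separates
  the angle from the exponential variable, so moments of this power factorise.\<close>

lemma stable_weight_powr:
  assumes "0 < \<Delta>" "\<Delta> < 1" "0 < \<theta>" "\<theta> < pi" "0 < w"
  shows "stable_weight \<Delta> \<theta> w powr (- (1 - \<Delta>)) = w powr \<Delta> * zolotarev (1 - \<Delta>) \<theta>"
proof -
  have pos: "sin ((1 - \<Delta>) * \<theta>) > 0" "sin (\<theta> * \<Delta>) > 0" "sin \<theta> > 0"
    using sin_scaled_pos[of "1 - \<Delta>" \<theta>] sin_scaled_pos[of \<Delta> \<theta>] sin_gt_zero[of \<theta>] assms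
    by (auto simp: mult.commute)
  have "stable_weight \<Delta> \<theta> w powr (- (1 - \<Delta>)) = inverse (stable_weight \<Delta> \<theta> w powr (1 - \<Delta>))"
    by (rule powr_minus)
  also have "stable_weight \<Delta> \<theta> w powr (1 - \<Delta>)
     = sin ((1 - \<Delta>) * \<theta>) powr (1 - \<Delta>) / sin \<theta> * (sin (\<theta> * \<Delta>) powr \<Delta> / w powr \<Delta>)"
    using pos assms by (simp add: stable_weight_def Let_def powr_mult powr_divide powr_powr)
  finally show ?thesis
    using pos assms by (simp add: zolotarev_def field_simps)
qed

lemma stable_weight_measurable [measurable (raw)]:
  assumes [measurable]: "f \<in> borel_measurable M" "g \<in> borel_measurable M"
  shows "(\<lambda>x. stable_weight \<Delta> (f x) (g x)) \<in> borel_measurable M"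
  unfolding stable_weight_def Let_def
  by (intro borel_measurable_times borel_measurable_divide powr_real_measurable) measurable

lemma zolotarev_measurable [measurable]: "zolotarev \<alpha> \<in> borel_measurable borel"
  unfolding zolotarev_def[abs_def] by measurable

definition weight_law :: "(real \<times> real) measure" where
  "weight_law = angle_law \<Otimes>\<^sub>M exp_law"

lemma sets_weight_law [simp, measurable_cong]: "sets weight_law = sets (borel \<Otimes>\<^sub>M borel)"
  unfolding weight_law_def by (rule sets_pair_measure_cong) simp_all

lemma prob_space_weight_law: "prob_space weight_law"
proof -
  interpret pair_prob_space angle_law exp_law
    by (intro pair_prob_spaceI prob_space_angle_law prob_space_exp_law)
  show ?thesis unfolding weight_law_def by (rule P.prob_space_axioms)
qed

lemma AE_weight_law: "AE x in weight_law. 0 < fst x \<and> fst x < pi \<and> 0 < snd x"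
proof -
  interpret pair_prob_space angle_law exp_law
    by (intro pair_prob_spaceI prob_space_angle_law prob_space_exp_law)
  have "AE x in angle_law. AE y in exp_law. 0 < fst (x, y) \<and> fst (x, y) < pi \<and> 0 < snd (x, y)"
    using AE_angle_law
  proof eventually_elim
    case (elim x)
    show ?case using AE_exp_law by eventually_elim (use elim in auto)
  qed
  moreover have "{x \<in> space (angle_law \<Otimes>\<^sub>M exp_law). 0 < fst x \<and> fst x < pi \<and> 0 < snd x}
      \<in> sets (angle_law \<Otimes>\<^sub>M exp_law)"
    by measurable
  ultimately show ?thesis
    unfolding weight_law_def by (intro AE_pair_measure)
qed

lemma nn_integral_weight_law_prod:
  assumes [measurable]: "f \<in> borel_measurable borel" "g \<in> borel_measurable borel"
  shows "(\<integral>\<^sup>+x. f (fst x) * g (snd x) \<partial>weight_law) = (\<integral>\<^sup>+x. f x \<partial>angle_law) * (\<integral>\<^sup>+x. g x \<partial>exp_law)"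
proof -
  interpret pair_prob_space angle_law exp_law
    by (intro pair_prob_spaceI prob_space_angle_law prob_space_exp_law)
  have "(\<integral>\<^sup>+x. f (fst x) * g (snd x) \<partial>weight_law)
      = (\<integral>\<^sup>+x. \<integral>\<^sup>+y. f x * g y \<partial>exp_law \<partial>angle_law)"
    unfolding weight_law_def by (subst M2.nn_integral_fst[symmetric]) auto
  also have "\<dots> = (\<integral>\<^sup>+x. f x \<partial>angle_law) * (\<integral>\<^sup>+x. g x \<partial>exp_law)"
    by (simp add: nn_integral_cmult nn_integral_multc)
  finally show ?thesis .
qed

text \<open>The variable \<open>(w' / S)\<^sup>\<alpha>\<close>, with \<open>S\<close> a weight and \<open>w'\<close> an independent standard
  exponential, is standard exponential; its tail is the Laplace transform of \<open>S\<close>.\<close>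

definition exp_ratio :: "real \<Rightarrow> (real \<times> real) \<times> real \<Rightarrow> real" where
  "exp_ratio \<Delta> x = snd x powr (1 - \<Delta>) * stable_weight \<Delta> (fst (fst x)) (snd (fst x)) powr (- (1 - \<Delta>))"

lemma exp_ratio_measurable [measurable]:
  "exp_ratio \<Delta> \<in> borel_measurable ((borel \<Otimes>\<^sub>M borel) \<Otimes>\<^sub>M borel)"
  unfolding exp_ratio_def[abs_def] by measurable

lemma nn_integral_exp_ratio_powr:
  assumes "0 < \<Delta>" "\<Delta> < 1" "0 \<le> q"
  shows "(\<integral>\<^sup>+x. ennreal (exp_ratio \<Delta> x powr q) \<partial>(weight_law \<Otimes>\<^sub>M exp_law))
    = (\<integral>\<^sup>+x. ennreal (stable_weight \<Delta> (fst x) (snd x) powr (- (1 - \<Delta>) * q)) \<partial>weight_law) * ennreal (Gamma (1 + (1 - \<Delta>) * q))"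
proof -
  interpret pair_prob_space weight_law exp_law
    by (intro pair_prob_spaceI prob_space_weight_law prob_space_exp_law)
  have "(\<integral>\<^sup>+x. ennreal (exp_ratio \<Delta> x powr q) \<partial>(weight_law \<Otimes>\<^sub>M exp_law))
      = (\<integral>\<^sup>+x. \<integral>\<^sup>+y. ennreal (exp_ratio \<Delta> (x, y) powr q) \<partial>exp_law \<partial>weight_law)"
    by (subst M2.nn_integral_fst[symmetric]) auto
  also have "\<dots> = (\<integral>\<^sup>+x. \<integral>\<^sup>+y. ennreal (stable_weight \<Delta> (fst x) (snd x) powr (- (1 - \<Delta>) * q))
                        * ennreal (y powr ((1 - \<Delta>) * q)) \<partial>exp_law \<partial>weight_law)"
  proof (intro nn_integral_cong)
    fix x :: "real \<times> real" and y :: real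
    have "exp_ratio \<Delta> (x, y) powr q = y powr ((1 - \<Delta>) * q) * stable_weight \<Delta> (fst x) (snd x) powr (- (1 - \<Delta>) * q)"
      unfolding exp_ratio_def fst_conv snd_conv by (subst powr_mult) (simp_all only: powr_powr powr_ge_zero)
    then show "ennreal (exp_ratio \<Delta> (x, y) powr q)
        = ennreal (stable_weight \<Delta> (fst x) (snd x) powr (- (1 - \<Delta>) * q)) * ennreal (y powr ((1 - \<Delta>) * q))"
      by (simp only: ennreal_mult powr_ge_zero mult.commute[of "ennreal (stable_weight _ _ _ powr _)"])
  qed
  also have "\<dots> = (\<integral>\<^sup>+x. ennreal (stable_weight \<Delta> (fst x) (snd x) powr (- (1 - \<Delta>) * q)) \<partial>weight_law)
                  * (\<integral>\<^sup>+y. ennreal (y powr ((1 - \<Delta>) * q)) \<partial>exp_law)"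
    by (simp add: nn_integral_cmult nn_integral_multc)
  also have "(\<integral>\<^sup>+y. ennreal (y powr ((1 - \<Delta>) * q)) \<partial>exp_law) = ennreal (Gamma (1 + (1 - \<Delta>) * q))"
  proof (rule nn_integral_exp_law_powr)
    show "- 1 < (1 - \<Delta>) * q" using mult_nonneg_nonneg[of "1 - \<Delta>" q] assms by linarith
  qed
  finally show ?thesis .
qed

lemma exp_law_real_distribution: "real_distribution exp_law"
  unfolding real_distribution_def real_distribution_axioms_def
  using prob_space_exp_law by simp

lemma moments_from_nn_integral:
  assumes "real_distribution \<mu>" and nn: "AE x in \<mu>. 0 \<le> x"
    and "\<And>n::nat. (\<integral>\<^sup>+x. ennreal (x ^ n) \<partial>\<mu>) = ennreal (m n)" "\<And>n. 0 \<le> m n"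
  shows "integrable \<mu> (\<lambda>x. x ^ n)" "(\<integral>x. x ^ n \<partial>\<mu>) = m n"
proof -
  interpret real_distribution \<mu> by fact
  have AE: "AE x in \<mu>. 0 \<le> x ^ n" using nn by eventually_elim simp
  show "integrable \<mu> (\<lambda>x. x ^ n)"
    using AE assms(3)[of n] by (intro integrableI_nonneg) auto
  show "(\<integral>x. x ^ n \<partial>\<mu>) = m n"
    using AE assms(3)[of n] assms(4)[of n] by (subst integral_eq_nn_integral) auto
qed

lemma exp_law_moment: "(\<integral>\<^sup>+x. ennreal (x ^ n) \<partial>exp_law) = ennreal (fact n)"
proof -
  have "(\<integral>\<^sup>+x. ennreal (x ^ n) \<partial>exp_law) = (\<integral>\<^sup>+x. ennreal (x powr n) \<partial>exp_law)"
  proof (rule nn_integral_cong_AE)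
    show "AE x in exp_law. ennreal (x ^ n) = ennreal (x powr real n)"
      using AE_exp_law by eventually_elim (simp add: powr_realpow)
  qed
  also have "\<dots> = ennreal (Gamma (1 + real n))"
    by (rule nn_integral_exp_law_powr) simp
  finally show ?thesis by (simp add: Gamma_fact)
qed

text \<open>For integer \<open>n\<close> the exponential variable inside the weight contributes
  \<open>Gamma (1 + \<Delta> * n)\<close>, which cancels one Gamma factor of the integral over the
  angle; the independent exponential variable cancels the other,
  \<open>Gamma (1 + (1 - \<Delta>) * n)\<close>. What remains is \<open>fact n\<close>.\<close>

lemma distr_exp_ratio:
  assumes "0 < \<Delta>" "\<Delta> < 1"
  shows "distr (weight_law \<Otimes>\<^sub>M exp_law) borel (exp_ratio \<Delta>) = exp_law"
proof -
  interpret pair_prob_space weight_law exp_law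
    by (intro pair_prob_spaceI prob_space_weight_law prob_space_exp_law)
  let ?P = "weight_law \<Otimes>\<^sub>M exp_law" and ?\<alpha> = "1 - \<Delta>"
  have nn: "0 \<le> exp_ratio \<Delta> x" for x by (simp add: exp_ratio_def)
  have rd: "real_distribution (distr ?P borel (exp_ratio \<Delta>))"
    by (rule P.real_distribution_distr) simp
  have nnD: "AE x in distr ?P borel (exp_ratio \<Delta>). 0 \<le> x"
    by (subst AE_distr_iff) (auto simp: nn)
  have mom: "(\<integral>\<^sup>+x. ennreal (x ^ n) \<partial>distr ?P borel (exp_ratio \<Delta>)) = ennreal (fact n)" for n
  proof -
    have G: "Gamma (1 + ?\<alpha> * n) > 0" "Gamma (1 + \<Delta> * n) > 0"
      using assms by (auto intro!: Gamma_real_pos add_pos_nonneg)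
    have "(\<integral>\<^sup>+x. ennreal (stable_weight \<Delta> (fst x) (snd x) powr (- ?\<alpha> * n)) \<partial>weight_law)
        = (\<integral>\<^sup>+x. ennreal (zolotarev ?\<alpha> (fst x) ^ n) * ennreal (snd x powr (\<Delta> * n)) \<partial>weight_law)"
    proof (rule nn_integral_cong_AE)
      show "AE x in weight_law. ennreal (stable_weight \<Delta> (fst x) (snd x) powr (- ?\<alpha> * n))
          = ennreal (zolotarev ?\<alpha> (fst x) ^ n) * ennreal (snd x powr (\<Delta> * n))"
        using AE_weight_law
      proof eventually_elim
        case (elim x)
        then have S: "0 < stable_weight \<Delta> (fst x) (snd x)"
          using assms by (intro stable_weight_pos) auto
        have "stable_weight \<Delta> (fst x) (snd x) powr (- ?\<alpha> * n)
            = (stable_weight \<Delta> (fst x) (snd x) powr (- ?\<alpha>)) ^ n"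
          using S by (subst powr_powr[symmetric]) (simp add: powr_realpow)
        also have "\<dots> = (snd x powr \<Delta> * zolotarev ?\<alpha> (fst x)) ^ n"
          using stable_weight_powr[of \<Delta> "fst x" "snd x"] elim assms by simp
        also have "\<dots> = zolotarev ?\<alpha> (fst x) ^ n * snd x powr (\<Delta> * n)"
          using elim by (simp add: power_mult_distrib powr_power mult.commute)
        finally show ?case by (simp add: ennreal_mult'' )
      qed
    qed
    also have "\<dots> = (\<integral>\<^sup>+x. ennreal (zolotarev ?\<alpha> x ^ n) \<partial>angle_law) * (\<integral>\<^sup>+x. ennreal (x powr (\<Delta> * n)) \<partial>exp_law)"
      by (rule nn_integral_weight_law_prod[of "\<lambda>x. ennreal (zolotarev ?\<alpha> x ^ n)"]) auto
    also have "(\<integral>\<^sup>+x. ennreal (x powr (\<Delta> * n)) \<partial>exp_law) = ennreal (Gamma (1 + \<Delta> * n))"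
      using assms by (intro nn_integral_exp_law_powr) (smt (verit) mult_nonneg_nonneg of_nat_0_le_iff)
    also have "(\<integral>\<^sup>+x. ennreal (zolotarev ?\<alpha> x ^ n) \<partial>angle_law)
        = ennreal (pi * fact n / (Gamma (1 + ?\<alpha> * n) * Gamma (1 + (1 - ?\<alpha>) * n)) / pi)"
      using assms
      by (intro nn_integral_angle_law_has_integral zolotarev_integral zero_le_power zolotarev_nonneg) auto
    finally have S: "(\<integral>\<^sup>+x. ennreal (stable_weight \<Delta> (fst x) (snd x) powr (- ?\<alpha> * n)) \<partial>weight_law)
        = ennreal (fact n / Gamma (1 + ?\<alpha> * n))"
      using G by (simp flip: ennreal_mult'')
    have "(\<integral>\<^sup>+x. ennreal (x ^ n) \<partial>distr ?P borel (exp_ratio \<Delta>)) = (\<integral>\<^sup>+x. ennreal (exp_ratio \<Delta> x ^ n) \<partial>?P)"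
      by (subst nn_integral_distr) auto
    also have "\<dots> = (\<integral>\<^sup>+x. ennreal (exp_ratio \<Delta> x powr n) \<partial>?P)"
    proof (rule nn_integral_cong_AE)
      have "AE x in ?P. 0 < fst (fst x) \<and> fst (fst x) < pi \<and> 0 < snd (fst x) \<and> 0 < snd x"
      proof -
        have "AE x in weight_law. AE y in exp_law. 0 < fst (fst (x, y)) \<and> fst (fst (x, y)) < pi
            \<and> 0 < snd (fst (x, y)) \<and> 0 < snd (x, y)"
          using AE_weight_law
        proof eventually_elim
          case (elim x)
          show ?case using AE_exp_law by eventually_elim (use elim in auto)
        qed
        moreover have "{x \<in> space ?P. 0 < fst (fst x) \<and> fst (fst x) < pi \<and> 0 < snd (fst x) \<and> 0 < snd x}
            \<in> sets ?P"
          by measurable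
        ultimately show ?thesis by (intro AE_pair_measure)
      qed
      then show "AE x in ?P. ennreal (exp_ratio \<Delta> x ^ n) = ennreal (exp_ratio \<Delta> x powr real n)"
      proof eventually_elim
        case (elim x)
        then have "0 < stable_weight \<Delta> (fst (fst x)) (snd (fst x))"
          using assms by (intro stable_weight_pos) auto
        then have "0 < exp_ratio \<Delta> x" using elim by (simp add: exp_ratio_def)
        then show ?case by (simp add: powr_realpow)
      qed
    qed
    also have "\<dots> = ennreal (fact n)"
      using nn_integral_exp_ratio_powr[of \<Delta> "real n"] assms S G by (simp flip: ennreal_mult'')
    finally show ?thesis .
  qed
  have nnE: "AE x in exp_law. 0 \<le> x" using AE_exp_law by eventually_elim simp
  show ?thesis
    using moments_from_nn_integral[OF rd nnD mom] moments_from_nn_integral[OF exp_law_real_distribution nnE exp_law_moment]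
    by (intro factorial_moments_unique[OF rd exp_law_real_distribution nnD nnE]) simp_all
qed

text \<open>Real \<open>q\<close> is within reach because the whole law of \<open>exp_ratio\<close>
  is known and not only its integer moments. Dividing its moment by that of the independent
  exponential factor isolates the weight. The instance of interest is
  \<open>q = m / \<Delta>\<close>.\<close>

lemma nn_integral_stable_weight_powr:
  assumes "0 < \<Delta>" "\<Delta> < 1" "0 \<le> q"
  shows "(\<integral>\<^sup>+x. ennreal (stable_weight \<Delta> (fst x) (snd x) powr (- (1 - \<Delta>) * q)) \<partial>weight_law)
    = ennreal (Gamma (1 + q) / Gamma (1 + (1 - \<Delta>) * q))"
proof -
  let ?I = "\<integral>\<^sup>+x. ennreal (stable_weight \<Delta> (fst x) (snd x) powr (- (1 - \<Delta>) * q)) \<partial>weight_law"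
  have G: "Gamma (1 + (1 - \<Delta>) * q) > 0"
    using assms by (auto intro!: Gamma_real_pos add_pos_nonneg)
  have "(\<integral>\<^sup>+x. ennreal (exp_ratio \<Delta> x powr q) \<partial>(weight_law \<Otimes>\<^sub>M exp_law))
      = (\<integral>\<^sup>+x. ennreal (x powr q) \<partial>distr (weight_law \<Otimes>\<^sub>M exp_law) borel (exp_ratio \<Delta>))"
    by (subst nn_integral_distr) auto
  also have "\<dots> = ennreal (Gamma (1 + q))"
    unfolding distr_exp_ratio[OF assms(1,2)] using assms by (intro nn_integral_exp_law_powr) simp
  finally have "?I * ennreal (Gamma (1 + (1 - \<Delta>) * q)) = ennreal (Gamma (1 + q))"
    unfolding nn_integral_exp_ratio_powr[OF assms] .
  then have "?I * ennreal (Gamma (1 + (1 - \<Delta>) * q)) / ennreal (Gamma (1 + (1 - \<Delta>) * q))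
     = ennreal (Gamma (1 + q)) / ennreal (Gamma (1 + (1 - \<Delta>) * q))"
    by simp
  then show ?thesis
    using G assms Gamma_real_pos[of "1 + q"] by (simp add: ennreal_mult_divide_eq divide_ennreal)
qed

text \<open>Almost surely \<open>exp_ratio\<close> exceeds \<open>s powr (1 - \<Delta>)\<close>
  exactly when the independent exponential variable exceeds \<open>s\<close> times the weight.
  Conditioning on the weight turns the probability of this event into the Laplace transform, and the
  exponential law of \<open>exp_ratio\<close> evaluates it.\<close>

lemma stable_weight_laplace:
  assumes "0 < \<Delta>" "\<Delta> < 1" "0 \<le> s"
  shows "(\<integral>x. exp (- (s * stable_weight \<Delta> (fst x) (snd x))) \<partial>weight_law) = exp (- (s powr (1 - \<Delta>)))"
proof (cases "s = 0")
  case True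
  interpret prob_space weight_law by (rule prob_space_weight_law)
  show ?thesis using True prob_space assms by simp
next
  case False
  with assms have s: "0 < s" by simp
  interpret pair_prob_space weight_law exp_law
    by (intro pair_prob_spaceI prob_space_weight_law prob_space_exp_law)
  let ?P = "weight_law \<Otimes>\<^sub>M exp_law" and ?\<alpha> = "1 - \<Delta>"
  let ?S = "\<lambda>x. stable_weight \<Delta> (fst x) (snd x)"
  have "ennreal (exp (- (s powr ?\<alpha>))) = emeasure exp_law {s powr ?\<alpha><..}"
    by (rule emeasure_exp_law_gt[symmetric]) simp
  also have "\<dots> = emeasure (distr ?P borel (exp_ratio \<Delta>)) {s powr ?\<alpha><..}"
    using assms by (simp add: distr_exp_ratio)
  also have "\<dots> = (\<integral>\<^sup>+x. indicator {s powr ?\<alpha><..} (exp_ratio \<Delta> x) \<partial>?P)"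
    by (subst nn_integral_indicator[symmetric], simp, subst nn_integral_distr) auto
  also have "\<dots> = (\<integral>\<^sup>+x. \<integral>\<^sup>+y. indicator {s powr ?\<alpha><..} (exp_ratio \<Delta> (x, y)) \<partial>exp_law \<partial>weight_law)"
    by (subst M2.nn_integral_fst[symmetric]) auto
  also have "\<dots> = (\<integral>\<^sup>+x. ennreal (exp (- (s * ?S x))) \<partial>weight_law)"
  proof (rule nn_integral_cong_AE)
    show "AE x in weight_law. (\<integral>\<^sup>+y. indicator {s powr ?\<alpha><..} (exp_ratio \<Delta> (x, y)) \<partial>exp_law)
        = ennreal (exp (- (s * ?S x)))"
      using AE_weight_law
    proof eventually_elim
      case (elim x)
      then have S: "0 < ?S x" using assms by (intro stable_weight_pos) auto
      have "(\<integral>\<^sup>+y. indicator {s powr ?\<alpha><..} (exp_ratio \<Delta> (x, y)) \<partial>exp_law)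
          = (\<integral>\<^sup>+y. indicator {s * ?S x<..} y \<partial>exp_law)"
      proof (rule nn_integral_cong_AE)
        show "AE y in exp_law. indicator {s powr ?\<alpha><..} (exp_ratio \<Delta> (x, y))
            = (indicator {s * ?S x<..} y :: ennreal)"
          using AE_exp_law
        proof eventually_elim
          case (elim y)
          have "s powr ?\<alpha> < exp_ratio \<Delta> (x, y) \<longleftrightarrow> s powr ?\<alpha> < (y / ?S x) powr ?\<alpha>"
          proof -
            have "(y / ?S x) powr ?\<alpha> = y powr ?\<alpha> / ?S x powr ?\<alpha>"
              using S elim by (simp add: powr_divide)
            then have "exp_ratio \<Delta> (x, y) = (y / ?S x) powr ?\<alpha>"
              by (simp only: exp_ratio_def fst_conv snd_conv powr_minus divide_inverse)
            then show ?thesis by simp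
          qed
          also have "\<dots> \<longleftrightarrow> s < y / ?S x"
          proof
            assume "s < y / ?S x"
            then show "s powr ?\<alpha> < (y / ?S x) powr ?\<alpha>"
              using s assms by (intro powr_less_mono2) auto
          next
            assume *: "s powr ?\<alpha> < (y / ?S x) powr ?\<alpha>"
            show "s < y / ?S x"
            proof (rule ccontr)
              assume "\<not> s < y / ?S x"
              then have "(y / ?S x) powr ?\<alpha> \<le> s powr ?\<alpha>"
                using S elim assms by (intro powr_mono2) auto
              with * show False by simp
            qed
          qed
          also have "\<dots> \<longleftrightarrow> s * ?S x < y"
            using S by (simp add: field_simps)
          finally show ?case by (simp add: indicator_def)
        qed
      qed
      also have "\<dots> = ennreal (exp (- (s * ?S x)))"
        using S s by (simp add: emeasure_exp_law_gt)
      finally show ?case .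
    qed
  qed
  finally show ?thesis
    by (subst integral_eq_nn_integral) (auto dest: sym)
qed

section \<open>Moments of the normalised score\<close>

definition unit_score :: "real \<Rightarrow> real \<times> real \<Rightarrow> real" where
  "unit_score \<Delta> x = \<Delta> * stable_weight \<Delta> (fst x) (snd x) powr (- (1 - \<Delta>) / \<Delta>)"

lemma unit_score_measurable [measurable]: "unit_score \<Delta> \<in> borel_measurable (borel \<Otimes>\<^sub>M borel)"
  unfolding unit_score_def[abs_def] by measurable

lemma AE_unit_score_pos:
  assumes "0 < \<Delta>" "\<Delta> < 1"
  shows "AE x in weight_law. 0 < unit_score \<Delta> x"
  using AE_weight_law
proof eventually_elim
  case (elim x)
  then have "0 < stable_weight \<Delta> (fst x) (snd x)"
    using assms by (intro stable_weight_pos) auto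
  then show ?case using assms by (simp add: unit_score_def)
qed

lemma Gamma_falling_factorial:
  fixes x :: real
  assumes "real m < x + 1"
  shows "Gamma (1 + x) = (\<Prod>l<m. x - real l) * Gamma (1 + x - real m)"
  using assms
proof (induction m)
  case 0
  then show ?case by simp
next
  case (Suc m)
  have "Gamma (1 + x - real m) = (x - real m) * Gamma (x - real m)"
    using Gamma_plus1[of "x - real m"] Suc.prems by (auto simp: add.commute algebra_simps nonpos_Ints_def)
  with Suc show ?case by simp
qed

text \<open>For \<open>q = m / \<Delta>\<close> the two Gamma arguments differ by the integer
  \<open>m\<close>, so their quotient is a falling factorial with \<open>m\<close> factors, and
  \<open>\<Delta> ^ m\<close> clears the denominators.\<close>

lemma unit_score_moment:
  assumes "0 < \<Delta>" "\<Delta> < 1" "0 < m"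
  shows "(\<integral>\<^sup>+x. ennreal (unit_score \<Delta> x ^ m) \<partial>weight_law) = ennreal (\<Prod>l<m. real m - real l * \<Delta>)"
proof -
  let ?q = "real m / \<Delta>" and ?\<alpha> = "1 - \<Delta>"
  have q: "real m < ?q" using assms by (simp add: field_simps)
  have "(\<integral>\<^sup>+x. ennreal (unit_score \<Delta> x ^ m) \<partial>weight_law)
      = (\<integral>\<^sup>+x. ennreal (\<Delta> ^ m) * ennreal (stable_weight \<Delta> (fst x) (snd x) powr (- ?\<alpha> * ?q)) \<partial>weight_law)"
  proof (rule nn_integral_cong_AE)
    show "AE x in weight_law. ennreal (unit_score \<Delta> x ^ m)
        = ennreal (\<Delta> ^ m) * ennreal (stable_weight \<Delta> (fst x) (snd x) powr (- ?\<alpha> * ?q))"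
      using AE_weight_law
    proof eventually_elim
      case (elim x)
      then have S: "0 < stable_weight \<Delta> (fst x) (snd x)"
        using assms by (intro stable_weight_pos) auto
      have "unit_score \<Delta> x ^ m = \<Delta> ^ m * stable_weight \<Delta> (fst x) (snd x) powr (real m * (- ?\<alpha> / \<Delta>))"
        using S by (simp add: unit_score_def power_mult_distrib powr_power)
      also have "real m * (- ?\<alpha> / \<Delta>) = - ?\<alpha> * ?q"
        by simp
      finally show ?case using assms by (simp add: ennreal_mult)
    qed
  qed
  also have "\<dots> = ennreal (\<Delta> ^ m) * ennreal (Gamma (1 + ?q) / Gamma (1 + ?\<alpha> * ?q))"
    using assms nn_integral_stable_weight_powr[of \<Delta> ?q] by (subst nn_integral_cmult) auto
  also have "1 + ?\<alpha> * ?q = 1 + ?q - real m"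
    using assms by (simp add: field_simps)
  also have "Gamma (1 + ?q) / Gamma (1 + ?q - real m) = (\<Prod>l<m. ?q - real l)"
  proof -
    have "Gamma (1 + ?q - real m) > 0" using q by (intro Gamma_real_pos) simp
    then have "Gamma (1 + ?q - real m) \<noteq> 0" by (rule less_imp_neq[symmetric])
    then show ?thesis using Gamma_falling_factorial[of m ?q] q by simp
  qed
  also have "ennreal (\<Delta> ^ m) * ennreal (\<Prod>l<m. ?q - real l) = ennreal (\<Delta> ^ m * (\<Prod>l<m. ?q - real l))"
    using assms by (simp add: ennreal_mult')
  also have "\<Delta> ^ m * (\<Prod>l<m. ?q - real l) = (\<Prod>l<m. \<Delta> * (?q - real l))"
    by (simp add: prod.distrib)
  also have "\<dots> = (\<Prod>l<m. real m - real l * \<Delta>)"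
    using assms by (intro prod.cong) (auto simp: field_simps)
  finally show ?thesis .
qed

section \<open>The blow-up of the negative power near zero, uniformly in \<Delta>\<close>

definition lower_dev :: "real \<Rightarrow> real \<Rightarrow> real" where
  "lower_dev \<Delta> y = max 0 ((y powr (- \<Delta>) - 1) / \<Delta>)"

lemma lower_dev_measurable [measurable]: "lower_dev \<Delta> \<in> borel_measurable borel"
  unfolding lower_dev_def[abs_def] by measurable

lemma lower_dev_nonneg: "0 \<le> lower_dev \<Delta> y"
  by (simp add: lower_dev_def)

text \<open>Convexity of \<open>exp\<close> between 0 and \<open>ln c\<close>. With
  \<open>p = \<Delta>\<close> the bound yields the factor \<open>\<Delta>\<close> that compensates
  the division in \<open>lower_dev\<close>.\<close>

lemma powr_le_Bernoulli:
  fixes c p :: real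
  assumes "0 < c" "0 \<le> p" "p \<le> 1"
  shows "c powr p \<le> 1 + p * (c - 1)"
proof -
  have "exp ((1 - p) * 0 + p * ln c) \<le> (1 - p) * exp 0 + p * exp (ln c)"
    using convex_onD[OF exp_convex, of p 0 "ln c"] assms by simp
  then show ?thesis using assms by (simp add: powr_def algebra_simps)
qed

text \<open>The factor \<open>(1 + \<Delta> \<pi> / sin \<theta>)\<close> comes from
  \<open>sin ((1 - \<Delta>) \<theta>) \<le> sin \<theta> + \<Delta> \<pi>\<close>.\<close>

lemma lower_dev_unit_score_le:
  assumes "0 < \<Delta>" "\<Delta> < 1" "0 < \<theta>" "\<theta> < pi" "0 < w"
  shows "1 + lower_dev \<Delta> (unit_score \<Delta> (\<theta>, w)) \<le> (1 + 1 / w) * (1 + pi / sin \<theta>)\<^sup>2"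
proof -
  let ?\<alpha> = "1 - \<Delta>"
  let ?S = "stable_weight \<Delta> \<theta> w" and ?b = "pi / sin \<theta>"
  have S: "0 < ?S" using assms by (intro stable_weight_pos)
  have pos: "sin (?\<alpha> * \<theta>) > 0" "sin (\<Delta> * \<theta>) > 0" "sin \<theta> > 0"
    using sin_scaled_pos[of ?\<alpha> \<theta>] sin_scaled_pos[of \<Delta> \<theta>] sin_gt_zero[of \<theta>] assms by auto
  have b: "0 < ?b" using pos by simp
  have db: "0 \<le> \<Delta> * ?b" using assms b by (intro mult_nonneg_nonneg) auto
  have sD: "sin (\<Delta> * \<theta>) \<le> \<Delta> * pi"
  proof -
    have "sin (\<Delta> * \<theta>) \<le> \<Delta> * \<theta>" using assms by (intro sin_x_le_x) simp
    also have "\<dots> \<le> \<Delta> * pi" using assms by (intro mult_left_mono) auto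
    finally show ?thesis .
  qed
  have sa: "sin (?\<alpha> * \<theta>) \<le> sin \<theta> + \<Delta> * pi"
  proof -
    have "sin (?\<alpha> * \<theta>) = sin \<theta> * cos (\<Delta> * \<theta>) - cos \<theta> * sin (\<Delta> * \<theta>)"
      by (simp add: left_diff_distrib sin_diff)
    also have "\<dots> \<le> sin \<theta> * 1 - (-1) * sin (\<Delta> * \<theta>)"
      using pos by (intro diff_mono mult_left_mono mult_right_mono) auto
    finally show ?thesis using sD by simp
  qed
  define Y where "Y = unit_score \<Delta> (\<theta>, w)"
  have "Y powr \<Delta> = \<Delta> powr \<Delta> * ?S powr (- ?\<alpha>)"
    using assms S by (simp add: Y_def unit_score_def powr_mult powr_powr)
  also have "\<dots> = \<Delta> powr \<Delta> * (w powr \<Delta> * zolotarev ?\<alpha> \<theta>)"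
    by (simp only: stable_weight_powr[OF assms])
  finally have "Y powr (- \<Delta>) = inverse (\<Delta> powr \<Delta> * (w powr \<Delta> * zolotarev ?\<alpha> \<theta>))"
    by (simp add: powr_minus)
  \<comment> \<open>The normalisation \<open>\<Delta> powr \<Delta>\<close> is joined to the sine of
    \<open>\<Delta> * \<theta>\<close>, because \<open>sin (\<Delta> * \<theta>) / \<Delta>\<close>
    is at most \<open>pi\<close> for every \<open>\<Delta>\<close>.\<close>
  also have "\<dots> = (1 / w) powr \<Delta> * ((sin (\<Delta> * \<theta>) / \<Delta>) powr \<Delta> * sin (?\<alpha> * \<theta>) powr ?\<alpha> / sin \<theta>)"
    using assms pos by (simp add: zolotarev_def powr_divide field_simps)
  also have "\<dots> \<le> (1 / w) powr \<Delta> * (pi powr \<Delta> * (sin \<theta> + \<Delta> * pi) powr ?\<alpha> / sin \<theta>)"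
    using assms pos sa sD
    by (intro mult_left_mono divide_right_mono mult_mono powr_mono2) (auto simp: field_simps)
  also have "pi powr \<Delta> * (sin \<theta> + \<Delta> * pi) powr ?\<alpha> / sin \<theta> = ?b powr \<Delta> * (1 + \<Delta> * ?b) powr ?\<alpha>"
  proof -
    have "sin \<theta> + \<Delta> * pi = sin \<theta> * (1 + \<Delta> * ?b)" using pos by (simp add: field_simps)
    then have "(sin \<theta> + \<Delta> * pi) powr ?\<alpha> = sin \<theta> powr ?\<alpha> * (1 + \<Delta> * ?b) powr ?\<alpha>"
      using pos assms b by (simp add: powr_mult)
    also have "sin \<theta> powr ?\<alpha> = sin \<theta> / sin \<theta> powr \<Delta>"
      using pos by (simp add: powr_diff)
    finally show ?thesis using pos by (simp add: powr_divide)
  qed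
  also have "(1 / w) powr \<Delta> * (?b powr \<Delta> * (1 + \<Delta> * ?b) powr ?\<alpha>) \<le> (1 + \<Delta> * (1 / w)) * ((1 + \<Delta> * ?b) * (1 + \<Delta> * ?b))"
  proof (intro mult_mono)
    show "(1 / w) powr \<Delta> \<le> 1 + \<Delta> * (1 / w)"
      using powr_le_Bernoulli[of "1 / w" \<Delta>] assms by (simp add: algebra_simps)
    show "?b powr \<Delta> \<le> 1 + \<Delta> * ?b"
      using powr_le_Bernoulli[of ?b \<Delta>] assms b by (simp add: algebra_simps)
    have "(1 + \<Delta> * ?b) powr ?\<alpha> \<le> (1 + \<Delta> * ?b) powr 1"
      using assms db by (intro powr_mono) auto
    then show "(1 + \<Delta> * ?b) powr ?\<alpha> \<le> 1 + \<Delta> * ?b" using db by simp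
  qed (use assms b db in auto)
  finally have *: "Y powr (- \<Delta>) \<le> (1 + \<Delta> * (1 / w)) * ((1 + \<Delta> * ?b) * (1 + \<Delta> * ?b))" .
  \<comment> \<open>As a polynomial in \<open>\<Delta>\<close> the product has nonnegative
    coefficients and constant term 1. Each higher power of \<open>\<Delta>\<close> is at most
    \<open>\<Delta>\<close>, so the increment from 0 is at most \<open>\<Delta>\<close> times the
    increment up to 1.\<close>
  have poly: "(1 + \<Delta> * a) * ((1 + \<Delta> * c) * (1 + \<Delta> * c)) - 1 \<le> \<Delta> * ((1 + a) * (1 + c)\<^sup>2 - 1)"
    if "0 \<le> a" "0 \<le> c" for a c :: real
  proof -
    have "\<Delta> * ((1 + a) * (1 + c)\<^sup>2 - 1) - ((1 + \<Delta> * a) * ((1 + \<Delta> * c) * (1 + \<Delta> * c)) - 1)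
      = \<Delta> * ((1 - \<Delta>) * (c * c + 2 * (a * c)) + (1 - \<Delta>\<^sup>2) * (a * c * c))"
      by (simp add: algebra_simps power2_eq_square)
    moreover have "0 \<le> 1 - \<Delta>\<^sup>2" using assms by (simp add: power_le_one)
    ultimately show ?thesis
      using that assms
      by (smt (verit) mult_nonneg_nonneg)
  qed
  have "(Y powr (- \<Delta>) - 1) / \<Delta> \<le> (1 + 1 / w) * (1 + ?b)\<^sup>2 - 1"
    using * poly[of "1 / w" ?b] assms b by (simp add: pos_divide_le_eq mult.commute)
  moreover have "0 \<le> (1 + 1 / w) * (1 + ?b)\<^sup>2 - 1"
    using assms b mult_mono[of 1 "1 + 1 / w" 1 "(1 + ?b)\<^sup>2"] by (simp add: one_le_power)
  ultimately show ?thesis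
    unfolding Y_def[symmetric] lower_dev_def by simp
qed

lemma nn_integral_inverse_sqrt_sin:
  "(\<integral>\<^sup>+x. ennreal (1 + sqrt (pi / sin x)) \<partial>angle_law) < \<infinity>"
proof -
  have pos: "0 \<le> sin x" if "x \<in> {0..pi}" for x using that by (simp add: sin_ge_zero)
  \<comment> \<open>The factor \<open>\<bar>cos x\<bar>\<close> makes an elementary primitive
    available. \<open>F\<close> glues its branches on the two sides of \<open>pi / 2\<close>; the
    constant 4 makes them meet.\<close>
  define F where "F x = (if x \<le> pi / 2 then 2 * sqrt (sin x) else 4 - 2 * sqrt (sin x))" for x
  have int: "((\<lambda>x. \<bar>cos x\<bar> / sqrt (sin x)) has_integral (F pi - F 0)) {0..pi}"
  proof (rule fundamental_theorem_of_calculus_interior_strong[of "{pi/2}"])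
    show "continuous_on {0..pi} F"
    proof -
      have "continuous_on ({0..pi/2} \<union> {pi/2..pi}) F"
        unfolding F_def
      proof (rule continuous_on_If)
        fix x assume "x \<in> {pi/2..pi}" "x \<le> pi / 2"
        then have x: "x = pi / 2" by simp
        show "2 * sqrt (sin x) = 4 - 2 * sqrt (sin x)" unfolding x by simp
      next
        fix x assume "x \<in> {0..pi/2}" "\<not> x \<le> pi / 2"
        then show "2 * sqrt (sin x) = 4 - 2 * sqrt (sin x)" by simp
      qed (auto intro!: continuous_intros)
      moreover have "{0..pi/2} \<union> {pi/2..pi} = {0..pi}" by auto
      ultimately show ?thesis by simp
    qed
    fix x assume x: "x \<in> {0<..<pi} - {pi/2}"
    then have s: "sin x > 0" by (simp add: sin_gt_zero)
    show "(F has_vector_derivative \<bar>cos x\<bar> / sqrt (sin x)) (at x)"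
    proof (cases "x < pi / 2")
      case True
      have c: "cos x > 0" using x True by (intro cos_gt_zero_pi) auto
      have "((\<lambda>x. 2 * sqrt (sin x)) has_real_derivative \<bar>cos x\<bar> / sqrt (sin x)) (at x)"
        using s c by (auto intro!: derivative_eq_intros simp: field_simps)
      then have "(F has_real_derivative \<bar>cos x\<bar> / sqrt (sin x)) (at x)"
        by (rule has_field_derivative_transform_within_open[of _ _ _ "{..<pi/2}"]) (use True in \<open>auto simp: F_def\<close>)
      then show ?thesis by (simp add: has_real_derivative_iff_has_vector_derivative)
    next
      case False
      have c: "cos x < 0" using cos_gt_zero_pi[of "pi - x"] x False by (auto simp: cos_diff)
      have "((\<lambda>x. 4 - 2 * sqrt (sin x)) has_real_derivative \<bar>cos x\<bar> / sqrt (sin x)) (at x)"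
        using s c by (auto intro!: derivative_eq_intros simp: field_simps)
      then have "(F has_real_derivative \<bar>cos x\<bar> / sqrt (sin x)) (at x)"
        by (rule has_field_derivative_transform_within_open[of _ _ _ "{pi/2<..}"]) (use False x in \<open>auto simp: F_def\<close>)
      then show ?thesis by (simp add: has_real_derivative_iff_has_vector_derivative)
    qed
  qed auto
  \<comment> \<open>Dividing \<open>1 \<le> sqrt (sin x) + \<bar>cos x\<bar>\<close> by
    \<open>sqrt (sin x)\<close> reintroduces the cosine at the price of a constant.\<close>
  have le: "1 + sqrt (pi / sin x) \<le> 1 + sqrt pi + sqrt pi * (\<bar>cos x\<bar> / sqrt (sin x))" if "0 < sin x" for x
  proof -
    have "1 = (sin x)\<^sup>2 + (cos x)\<^sup>2" by simp
    also have "\<dots> \<le> sqrt (sin x) + \<bar>cos x\<bar>"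
    proof (intro add_mono)
      have "(sqrt (sin x)) ^ 4 = (sin x)\<^sup>2"
        using that by (simp add: power4_eq_xxxx power2_eq_square)
      moreover have "(sqrt (sin x)) ^ 4 \<le> (sqrt (sin x)) ^ 1"
        using that by (intro power_decreasing) auto
      ultimately show "(sin x)\<^sup>2 \<le> sqrt (sin x)" by simp
      have "(cos x)\<^sup>2 = \<bar>cos x\<bar> * \<bar>cos x\<bar>" by (simp add: power2_eq_square)
      also have "\<dots> \<le> \<bar>cos x\<bar> * 1" by (intro mult_left_mono) auto
      finally show "(cos x)\<^sup>2 \<le> \<bar>cos x\<bar>" by simp
    qed
    finally have "1 / sqrt (sin x) \<le> 1 + \<bar>cos x\<bar> / sqrt (sin x)"
      using that by (simp add: field_simps)
    then have "sqrt pi * (1 / sqrt (sin x)) \<le> sqrt pi * (1 + \<bar>cos x\<bar> / sqrt (sin x))"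
      by (intro mult_left_mono) auto
    then show ?thesis by (simp add: real_sqrt_divide algebra_simps)
  qed
  have "((\<lambda>x. (1 + sqrt pi) + sqrt pi * (\<bar>cos x\<bar> / sqrt (sin x))) has_integral
      ((1 + sqrt pi) * (pi - 0) + sqrt pi * (F pi - F 0))) {0..pi}"
    using has_integral_const_real[of "1 + sqrt pi" 0 pi]
    by (intro has_integral_add has_integral_mult_right int) (simp add: mult.commute)
  then have fin: "(\<integral>\<^sup>+x. ennreal ((1 + sqrt pi) + sqrt pi * (\<bar>cos x\<bar> / sqrt (sin x))) \<partial>angle_law) < \<infinity>"
    by (subst nn_integral_angle_law_has_integral) (auto simp: sin_ge_zero)
  have "(\<integral>\<^sup>+x. ennreal (1 + sqrt (pi / sin x)) \<partial>angle_law)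
     \<le> (\<integral>\<^sup>+x. ennreal ((1 + sqrt pi) + sqrt pi * (\<bar>cos x\<bar> / sqrt (sin x))) \<partial>angle_law)"
  proof (rule nn_integral_mono_AE)
    show "AE x in angle_law. ennreal (1 + sqrt (pi / sin x))
        \<le> ennreal ((1 + sqrt pi) + sqrt pi * (\<bar>cos x\<bar> / sqrt (sin x)))"
      using AE_angle_law
      by eventually_elim (intro ennreal_leI le sin_gt_zero; simp)
  qed
  with fin show ?thesis by (rule le_less_trans[rotated])
qed

text \<open>The exponent 1/4 turns the squared factor \<open>(1 + pi / sin \<theta>)\<^sup>2\<close>
  into a square root, which is integrable at 0 and \<open>pi\<close>; exponent 1/2 would leave the
  non-integrable \<open>1 / sin \<theta>\<close>. The dominating function is free of
  \<open>\<Delta>\<close>, hence so is \<open>K\<close>.\<close>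

lemma lower_dev_unit_score_bound:
  obtains K :: real where "1 \<le> K" "\<And>\<Delta>. 0 < \<Delta> \<Longrightarrow> \<Delta> < 1 \<Longrightarrow>
    (\<integral>\<^sup>+x. ennreal ((1 + lower_dev \<Delta> (unit_score \<Delta> x)) powr (1 / 4)) \<partial>weight_law) \<le> ennreal K"
proof -
  let ?A = "\<integral>\<^sup>+x. ennreal (1 + sqrt (pi / sin x)) \<partial>angle_law"
  let ?E = "\<integral>\<^sup>+y. ennreal (1 + y powr (- 1 / 2)) \<partial>exp_law"
  have "?E = (\<integral>\<^sup>+y. ennreal 1 + ennreal (y powr (- 1 / 2)) \<partial>exp_law)"
    by (intro nn_integral_cong ennreal_plus) simp_all
  also have "\<dots> = (\<integral>\<^sup>+y. ennreal 1 \<partial>exp_law) + ennreal (Gamma (1 + (- 1 / 2)))"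
    by (subst nn_integral_add) (auto simp: nn_integral_exp_law_powr)
  also have "\<dots> < \<infinity>"
    using prob_space.emeasure_space_1[OF prob_space_exp_law] by (simp add: ennreal_add_eq_top less_top)
  finally have fin: "?A * ?E < \<infinity>"
    using nn_integral_inverse_sqrt_sin by (simp add: ennreal_mult_less_top)
  obtain K0 where K0: "?A * ?E = ennreal K0"
    using fin by (cases "?A * ?E") auto
  show ?thesis
  proof
    show "1 \<le> max 1 K0" by simp
    fix \<Delta> :: real assume \<Delta>: "0 < \<Delta>" "\<Delta> < 1"
    have "(\<integral>\<^sup>+x. ennreal ((1 + lower_dev \<Delta> (unit_score \<Delta> x)) powr (1 / 4)) \<partial>weight_law)
       \<le> (\<integral>\<^sup>+x. ennreal (1 + sqrt (pi / sin (fst x))) * ennreal (1 + snd x powr (- 1 / 2)) \<partial>weight_law)"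
    proof (rule nn_integral_mono_AE)
      show "AE x in weight_law. ennreal ((1 + lower_dev \<Delta> (unit_score \<Delta> x)) powr (1 / 4))
          \<le> ennreal (1 + sqrt (pi / sin (fst x))) * ennreal (1 + snd x powr (- 1 / 2))"
        using AE_weight_law
      proof eventually_elim
        case (elim x)
        let ?b = "pi / sin (fst x)" and ?a = "1 / snd x"
        have b: "0 < ?b" using elim by (simp add: sin_gt_zero)
        have a: "0 < ?a" using elim by simp
        have "(1 + lower_dev \<Delta> (unit_score \<Delta> x)) powr (1 / 4) \<le> ((1 + ?a) * (1 + ?b)\<^sup>2) powr (1 / 4)"
          using lower_dev_unit_score_le[of \<Delta> "fst x" "snd x"] \<Delta> elim lower_dev_nonneg[of \<Delta> "unit_score \<Delta> x"]
          by (intro powr_mono2) auto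
        also have "\<dots> = (1 + ?a) powr (1 / 4) * sqrt (1 + ?b)"
        proof -
          have "(1 + ?b)\<^sup>2 = (1 + ?b) powr 2" using b by simp
          then have "((1 + ?b)\<^sup>2) powr (1 / 4) = (1 + ?b) powr (1 / 2)" by (simp only: powr_powr) simp
          also have "\<dots> = sqrt (1 + ?b)" using b by (simp add: powr_half_sqrt)
          finally show ?thesis using a b by (subst powr_mult) auto
        qed
        also have "\<dots> \<le> (1 + ?a powr (1 / 2)) * (1 + sqrt ?b)"
        proof (intro mult_mono)
          have "(1 + ?a) powr (1 / 4) \<le> (1 + ?a) powr (1 / 2)"
            using a by (intro powr_mono) auto
          also have "\<dots> = sqrt (1 + ?a)" using a by (simp add: powr_half_sqrt)
          also have "\<dots> \<le> sqrt 1 + sqrt ?a" using a by (intro sqrt_add_le_add_sqrt) auto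
          also have "\<dots> = 1 + ?a powr (1 / 2)" using a by (simp add: powr_half_sqrt)
          finally show "(1 + ?a) powr (1 / 4) \<le> 1 + ?a powr (1 / 2)" .
          show "sqrt (1 + ?b) \<le> 1 + sqrt ?b"
            using b sqrt_add_le_add_sqrt[of 1 ?b] by simp
        qed (use a b in auto)
        also have "?a powr (1 / 2) = snd x powr (- 1 / 2)"
          using elim by (simp add: powr_minus_divide powr_divide)
        finally show ?case
          using b by (subst ennreal_mult[symmetric]) (auto simp: mult.commute)
      qed
    qed
    also have "\<dots> = ?A * ?E"
      by (rule nn_integral_weight_law_prod[of "\<lambda>x. ennreal (1 + sqrt (pi / sin x))"]) measurable
    also have "\<dots> \<le> ennreal (max 1 K0)"
      unfolding K0 by (rule ennreal_leI) simp
    finally show "(\<integral>\<^sup>+x. ennreal ((1 + lower_dev \<Delta> (unit_score \<Delta> x)) powr (1 / 4)) \<partial>weight_law)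
       \<le> ennreal (max 1 K0)" .
  qed
qed

section \<open>Powers of the mean of scores\<close>

lemma (in prob_space) indep_sum_power:
  fixes X S :: "'a \<Rightarrow> real"
  assumes ind: "indep_var borel X borel S"
    and X: "\<And>j. j \<le> m \<Longrightarrow> integrable M (\<lambda>\<omega>. X \<omega> ^ j)"
    and S: "\<And>j. j \<le> m \<Longrightarrow> integrable M (\<lambda>\<omega>. S \<omega> ^ j)"
  shows "integrable M (\<lambda>\<omega>. (X \<omega> + S \<omega>) ^ m)"
    and "expectation (\<lambda>\<omega>. (X \<omega> + S \<omega>) ^ m)
      = (\<Sum>j\<le>m. real (m choose j) * (expectation (\<lambda>\<omega>. X \<omega> ^ j) * expectation (\<lambda>\<omega>. S \<omega> ^ (m - j))))"
proof -
  have ind': "indep_var borel (\<lambda>\<omega>. X \<omega> ^ j) borel (\<lambda>\<omega>. S \<omega> ^ l)" for j l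
    using indep_var_compose[OF ind, of "\<lambda>x. x ^ j" borel "\<lambda>x. x ^ l" borel] by (simp add: comp_def)
  have int: "integrable M (\<lambda>\<omega>. real (m choose j) * (X \<omega> ^ j * S \<omega> ^ (m - j)))" if "j \<le> m" for j
    using that by (intro integrable_mult_right indep_var_integrable ind' X S) auto
  have eq: "(X \<omega> + S \<omega>) ^ m = (\<Sum>j\<le>m. real (m choose j) * (X \<omega> ^ j * S \<omega> ^ (m - j)))" for \<omega>
    by (simp add: binomial_ring mult.assoc)
  show "integrable M (\<lambda>\<omega>. (X \<omega> + S \<omega>) ^ m)"
    unfolding eq using int by (intro Bochner_Integration.integrable_sum) auto
  show "expectation (\<lambda>\<omega>. (X \<omega> + S \<omega>) ^ m)
      = (\<Sum>j\<le>m. real (m choose j) * (expectation (\<lambda>\<omega>. X \<omega> ^ j) * expectation (\<lambda>\<omega>. S \<omega> ^ (m - j))))"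
    unfolding eq using int
    by (subst Bochner_Integration.integral_sum)
       (auto intro!: sum.cong simp: indep_var_lebesgue_integral[OF ind'] X S)
qed

text \<open>Summands are added one at a time; centring kills every cross term with a first power.
  The fourth moment gains \<open>6 * n * m2\<^sup>2\<close> when a summand joins \<open>n\<close>
  others, which accumulates to \<open>3 * n * (n - 1) * m2\<^sup>2\<close>.\<close>

lemma (in prob_space) centered_sum_moments:
  fixes Z :: "'i \<Rightarrow> 'a \<Rightarrow> real" and m2 m3 m4 :: real
  assumes "finite I" "indep_vars (\<lambda>_. borel) Z I"
    and int: "\<And>i j. i \<in> I \<Longrightarrow> j \<le> 4 \<Longrightarrow> integrable M (\<lambda>\<omega>. Z i \<omega> ^ j)"
    and mom: "\<And>i. i \<in> I \<Longrightarrow> expectation (Z i) = 0"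
      "\<And>i. i \<in> I \<Longrightarrow> expectation (\<lambda>\<omega>. Z i \<omega> ^ 2) = m2"
      "\<And>i. i \<in> I \<Longrightarrow> expectation (\<lambda>\<omega>. Z i \<omega> ^ 3) = m3"
      "\<And>i. i \<in> I \<Longrightarrow> expectation (\<lambda>\<omega>. Z i \<omega> ^ 4) = m4"
  shows "\<forall>j\<le>4. integrable M (\<lambda>\<omega>. (\<Sum>i\<in>I. Z i \<omega>) ^ j)"
    and "expectation (\<lambda>\<omega>. \<Sum>i\<in>I. Z i \<omega>) = 0"
    and "expectation (\<lambda>\<omega>. (\<Sum>i\<in>I. Z i \<omega>) ^ 2) = card I * m2"
    and "expectation (\<lambda>\<omega>. (\<Sum>i\<in>I. Z i \<omega>) ^ 3) = card I * m3"
    and "expectation (\<lambda>\<omega>. (\<Sum>i\<in>I. Z i \<omega>) ^ 4) = card I * m4 + 3 * real (card I) * (real (card I) - 1) * m2\<^sup>2"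
proof -
  have "(\<forall>j\<le>4. integrable M (\<lambda>\<omega>. (\<Sum>i\<in>I. Z i \<omega>) ^ j))
    \<and> expectation (\<lambda>\<omega>. \<Sum>i\<in>I. Z i \<omega>) = 0
    \<and> expectation (\<lambda>\<omega>. (\<Sum>i\<in>I. Z i \<omega>) ^ 2) = card I * m2
    \<and> expectation (\<lambda>\<omega>. (\<Sum>i\<in>I. Z i \<omega>) ^ 3) = card I * m3
    \<and> expectation (\<lambda>\<omega>. (\<Sum>i\<in>I. Z i \<omega>) ^ 4) = card I * m4 + 3 * real (card I) * (real (card I) - 1) * m2\<^sup>2"
    using assms
  proof (induction I rule: finite_induct)
    case empty
    then show ?case by (auto simp: power_0_left)
  next
    case (insert i I)
    let ?S = "\<lambda>\<omega>. \<Sum>i\<in>I. Z i \<omega>"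
    have "indep_vars (\<lambda>_. borel) Z I"
      using insert.prems(1) by (rule indep_vars_subset) auto
    with insert have IH: "\<forall>j\<le>4. integrable M (\<lambda>\<omega>. ?S \<omega> ^ j)"
      "expectation ?S = 0"
      "expectation (\<lambda>\<omega>. ?S \<omega> ^ 2) = card I * m2"
      "expectation (\<lambda>\<omega>. ?S \<omega> ^ 3) = card I * m3"
      "expectation (\<lambda>\<omega>. ?S \<omega> ^ 4) = card I * m4 + 3 * real (card I) * (real (card I) - 1) * m2\<^sup>2"
      by auto
    have ind: "indep_var borel (Z i) borel ?S"
      using insert by (intro indep_vars_sum) auto
    have int: "integrable M (\<lambda>\<omega>. (Z i \<omega> + ?S \<omega>) ^ m)" if "m \<le> 4" for m
      using that insert.prems(2) IH(1) by (intro indep_sum_power[OF ind]) auto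
    have E: "expectation (\<lambda>\<omega>. (Z i \<omega> + ?S \<omega>) ^ m)
      = (\<Sum>j\<le>m. real (m choose j) * (expectation (\<lambda>\<omega>. Z i \<omega> ^ j) * expectation (\<lambda>\<omega>. ?S \<omega> ^ (m - j))))"
      if "m \<le> 4" for m
      using that insert.prems(2) IH(1) by (intro indep_sum_power[OF ind]) auto
    have Z: "expectation (Z i) = 0" "expectation (\<lambda>\<omega>. (Z i \<omega>)\<^sup>2) = m2"
      "expectation (\<lambda>\<omega>. Z i \<omega> ^ 3) = m3" "expectation (\<lambda>\<omega>. Z i \<omega> ^ 4) = m4"
      using insert.prems(3-6) by auto
    have one: "expectation (\<lambda>\<omega>. 1 :: real) = 1" using prob_space by simp
    have E1: "expectation (\<lambda>\<omega>. Z i \<omega> + ?S \<omega>) = 0"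
      using E[of 1] Z IH one by (simp add: atMost_Suc)
    have E2: "expectation (\<lambda>\<omega>. (Z i \<omega> + ?S \<omega>) ^ 2) = m2 + card I * m2"
      using E[of 2] Z IH one by (simp add: atMost_Suc numeral_2_eq_2)
    have E3: "expectation (\<lambda>\<omega>. (Z i \<omega> + ?S \<omega>) ^ 3) = m3 + card I * m3"
    proof -
      have "{..3::nat} = {0,1,2,3}" by auto
      then show ?thesis using E[of 3] Z IH one by simp
    qed
    have E4: "expectation (\<lambda>\<omega>. (Z i \<omega> + ?S \<omega>) ^ 4)
        = m4 + 6 * (m2 * (card I * m2)) + (card I * m4 + 3 * real (card I) * (real (card I) - 1) * m2\<^sup>2)"
    proof -
      have "{..4::nat} = {0,1,2,3,4}" by auto
      moreover have "(4 choose 2 :: nat) = 6" by (simp add: choose_two)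
      ultimately show ?thesis using E[of 4] Z IH one by simp
    qed
    have sum: "(\<Sum>l\<in>insert i I. Z l \<omega>) = Z i \<omega> + ?S \<omega>" for \<omega>
      using insert by simp
    have card: "real (card (insert i I)) = 1 + real (card I)" using insert by simp
    show ?case
      unfolding sum card E1 E2 E3 E4 using int by (auto simp: algebra_simps power2_eq_square)
  qed
  then show "\<forall>j\<le>4. integrable M (\<lambda>\<omega>. (\<Sum>i\<in>I. Z i \<omega>) ^ j)"
    and "expectation (\<lambda>\<omega>. \<Sum>i\<in>I. Z i \<omega>) = 0"
    and "expectation (\<lambda>\<omega>. (\<Sum>i\<in>I. Z i \<omega>) ^ 2) = card I * m2"
    and "expectation (\<lambda>\<omega>. (\<Sum>i\<in>I. Z i \<omega>) ^ 3) = card I * m3"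
    and "expectation (\<lambda>\<omega>. (\<Sum>i\<in>I. Z i \<omega>) ^ 4) = card I * m4 + 3 * real (card I) * (real (card I) - 1) * m2\<^sup>2"
    by blast+
qed

section \<open>Taylor expansion of the power at 1\<close>

definition taylor_dev :: "real \<Rightarrow> real \<Rightarrow> real" where
  "taylor_dev \<Delta> x = (1 - x powr (- \<Delta>)) / \<Delta>"

text \<open>With \<open>z = x - 1\<close> the expansion is
  \<open>z - (1 + \<Delta>) / 2 * z\<^sup>2 + R * z ^ 3\<close>, and its square begins with
  \<open>z\<^sup>2 - (1 + \<Delta>) * z ^ 3\<close>. The cutoff at 1/2 keeps the \<open>m\<close>-th
  negative power below \<open>2 ^ Suc m\<close>, whence 8, \<open>R \<le> 16\<close> and
  \<open>96 = 8\<^sup>2 + 2 * 16\<close>.\<close>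

lemma taylor_dev_bounds:
  assumes "0 < \<Delta>" "\<Delta> < 1" "1 / 2 \<le> x"
  shows "\<bar>(x - 1) - taylor_dev \<Delta> x\<bar> \<le> 8 * (x - 1)\<^sup>2"
    and "\<bar>(taylor_dev \<Delta> x)\<^sup>2 - (x - 1)\<^sup>2 + (1 + \<Delta>) * (x - 1) ^ 3\<bar> \<le> 96 * (x - 1) ^ 4"
proof -
  define z where "z = x - 1"
  \<comment> \<open>\<open>d m\<close> is the \<open>m\<close>-th derivative of
    \<open>t powr (- \<Delta>)\<close>.\<close>
  define d where "d m t = (\<Prod>l<m. - \<Delta> - real l) * t powr (- \<Delta> - real m)" for m t
  have D: "DERIV (d m) t :> d (Suc m) t" if "1 / 2 \<le> t" for m t
  proof -
    have "DERIV (\<lambda>t. t powr (- \<Delta> - real m)) t :> (- \<Delta> - real m) * t powr (- \<Delta> - real m - 1)"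
      using that by (intro has_real_derivative_powr) simp
    then have "DERIV (d m) t :> (\<Prod>l<m. - \<Delta> - real l) * ((- \<Delta> - real m) * t powr (- \<Delta> - real m - 1))"
      unfolding d_def by (rule DERIV_cmult)
    then show ?thesis by (simp add: d_def algebra_simps)
  qed
  have small: "t powr (- \<Delta> - real m) \<le> 2 ^ Suc m" if "1 / 2 \<le> t" for t m
  proof -
    have "t powr (- \<Delta> - real m) \<le> (1 / 2) powr (- \<Delta> - real m)"
      using assms that by (intro powr_mono2') auto
    also have "\<dots> = 2 powr (\<Delta> + real m)"
      by (simp add: powr_divide powr_minus_divide[of 2 "\<Delta> + real m"] powr_diff powr_add powr_minus field_simps)
    also have "\<dots> \<le> 2 powr (real (Suc m))" using assms by (intro powr_mono) auto
    also have "\<dots> = 2 ^ Suc m" by (simp only: powr_realpow zero_less_numeral)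
    finally show ?thesis .
  qed
  have T: "\<exists>t\<ge>1/2. x powr (- \<Delta>) = (\<Sum>m<n. d m 1 / fact m * z ^ m) + d n t / fact n * z ^ n"
    if "0 < n" for n
  proof (cases "x = 1")
    case True
    have "(\<Sum>m<n. d m 1 / fact m * z ^ m) = d 0 1"
      using that True by (simp add: z_def power_0_left sum.delta' if_distrib lessThan_def cong: if_cong)
    then show ?thesis using True that by (intro exI[of _ 1]) (simp add: z_def d_def)
  next
    case False
    have "\<exists>t. (if x < 1 then x < t \<and> t < 1 else 1 < t \<and> t < x) \<and>
        x powr (- \<Delta>) = (\<Sum>m<n. d m 1 / fact m * (x - 1) ^ m) + d n t / fact n * (x - 1) ^ n"
      using that assms False
      by (intro Taylor[where a = "1 / 2" and b = "max 1 x" and diff = d]) (auto simp: d_def[of 0] fun_eq_iff intro!: D)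
    then obtain t where t: "if x < 1 then x < t \<and> t < 1 else 1 < t \<and> t < x"
        "x powr (- \<Delta>) = (\<Sum>m<n. d m 1 / fact m * (x - 1) ^ m) + d n t / fact n * (x - 1) ^ n"
      by blast
    then have "1 / 2 \<le> t" using assms by (auto split: if_splits)
    with t(2) show ?thesis unfolding z_def by blast
  qed
  have S2: "{..<2::nat} = {0,1}" and S3: "{..<3::nat} = {0,1,2}" by auto
  obtain t where t: "1 / 2 \<le> t" "x powr (- \<Delta>) = 1 - \<Delta> * z + \<Delta> * (1 + \<Delta>) / 2 * t powr (- \<Delta> - 2) * z\<^sup>2"
    using T[of 2] by (auto simp: S2 d_def algebra_simps)
  have d: "d 0 1 = 1" "d (Suc 0) 1 = - \<Delta>" "d 2 1 = \<Delta> * (1 + \<Delta>)"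
    "\<And>u. d 3 u = - (\<Delta> * (1 + \<Delta>) * (2 + \<Delta>)) * u powr (- \<Delta> - 3)"
    by (simp_all add: d_def S2 S3 algebra_simps)
  obtain u where u: "1 / 2 \<le> u" "x powr (- \<Delta>) = (\<Sum>m<3. d m 1 / fact m * z ^ m) + d 3 u / fact 3 * z ^ 3"
    using T[of 3] by auto
  define g where "g = taylor_dev \<Delta> x"
  define R where "R = (1 + \<Delta>) * (2 + \<Delta>) / 6 * u powr (- \<Delta> - 3)"
  have g1: "z - g = (1 + \<Delta>) / 2 * t powr (- \<Delta> - 2) * z\<^sup>2"
    using assms unfolding g_def taylor_dev_def t(2) by (simp add: field_simps)
  have g2: "z - g = (1 + \<Delta>) / 2 * z\<^sup>2 - R * z ^ 3"
    using assms unfolding g_def taylor_dev_def u(2) R_def S3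
    by (simp add: d fact_numeral field_simps)
  have "(1 + \<Delta>) / 2 * t powr (- \<Delta> - 2) \<le> 1 * 8"
    using small[OF t(1), of 2] assms by (intro mult_mono) auto
  then have b1: "\<bar>z - g\<bar> \<le> 8 * z\<^sup>2"
    unfolding g1 using assms by (subst abs_of_nonneg) (auto intro!: mult_right_mono)
  have "(1 + \<Delta>) * (2 + \<Delta>) \<le> 2 * 3" using assms by (intro mult_mono) auto
  then have "R \<le> 1 * 16"
    unfolding R_def using small[OF u(1), of 3] assms by (intro mult_mono) auto
  moreover have "0 \<le> R" using assms by (simp add: R_def)
  ultimately have R: "\<bar>R\<bar> \<le> 16" by simp
  have "g\<^sup>2 - z\<^sup>2 + (1 + \<Delta>) * z ^ 3 = (z - g)\<^sup>2 - 2 * z * (z - g) + (1 + \<Delta>) * z ^ 3"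
    by (simp add: power2_eq_square algebra_simps)
  also have "2 * z * (z - g) = (1 + \<Delta>) * z ^ 3 - 2 * R * z ^ 4"
    unfolding g2 by (simp add: power2_eq_square power3_eq_cube power4_eq_xxxx algebra_simps)
  finally have "\<bar>g\<^sup>2 - z\<^sup>2 + (1 + \<Delta>) * z ^ 3\<bar> = \<bar>(z - g)\<^sup>2 + 2 * R * z ^ 4\<bar>" by simp
  also have "\<dots> \<le> \<bar>z - g\<bar>\<^sup>2 + 2 * \<bar>R\<bar> * z ^ 4"
    by (rule order_trans[OF abs_triangle_ineq]) (simp add: abs_mult)
  also have "\<dots> \<le> (8 * z\<^sup>2)\<^sup>2 + 2 * 16 * z ^ 4"
    using b1 R by (intro add_mono power_mono mult_right_mono mult_left_mono) auto
  also have "\<dots> = 96 * z ^ 4" by (simp add: power2_eq_square power4_eq_xxxx)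
  finally show "\<bar>(taylor_dev \<Delta> x)\<^sup>2 - (x - 1)\<^sup>2 + (1 + \<Delta>) * (x - 1) ^ 3\<bar> \<le> 96 * (x - 1) ^ 4"
    by (simp add: g_def z_def)
  show "\<bar>(x - 1) - taylor_dev \<Delta> x\<bar> \<le> 8 * (x - 1)\<^sup>2"
    using b1 by (simp add: g_def z_def)
qed

text \<open>A single majorant, up to a factor 3, for both Taylor errors below 1/2, where the
  remainder bounds break down. The square is there because the second moment of
  \<open>taylor_dev\<close> is expanded as well.\<close>

definition small_part :: "real \<Rightarrow> real \<Rightarrow> real" where
  "small_part \<Delta> x = (if x < 1 / 2 then (1 + lower_dev \<Delta> x)\<^sup>2 else 0)"

lemma small_part_measurable [measurable]: "small_part \<Delta> \<in> borel_measurable borel"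
  unfolding small_part_def[abs_def] by measurable

lemma taylor_dev_measurable [measurable]: "taylor_dev \<Delta> \<in> borel_measurable borel"
  unfolding taylor_dev_def[abs_def] by measurable

lemma small_part_nonneg: "0 \<le> small_part \<Delta> x"
  by (simp add: small_part_def)

lemma taylor_dev_bounds_pos:
  assumes "0 < \<Delta>" "\<Delta> < 1" "0 < x"
  shows "\<bar>(x - 1) - taylor_dev \<Delta> x\<bar> \<le> 8 * (x - 1)\<^sup>2 + small_part \<Delta> x"
    and "\<bar>(taylor_dev \<Delta> x)\<^sup>2 - (x - 1)\<^sup>2 + (1 + \<Delta>) * (x - 1) ^ 3\<bar> \<le> 96 * (x - 1) ^ 4 + 3 * small_part \<Delta> x"
proof -
  have "\<bar>(x - 1) - taylor_dev \<Delta> x\<bar> \<le> 8 * (x - 1)\<^sup>2 + small_part \<Delta> x \<and>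
    \<bar>(taylor_dev \<Delta> x)\<^sup>2 - (x - 1)\<^sup>2 + (1 + \<Delta>) * (x - 1) ^ 3\<bar> \<le> 96 * (x - 1) ^ 4 + 3 * small_part \<Delta> x"
  proof (cases "x < 1 / 2")
    case False
    then show ?thesis using taylor_dev_bounds[of \<Delta> x] assms by (simp add: small_part_def)
  next
    case True
    define L where "L = lower_dev \<Delta> x"
    have "1 \<le> x powr (- \<Delta>)"
      using powr_mono2'[of "- \<Delta>" x 1] assms True by simp
    then have g: "taylor_dev \<Delta> x = - L"
      using assms by (simp add: L_def lower_dev_def taylor_dev_def max_def field_simps)
    have L: "0 \<le> L" by (simp add: L_def lower_dev_nonneg)
    have h: "small_part \<Delta> x = (1 + L)\<^sup>2" using True by (simp add: small_part_def L_def)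
    have z: "\<bar>x - 1\<bar> \<le> 1" using assms True by simp
    have z2: "(x - 1)\<^sup>2 \<le> 1" using z by (simp add: abs_square_le_1)
    have z3: "\<bar>(1 + \<Delta>) * (x - 1) ^ 3\<bar> \<le> 2 * 1"
      unfolding abs_mult power_abs using assms z by (intro mult_mono power_le_one) auto
    have "\<bar>(x - 1) - taylor_dev \<Delta> x\<bar> \<le> 1 + L"
      unfolding g using z L by linarith
    also have "\<dots> \<le> (1 + L)\<^sup>2" using L by (simp add: self_le_power)
    finally have 1: "\<bar>(x - 1) - taylor_dev \<Delta> x\<bar> \<le> (1 + L)\<^sup>2" .
    have "\<bar>(taylor_dev \<Delta> x)\<^sup>2 - (x - 1)\<^sup>2 + (1 + \<Delta>) * (x - 1) ^ 3\<bar> \<le> L\<^sup>2 + 1 + 2"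
      unfolding g using z2 z3 zero_le_power2[of "x - 1"] zero_le_power2[of L] by (simp only: power2_minus)
    also have "\<dots> \<le> 3 * (1 + L)\<^sup>2" using L by (simp add: power2_eq_square algebra_simps)
    finally show ?thesis using 1 unfolding h by (simp add: add_increasing)
  qed
  then show "\<bar>(x - 1) - taylor_dev \<Delta> x\<bar> \<le> 8 * (x - 1)\<^sup>2 + small_part \<Delta> x"
    and "\<bar>(taylor_dev \<Delta> x)\<^sup>2 - (x - 1)\<^sup>2 + (1 + \<Delta>) * (x - 1) ^ 3\<bar> \<le> 96 * (x - 1) ^ 4 + 3 * small_part \<Delta> x"
    by auto
qed

text \<open>Meant for \<open>x\<close> the mean, \<open>y\<close> one of the scores and
  \<open>c\<close> the sample size. Since \<open>c powr \<Delta> - 1\<close> is at most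
  \<open>\<Delta> * (c - 1)\<close>, passing from the mean to a score costs only a factor
  \<open>c\<close>, uniformly in \<open>\<Delta>\<close>.\<close>

lemma lower_dev_mean_le:
  assumes "0 < \<Delta>" "\<Delta> < 1" "0 < y" "1 \<le> c" "y / c \<le> x"
  shows "1 + lower_dev \<Delta> x \<le> c * (1 + lower_dev \<Delta> y)"
proof -
  have x: "0 < x" using assms by (meson divide_pos_pos less_le_trans zero_less_one)
  have "x powr (- \<Delta>) \<le> (y / c) powr (- \<Delta>)"
    using assms by (intro powr_mono2') auto
  also have "\<dots> = c powr \<Delta> * y powr (- \<Delta>)"
    using assms by (simp add: powr_divide powr_minus field_simps)
  also have "\<dots> \<le> c powr \<Delta> * (1 + \<Delta> * lower_dev \<Delta> y)"
    using assms by (intro mult_left_mono) (auto simp: lower_dev_def max_def field_simps)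
  finally have 1: "x powr (- \<Delta>) \<le> c powr \<Delta> + \<Delta> * (c powr \<Delta> * lower_dev \<Delta> y)"
    by (simp add: algebra_simps)
  have 2: "c powr \<Delta> \<le> 1 + \<Delta> * (c - 1)"
    using assms by (intro powr_le_Bernoulli) auto
  have "c powr \<Delta> \<le> c powr 1" using assms by (intro powr_mono) auto
  then have "c powr \<Delta> * lower_dev \<Delta> y \<le> c * lower_dev \<Delta> y"
    using assms by (intro mult_right_mono lower_dev_nonneg) auto
  then have 3: "\<Delta> * (c powr \<Delta> * lower_dev \<Delta> y) \<le> \<Delta> * (c * lower_dev \<Delta> y)"
    using assms by (intro mult_left_mono) auto
  have "x powr (- \<Delta>) - 1 \<le> \<Delta> * (c - 1 + c * lower_dev \<Delta> y)"
    using 1 2 3 by (simp add: algebra_simps)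
  then have "(x powr (- \<Delta>) - 1) / \<Delta> \<le> c - 1 + c * lower_dev \<Delta> y"
    using assms by (simp add: pos_divide_le_eq mult.commute)
  moreover have "0 \<le> c - 1 + c * lower_dev \<Delta> y"
    using assms lower_dev_nonneg[of \<Delta> y] by simp
  ultimately have "lower_dev \<Delta> x \<le> c - 1 + c * lower_dev \<Delta> y"
    unfolding lower_dev_def[of \<Delta> x] by simp
  then show ?thesis by (simp add: algebra_simps)
qed


lemma exp_minus_le_quadratic:
  fixes u :: real
  assumes "0 \<le> u"
  shows "exp (- u) \<le> 1 - u + u\<^sup>2 / 2"
proof -
  let ?f = "\<lambda>u::real. 1 - u + u\<^sup>2 / 2 - exp (- u)"
  have "?f 0 \<le> ?f u"
  proof (rule DERIV_nonneg_imp_nondecreasing[OF assms])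
    fix x :: real
    have "(?f has_real_derivative x - 1 + exp (- x)) (at x)"
      by (auto intro!: derivative_eq_intros)
    moreover have "0 \<le> x - 1 + exp (- x)" using exp_ge_add_one_self[of "- x"] by simp
    ultimately show "\<exists>y. (?f has_real_derivative y) (at x) \<and> 0 \<le> y" by blast
  qed
  then show ?thesis by simp
qed

text \<open>The indicator of \<open>mean < 1 / 2\<close> is bounded by a Chernoff factor in the samples from the
  ninth on, while the blow-up of \<open>x powr (- \<Delta>)\<close> at \<open>0\<close> is shared among the first eight.\<close>

lemma small_part_mean_le:
  fixes y :: "nat \<Rightarrow> real"
  assumes \<Delta>: "0 < \<Delta>" "\<Delta> < 1" and k: "8 \<le> k" and y: "\<And>j. j \<in> {1..k} \<Longrightarrow> 0 < y j"
  shows "small_part \<Delta> ((\<Sum>j=1..k. y j) / k) \<le> (real k)\<^sup>2 * exp (real k / 16) *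
    (\<Prod>j=1..k. if j \<le> 8 then (1 + lower_dev \<Delta> (y j)) powr (1 / 4) else exp (- y j / 8))"
    (is "small_part \<Delta> ?x \<le> _ * _ * prod ?\<phi> _")
proof (cases "?x < 1 / 2")
  case False
  then show ?thesis
    by (auto simp: small_part_def intro!: mult_nonneg_nonneg prod_nonneg)
next
  case True
  have split: "{1..k} = {1..8} \<union> {9..k}" using k by auto
  define L where "L = 1 + lower_dev \<Delta> ?x"
  have L: "1 \<le> L" by (simp add: L_def lower_dev_nonneg)
  have k0: "0 < real k" using k by simp
  have j: "L powr (1 / 4) \<le> (real k) powr (1 / 4) * ?\<phi> j" if "j \<in> {1..8}" for j
  proof -
    have j: "j \<in> {1..k}" using that k by auto
    have "y j \<le> (\<Sum>j=1..k. y j)"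
      using j y by (intro member_le_sum) (auto intro: less_imp_le)
    then have "y j / real k \<le> ?x" by (intro divide_right_mono) auto
    then have "L \<le> real k * (1 + lower_dev \<Delta> (y j))"
      unfolding L_def using \<Delta> k y[OF j] by (intro lower_dev_mean_le) auto
    then have "L powr (1 / 4) \<le> (real k * (1 + lower_dev \<Delta> (y j))) powr (1 / 4)"
      using L by (intro powr_mono2) auto
    also have "\<dots> = real k powr (1 / 4) * (1 + lower_dev \<Delta> (y j)) powr (1 / 4)"
      using lower_dev_nonneg[of \<Delta> "y j"] by (subst powr_mult) auto
    finally show ?thesis using that by simp
  qed
  \<comment> \<open>Eight exponents 1/4 add up to 2. Each factor is charged to a different score, so
    that independence factorises the later expectation; the eight factors
    \<open>k powr (1 / 4)\<close> multiply to \<open>k\<^sup>2\<close>.\<close>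
  have "L\<^sup>2 = (\<Prod>j\<in>{1..8::nat}. L powr (1 / 4))"
    using L by (simp add: powr_power)
  also have "\<dots> \<le> (\<Prod>j\<in>{1..8}. (real k) powr (1 / 4) * ?\<phi> j)"
    using j by (intro prod_mono) auto
  also have "\<dots> = (real k)\<^sup>2 * prod ?\<phi> {1..8}"
    using k0 by (simp add: prod.distrib powr_power)
  finally have 1: "L\<^sup>2 \<le> (real k)\<^sup>2 * prod ?\<phi> {1..8}" .
  \<comment> \<open>The remaining scores sum to at most \<open>k / 2\<close>, which the Chernoff
    rate 1/8 turns into \<open>k / 16\<close>.\<close>
  have "(\<Sum>j\<in>{9..k}. y j) \<le> (\<Sum>j=1..k. y j)"
    using y by (intro sum_mono2) (auto intro: less_imp_le)
  also have "\<dots> \<le> real k / 2" using True k0 by (simp add: field_simps)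
  finally have "0 \<le> real k / 16 + (\<Sum>j\<in>{9..k}. - y j / 8)"
    by (simp add: sum_divide_distrib[symmetric] sum_negf)
  then have "1 \<le> exp (real k / 16 + (\<Sum>j\<in>{9..k}. - y j / 8))" by simp
  also have "\<dots> = exp (real k / 16) * prod ?\<phi> {9..k}"
    by (simp add: exp_add exp_sum)
  finally have 2: "1 \<le> exp (real k / 16) * prod ?\<phi> {9..k}" .
  have "L\<^sup>2 * 1 \<le> ((real k)\<^sup>2 * prod ?\<phi> {1..8}) * (exp (real k / 16) * prod ?\<phi> {9..k})"
    using 1 2 by (intro mult_mono mult_nonneg_nonneg prod_nonneg) auto
  also have "prod ?\<phi> {1..k} = prod ?\<phi> {1..8} * prod ?\<phi> {9..k}"
    unfolding split by (rule prod.union_disjoint) auto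
  ultimately show ?thesis
    using True by (simp add: small_part_def L_def mult_ac)
qed

text \<open>\<open>K ^ 8\<close> accounts for the eight moments of order 1/4. \<open>2 ^ 27\<close>
  exceeds \<open>96 * 32 ^ 4\<close>, which comes from \<open>exp u \<ge> u ^ 4 / 24\<close> at
  \<open>u = k / 32\<close>.\<close>

definition tail_const :: "real \<Rightarrow> real" where
  "tail_const K = K ^ 8 * 2 ^ 27"

section \<open>The expansion for an abstract sample of scores\<close>

locale score_sample = prob_space M for M :: "'a measure" +
  fixes Y :: "nat \<Rightarrow> 'a \<Rightarrow> real" and \<Delta> K m3 m4 :: real and k :: nat
  assumes \<Delta>: "0 < \<Delta>" "\<Delta> < 1" and k: "8 \<le> k" and K: "1 \<le> K"
    and indep: "indep_vars (\<lambda>_. borel) Y {1..k}"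
    and Y_pos: "\<And>j. j \<in> {1..k} \<Longrightarrow> AE \<omega> in M. 0 < Y j \<omega>"
    and Y_int: "\<And>j m. j \<in> {1..k} \<Longrightarrow> m \<le> 4 \<Longrightarrow> integrable M (\<lambda>\<omega>. Y j \<omega> ^ m)"
    and Y_mom: "\<And>j. j \<in> {1..k} \<Longrightarrow> expectation (Y j) = 1"
      "\<And>j. j \<in> {1..k} \<Longrightarrow> expectation (\<lambda>\<omega>. Y j \<omega> ^ 2) = 4 - 2 * \<Delta>"
      "\<And>j. j \<in> {1..k} \<Longrightarrow> expectation (\<lambda>\<omega>. Y j \<omega> ^ 3) = m3"
      "\<And>j. j \<in> {1..k} \<Longrightarrow> expectation (\<lambda>\<omega>. Y j \<omega> ^ 4) = m4"
    and m: "0 \<le> m3" "m3 \<le> 27" "0 \<le> m4" "m4 \<le> 256"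
    and Y_low: "\<And>j. j \<in> {1..k} \<Longrightarrow> (\<integral>\<^sup>+\<omega>. ennreal ((1 + lower_dev \<Delta> (Y j \<omega>)) powr (1 / 4)) \<partial>M) \<le> ennreal K"
begin

lemma Y_rv: "j \<in> {1..k} \<Longrightarrow> Y j \<in> borel_measurable M"
  using indep by (auto simp: indep_vars_def)

definition mean :: "'a \<Rightarrow> real" where
  "mean \<omega> = (\<Sum>j=1..k. Y j \<omega>) / k"

lemma mean_measurable [measurable]: "mean \<in> borel_measurable M"
  unfolding mean_def[abs_def] by (intro borel_measurable_divide borel_measurable_sum Y_rv) auto

lemma mean_pos: "AE \<omega> in M. 0 < mean \<omega>"
proof -
  have "AE \<omega> in M. \<forall>j\<in>{1..k}. 0 < Y j \<omega>"
    using Y_pos by (subst AE_finite_all) auto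
  then show ?thesis
  proof eventually_elim
    case (elim \<omega>)
    then show ?case unfolding mean_def using k by (intro divide_pos_pos sum_pos) auto
  qed
qed

text \<open>The quadratic bound on \<open>exp\<close> needs only two moments and gives at most
  \<open>1 - 1 / 8 + 4 / 128 = 1 - 3 / 32\<close>. The rate 1/8 makes the decay 3/32 per sample beat
  the growth \<open>1 / 16 = 2 / 32\<close> caused by the threshold 1/2.\<close>

lemma exp_score_le:
  assumes j: "j \<in> {1..k}"
  shows "(\<integral>\<^sup>+\<omega>. ennreal (exp (- Y j \<omega> / 8)) \<partial>M) \<le> ennreal (exp (- 3 / 32))"
proof -
  have [measurable]: "Y j \<in> borel_measurable M" using j by (rule Y_rv)
  have int1: "integrable M (Y j)" using Y_int[OF j, of 1] by simp
  have int2: "integrable M (\<lambda>\<omega>. (Y j \<omega>)\<^sup>2)" using Y_int[OF j, of 2] by simp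
  have int: "integrable M (\<lambda>\<omega>. 1 - Y j \<omega> / 8 + (Y j \<omega>)\<^sup>2 / 128)"
    using int1 int2 by auto
  have le: "AE \<omega> in M. exp (- Y j \<omega> / 8) \<le> 1 - Y j \<omega> / 8 + (Y j \<omega>)\<^sup>2 / 128"
    using Y_pos[OF j]
  proof eventually_elim
    case (elim \<omega>)
    then show ?case using exp_minus_le_quadratic[of "Y j \<omega> / 8"] by (simp add: power_divide)
  qed
  have "(\<integral>\<^sup>+\<omega>. ennreal (exp (- Y j \<omega> / 8)) \<partial>M) \<le> (\<integral>\<^sup>+\<omega>. ennreal (1 - Y j \<omega> / 8 + (Y j \<omega>)\<^sup>2 / 128) \<partial>M)"
    using le by (intro nn_integral_mono_AE) (auto elim!: eventually_mono intro!: ennreal_leI)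
  also have "\<dots> = ennreal (expectation (\<lambda>\<omega>. 1 - Y j \<omega> / 8 + (Y j \<omega>)\<^sup>2 / 128))"
    by (rule nn_integral_eq_integral[OF int])
       (use le in eventually_elim, rule order_trans[OF exp_ge_zero])
  also have "expectation (\<lambda>\<omega>. 1 - Y j \<omega> / 8 + (Y j \<omega>)\<^sup>2 / 128) = 1 - 1 / 8 + (4 - 2 * \<Delta>) / 128"
    using int1 int2 Y_mom(1,2)[OF j] prob_space by simp
  also have "\<dots> \<le> 1 + (- 3 / 32)" using \<Delta> by simp
  also have "\<dots> \<le> exp (- 3 / 32)" by (rule exp_ge_add_one_self)
  finally show ?thesis by (simp add: ennreal_leI)
qed

abbreviation C0 :: real where "C0 \<equiv> tail_const K"

lemma small_part_integral: "(\<integral>\<^sup>+\<omega>. ennreal (small_part \<Delta> (mean \<omega>)) \<partial>M) \<le> ennreal (C0 / k\<^sup>2)"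
proof -
  define \<phi> where "\<phi> j x = (if j \<le> 8 then (1 + lower_dev \<Delta> x) powr (1 / 4) else exp (- x / 8))" for j :: nat and x
  have [measurable]: "\<phi> j \<in> borel_measurable borel" for j
    unfolding \<phi>_def by (cases "j \<le> 8") simp_all
  have \<phi>_nn: "0 \<le> \<phi> j x" for j x by (simp add: \<phi>_def)
  define q :: real where "q = exp (- 3 / 32)"
  have "(\<integral>\<^sup>+\<omega>. ennreal (small_part \<Delta> (mean \<omega>)) \<partial>M)
      \<le> (\<integral>\<^sup>+\<omega>. ennreal ((real k)\<^sup>2 * exp (real k / 16)) * ennreal (\<Prod>j=1..k. \<phi> j (Y j \<omega>)) \<partial>M)"
  proof (rule nn_integral_mono_AE)
    have "AE \<omega> in M. \<forall>j\<in>{1..k}. 0 < Y j \<omega>"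
      using Y_pos by (subst AE_finite_all) auto
    then show "AE \<omega> in M. ennreal (small_part \<Delta> (mean \<omega>))
        \<le> ennreal ((real k)\<^sup>2 * exp (real k / 16)) * ennreal (\<Prod>j=1..k. \<phi> j (Y j \<omega>))"
    proof eventually_elim
      case (elim \<omega>)
      then show ?case
        unfolding mean_def \<phi>_def
        using small_part_mean_le[of \<Delta> k "\<lambda>j. Y j \<omega>"] \<Delta> k
        by (subst ennreal_mult'[symmetric]) (auto intro!: ennreal_leI)
    qed
  qed
  also have "\<dots> = ennreal ((real k)\<^sup>2 * exp (real k / 16)) * (\<integral>\<^sup>+\<omega>. ennreal (\<Prod>j=1..k. \<phi> j (Y j \<omega>)) \<partial>M)"
  proof (rule nn_integral_cmult)
    show "(\<lambda>\<omega>. ennreal (\<Prod>j=1..k. \<phi> j (Y j \<omega>))) \<in> borel_measurable M"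
      by (intro measurable_compose[OF _ measurable_ennreal] borel_measurable_prod measurable_compose[OF Y_rv]) auto
  qed
  also have "(\<integral>\<^sup>+\<omega>. ennreal (\<Prod>j=1..k. \<phi> j (Y j \<omega>)) \<partial>M) = (\<integral>\<^sup>+\<omega>. (\<Prod>j=1..k. ennreal (\<phi> j (Y j \<omega>))) \<partial>M)"
    by (simp add: prod_ennreal \<phi>_nn)
  also have "\<dots> = (\<Prod>j=1..k. \<integral>\<^sup>+\<omega>. ennreal (\<phi> j (Y j \<omega>)) \<partial>M)"
    by (intro indep_vars_nn_integral indep_vars_compose2[OF indep]) auto
  also have "\<dots> \<le> (\<Prod>j=1..k. if j \<le> 8 then ennreal K else ennreal q)"
    using Y_low exp_score_le by (intro prod_mono_ennreal) (auto simp: \<phi>_def q_def)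
  also have "\<dots> = ennreal (K ^ 8 * q ^ (k - 8))"
  proof -
    have split: "{1..k} = {1..8} \<union> {9..k}" using k by auto
    have "(\<Prod>j=1..k. if j \<le> 8 then ennreal K else ennreal q)
        = (\<Prod>j\<in>{1..8::nat}. if j \<le> 8 then ennreal K else ennreal q) * (\<Prod>j\<in>{9..k}. if j \<le> 8 then ennreal K else ennreal q)"
      unfolding split by (rule prod.union_disjoint) auto
    also have "\<dots> = ennreal K ^ 8 * ennreal q ^ (k - 8)" by simp
    finally show ?thesis using K by (simp add: ennreal_mult ennreal_power q_def)
  qed
  finally have "(\<integral>\<^sup>+\<omega>. ennreal (small_part \<Delta> (mean \<omega>)) \<partial>M)
      \<le> ennreal ((real k)\<^sup>2 * exp (real k / 16) * (K ^ 8 * q ^ (k - 8)))"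
    using K by (simp add: ennreal_mult' mult_left_mono q_def)
  also have "\<dots> \<le> ennreal (C0 / k\<^sup>2)"
  proof (rule ennreal_leI)
    \<comment> \<open>The exponent is \<open>2 * u - 3 * u + 3 / 4\<close>, where 3/4 pays for the
      eight samples outside the Chernoff factor. The surviving \<open>exp (- u)\<close> is bounded
      by a multiple of \<open>1 / k ^ 4\<close>, which absorbs the prefactor
      \<open>k\<^sup>2\<close> and leaves \<open>1 / k\<^sup>2\<close>.\<close>
    define u where "u = real k / 32"
    have k0: "0 < real k" and u: "0 \<le> u" using k by (auto simp: u_def)
    have "q ^ (k - 8) = exp (- 3 / 32 * real (k - 8))"
      by (simp add: q_def exp_of_nat_mult[symmetric] mult.commute)
    also have "- 3 / 32 * real (k - 8) = 3 / 4 - 3 * u" using k by (simp add: u_def of_nat_diff field_simps)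
    finally have "exp (real k / 16) * q ^ (k - 8) = exp (2 * u + (3 / 4 - 3 * u))"
      by (simp add: u_def exp_add[symmetric])
    also have "\<dots> = exp (3 / 4) / exp u"
      by (simp add: exp_diff[symmetric])
    also have "\<dots> \<le> 4 / (u ^ 4 / 24)"
    proof (intro frac_le)
      have "exp (3 / 4 :: real) \<le> exp 1" by simp
      also have "\<dots> \<le> 3" by (rule exp_le)
      finally show "exp (3 / 4 :: real) \<le> 4" by simp
      have "(\<Sum>n\<in>{4}. u ^ n / fact n) \<le> (\<Sum>n. u ^ n / fact n)"
        using u summable_power_div_fact[of u] by (intro sum_le_suminf) auto
      also have "\<dots> = exp u" by (simp add: exp_def divide_inverse scaleR_conv_of_real mult.commute)
      finally show "u ^ 4 / 24 \<le> exp u" by (simp add: fact_numeral)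
    qed (use k in \<open>auto simp: u_def\<close>)
    also have "\<dots> = 96 * 32 ^ 4 / real k ^ 4" by (simp add: u_def power_divide)
    also have "\<dots> \<le> 2 ^ 27 / real k ^ 4" by (intro divide_right_mono) auto
    finally have "(real k)\<^sup>2 * K ^ 8 * (exp (real k / 16) * q ^ (k - 8)) \<le> (real k)\<^sup>2 * K ^ 8 * (2 ^ 27 / real k ^ 4)"
      using K by (intro mult_left_mono) auto
    then show "(real k)\<^sup>2 * exp (real k / 16) * (K ^ 8 * q ^ (k - 8)) \<le> C0 / k\<^sup>2"
      using k0 by (simp add: tail_const_def mult_ac power4_eq_xxxx power2_eq_square)
  qed
  finally show ?thesis .
qed

lemma small_part_integrable: "integrable M (\<lambda>\<omega>. small_part \<Delta> (mean \<omega>))"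
  using small_part_integral
  by (intro integrableI_nonneg) (auto simp: small_part_nonneg intro: le_less_trans)

lemma small_part_expectation: "expectation (\<lambda>\<omega>. small_part \<Delta> (mean \<omega>)) \<le> C0 / k\<^sup>2"
proof -
  have "0 \<le> C0 / k\<^sup>2" using K by (simp add: tail_const_def)
  then show ?thesis
    using small_part_integral nn_integral_eq_integral[OF small_part_integrable]
    by (simp add: small_part_nonneg)
qed

lemma C0_nonneg: "0 \<le> C0"
  using K by (simp add: tail_const_def)

text \<open>The second moment is kept exact, being the leading term of the variance; the third and
  fourth only enter the error, and both are of order \<open>1 / k\<^sup>2\<close>. The numbers are
  crude: for instance \<open>330 = 303 + 3 * 9\<close>, with 303 bounding the centred fourth moment
  of one score.\<close>

lemma mean_moments:
  shows "j \<le> 4 \<Longrightarrow> integrable M (\<lambda>\<omega>. (mean \<omega> - 1) ^ j)"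
    and "expectation (\<lambda>\<omega>. mean \<omega> - 1) = 0"
    and "expectation (\<lambda>\<omega>. (mean \<omega> - 1) ^ 2) = (3 - 2 * \<Delta>) / k"
    and "\<bar>expectation (\<lambda>\<omega>. (mean \<omega> - 1) ^ 3)\<bar> \<le> 40 / k\<^sup>2"
    and "expectation (\<lambda>\<omega>. (mean \<omega> - 1) ^ 4) \<le> 330 / k\<^sup>2"
proof -
  let ?Z = "\<lambda>j \<omega>. Y j \<omega> - 1" and ?I = "{1..k}"
  define n3 where "n3 = m3 - 3 * (4 - 2 * \<Delta>) + 2"
  define n4 where "n4 = m4 - 4 * m3 + 6 * (4 - 2 * \<Delta>) - 3"
  have k0: "0 < real k" using k by simp
  have ind: "indep_vars (\<lambda>_. borel) ?Z ?I"
    by (rule indep_vars_compose2[OF indep]) auto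
  have int: "integrable M (\<lambda>\<omega>. ?Z i \<omega> ^ j)" if "i \<in> ?I" "j \<le> 4" for i j
  proof -
    have "(\<lambda>\<omega>. ?Z i \<omega> ^ j) = (\<lambda>\<omega>. \<Sum>l\<le>j. real (j choose l) * (Y i \<omega> ^ l * (- 1) ^ (j - l)))"
      using binomial_ring[of "Y i _" "-1" j] by (simp add: fun_eq_iff mult.assoc)
    then show ?thesis
      using that by (auto intro!: Bochner_Integration.integrable_sum integrable_mult_right integrable_mult_left Y_int)
  qed
  have e1: "expectation (?Z i) = 0" if "i \<in> ?I" for i
    using Y_mom(1)[OF that] Y_int[OF that, of 1] prob_space by simp
  have Y1: "integrable M (Y i)" if "i \<in> ?I" for i using Y_int[OF that, of 1] by simp
  have e2: "expectation (\<lambda>\<omega>. ?Z i \<omega> ^ 2) = 3 - 2 * \<Delta>" if i: "i \<in> ?I" for i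
  proof -
    have "(\<lambda>\<omega>. ?Z i \<omega> ^ 2) = (\<lambda>\<omega>. Y i \<omega> ^ 2 - 2 * Y i \<omega> + 1)"
      by (simp add: power2_eq_square algebra_simps fun_eq_iff)
    then show ?thesis
      using Y_mom[OF i] Y_int[OF i, of 2] Y1[OF i] prob_space by simp
  qed
  have e3: "expectation (\<lambda>\<omega>. ?Z i \<omega> ^ 3) = n3" if i: "i \<in> ?I" for i
  proof -
    have "(\<lambda>\<omega>. ?Z i \<omega> ^ 3) = (\<lambda>\<omega>. Y i \<omega> ^ 3 - 3 * Y i \<omega> ^ 2 + 3 * Y i \<omega> - 1)"
      by (simp add: power2_eq_square power3_eq_cube algebra_simps fun_eq_iff)
    then show ?thesis
      using Y_mom[OF i] Y_int[OF i, of 2] Y_int[OF i, of 3] Y1[OF i] prob_space by (simp add: n3_def)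
  qed
  have e4: "expectation (\<lambda>\<omega>. ?Z i \<omega> ^ 4) = n4" if i: "i \<in> ?I" for i
  proof -
    have "(\<lambda>\<omega>. ?Z i \<omega> ^ 4) = (\<lambda>\<omega>. Y i \<omega> ^ 4 - 4 * Y i \<omega> ^ 3 + 6 * Y i \<omega> ^ 2 - 4 * Y i \<omega> + 1)"
      by (simp add: power2_eq_square power3_eq_cube power4_eq_xxxx algebra_simps fun_eq_iff)
    then show ?thesis
      using Y_mom[OF i] Y_int[OF i, of 2] Y_int[OF i, of 3] Y_int[OF i, of 4] Y1[OF i] prob_space
      by (simp add: n4_def)
  qed
  note S = centered_sum_moments[OF _ ind int e1 e2 e3 e4, simplified]
  have mean: "mean \<omega> - 1 = (\<Sum>j\<in>?I. ?Z j \<omega>) / k" for \<omega>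
    using k0 by (simp add: mean_def sum_subtractf diff_divide_distrib)
  show "integrable M (\<lambda>\<omega>. (mean \<omega> - 1) ^ j)" if "j \<le> 4" for j
    using S(1) that unfolding mean power_divide by auto
  show "expectation (\<lambda>\<omega>. mean \<omega> - 1) = 0"
    unfolding mean using S(2) by simp
  show "expectation (\<lambda>\<omega>. (mean \<omega> - 1) ^ 2) = (3 - 2 * \<Delta>) / k"
    unfolding mean power_divide using S(3) k0 by (simp add: power2_eq_square)
  have "expectation (\<lambda>\<omega>. (mean \<omega> - 1) ^ 3) = n3 / k\<^sup>2"
    unfolding mean power_divide using S(4) k0 by (simp add: power2_eq_square power3_eq_cube)
  moreover have "\<bar>n3\<bar> \<le> 40" using m \<Delta> unfolding n3_def by (simp add: abs_le_iff)
  ultimately show "\<bar>expectation (\<lambda>\<omega>. (mean \<omega> - 1) ^ 3)\<bar> \<le> 40 / k\<^sup>2"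
    using k0 by (simp add: divide_right_mono)
  have "expectation (\<lambda>\<omega>. (mean \<omega> - 1) ^ 4) = (k * n4 + 3 * real k * (real k - 1) * (3 - 2 * \<Delta>)\<^sup>2) / k ^ 4"
    unfolding mean power_divide using S(5) k0 by simp
  also have "\<dots> \<le> (real k * real k * 303 + 3 * real k * real k * 9) / k ^ 4"
  proof (intro divide_right_mono add_mono)
    have "n4 \<le> 303" using m \<Delta> unfolding n4_def by simp
    then have "real k * n4 \<le> real k * 303" by (intro mult_left_mono) auto
    also have "\<dots> \<le> real k * real k * 303" using k by (intro mult_right_mono) auto
    finally show "real k * n4 \<le> real k * real k * 303" .
    have "(3 - 2 * \<Delta>)\<^sup>2 \<le> 3\<^sup>2" using \<Delta> by (intro power_mono) auto
    then show "3 * real k * (real k - 1) * (3 - 2 * \<Delta>)\<^sup>2 \<le> 3 * real k * real k * 9"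
      using k0 k by (intro mult_mono) auto
  qed auto
  also have "\<dots> = 330 / k\<^sup>2"
    using k0 by (simp add: power2_eq_square power4_eq_xxxx field_simps)
  finally show "expectation (\<lambda>\<omega>. (mean \<omega> - 1) ^ 4) \<le> 330 / k\<^sup>2" .
qed

text \<open>Centring removes the linear term, so the mean is at most of the order of the variance.
  The constants are \<open>24 = 8 * 3\<close> and \<open>31760 = 96 * 330 + 2 * 40\<close>, the last
  product being the signed cubic term.\<close>

lemma taylor_dev_mean:
  shows "integrable M (\<lambda>\<omega>. taylor_dev \<Delta> (mean \<omega>))"
    and "integrable M (\<lambda>\<omega>. (taylor_dev \<Delta> (mean \<omega>))\<^sup>2)"
    and "\<bar>expectation (\<lambda>\<omega>. taylor_dev \<Delta> (mean \<omega>))\<bar> \<le> (24 + C0) / k"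
    and "\<bar>expectation (\<lambda>\<omega>. (taylor_dev \<Delta> (mean \<omega>))\<^sup>2) - (3 - 2 * \<Delta>) / k\<bar> \<le> (31760 + 3 * C0) / k\<^sup>2"
proof -
  let ?g = "\<lambda>\<omega>. taylor_dev \<Delta> (mean \<omega>)" and ?z = "\<lambda>\<omega>. mean \<omega> - 1" and ?h = "\<lambda>\<omega>. small_part \<Delta> (mean \<omega>)"
  have k1: "1 \<le> real k" using k by simp
  have z: "integrable M ?z" "integrable M (\<lambda>\<omega>. (?z \<omega>)\<^sup>2)" "integrable M (\<lambda>\<omega>. ?z \<omega> ^ 3)" "integrable M (\<lambda>\<omega>. ?z \<omega> ^ 4)"
    using mean_moments(1)[of 1] mean_moments(1)[of 2] mean_moments(1)[of 3] mean_moments(1)[of 4] by auto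
  have le1: "AE \<omega> in M. \<bar>?z \<omega> - ?g \<omega>\<bar> \<le> 8 * (?z \<omega>)\<^sup>2 + ?h \<omega>"
    using mean_pos by eventually_elim (rule taylor_dev_bounds_pos[OF \<Delta>])
  have le2: "AE \<omega> in M. \<bar>(?g \<omega>)\<^sup>2 - (?z \<omega>)\<^sup>2 + (1 + \<Delta>) * ?z \<omega> ^ 3\<bar> \<le> 96 * ?z \<omega> ^ 4 + 3 * ?h \<omega>"
    using mean_pos by eventually_elim (rule taylor_dev_bounds_pos[OF \<Delta>])
  have h1: "integrable M (\<lambda>\<omega>. 8 * (?z \<omega>)\<^sup>2 + ?h \<omega>)"
    using z small_part_integrable by auto
  have h2: "integrable M (\<lambda>\<omega>. 96 * ?z \<omega> ^ 4 + 3 * ?h \<omega>)"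
    using z small_part_integrable by auto
  \<comment> \<open>The remainders are dominated by integrable functions; integrability of
    \<open>?g\<close> and of its square then follows by subtraction from the integrable powers of
    \<open>?z\<close>.\<close>
  have r1: "integrable M (\<lambda>\<omega>. ?z \<omega> - ?g \<omega>)"
    by (rule Bochner_Integration.integrable_bound[OF h1]) (use le1 in \<open>auto elim!: eventually_mono\<close>)
  have r2: "integrable M (\<lambda>\<omega>. (?g \<omega>)\<^sup>2 - (?z \<omega>)\<^sup>2 + (1 + \<Delta>) * ?z \<omega> ^ 3)"
    by (rule Bochner_Integration.integrable_bound[OF h2]) (use le2 in \<open>auto elim!: eventually_mono\<close>)
  have z3: "integrable M (\<lambda>\<omega>. (1 + \<Delta>) * ?z \<omega> ^ 3)" using z by auto
  show g1: "integrable M ?g"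
    using Bochner_Integration.integrable_diff[OF z(1) r1] by simp
  show g2: "integrable M (\<lambda>\<omega>. (?g \<omega>)\<^sup>2)"
    using Bochner_Integration.integrable_diff[OF Bochner_Integration.integrable_add[OF r2 z(2)] z3] by simp
  have "\<bar>expectation ?z - expectation ?g\<bar> = \<bar>expectation (\<lambda>\<omega>. ?z \<omega> - ?g \<omega>)\<bar>"
    using z g1 by simp
  also have "\<dots> \<le> expectation (\<lambda>\<omega>. \<bar>?z \<omega> - ?g \<omega>\<bar>)" by (rule integral_abs_bound)
  also have "\<dots> \<le> expectation (\<lambda>\<omega>. 8 * (?z \<omega>)\<^sup>2 + ?h \<omega>)"
    by (intro integral_mono_AE integrable_abs r1 h1 le1)
  also have "\<dots> = 8 * ((3 - 2 * \<Delta>) / k) + expectation ?h"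
    using z small_part_integrable mean_moments(3) by simp
  also have "\<dots> \<le> 8 * (3 / k) + C0 / k\<^sup>2"
    using small_part_expectation \<Delta> by (intro add_mono mult_left_mono divide_right_mono) auto
  also have "C0 / k\<^sup>2 \<le> C0 / k"
    using k1 C0_nonneg by (intro divide_left_mono) (auto simp: power2_eq_square)
  also have "8 * (3 / k) + C0 / k = (24 + C0) / k" by (simp add: add_divide_distrib)
  finally show "\<bar>expectation ?g\<bar> \<le> (24 + C0) / k"
    using mean_moments(2) by simp
  have E2: "expectation (\<lambda>\<omega>. (?g \<omega>)\<^sup>2 - (?z \<omega>)\<^sup>2 + (1 + \<Delta>) * ?z \<omega> ^ 3)
      = expectation (\<lambda>\<omega>. (?g \<omega>)\<^sup>2) - (3 - 2 * \<Delta>) / k + (1 + \<Delta>) * expectation (\<lambda>\<omega>. ?z \<omega> ^ 3)"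
    using z g2 mean_moments(3) by simp
  have "\<bar>expectation (\<lambda>\<omega>. (?g \<omega>)\<^sup>2 - (?z \<omega>)\<^sup>2 + (1 + \<Delta>) * ?z \<omega> ^ 3)\<bar>
      \<le> expectation (\<lambda>\<omega>. \<bar>(?g \<omega>)\<^sup>2 - (?z \<omega>)\<^sup>2 + (1 + \<Delta>) * ?z \<omega> ^ 3\<bar>)" by (rule integral_abs_bound)
  also have "\<dots> \<le> expectation (\<lambda>\<omega>. 96 * ?z \<omega> ^ 4 + 3 * ?h \<omega>)"
    by (intro integral_mono_AE integrable_abs r2 h2 le2)
  also have "\<dots> = 96 * expectation (\<lambda>\<omega>. ?z \<omega> ^ 4) + 3 * expectation ?h"
    using z small_part_integrable by simp
  also have "\<dots> \<le> 96 * (330 / k\<^sup>2) + 3 * (C0 / k\<^sup>2)"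
    using small_part_expectation mean_moments(5) by (intro add_mono mult_left_mono) auto
  finally have a: "\<bar>expectation (\<lambda>\<omega>. (?g \<omega>)\<^sup>2) - (3 - 2 * \<Delta>) / k + (1 + \<Delta>) * expectation (\<lambda>\<omega>. ?z \<omega> ^ 3)\<bar>
      \<le> 96 * (330 / k\<^sup>2) + 3 * (C0 / k\<^sup>2)"
    unfolding E2 .
  have b: "\<bar>(1 + \<Delta>) * expectation (\<lambda>\<omega>. ?z \<omega> ^ 3)\<bar> \<le> 2 * (40 / k\<^sup>2)"
    unfolding abs_mult using \<Delta> mean_moments(4) by (intro mult_mono) auto
  have "\<bar>expectation (\<lambda>\<omega>. (?g \<omega>)\<^sup>2) - (3 - 2 * \<Delta>) / k\<bar> \<le> (96 * (330 / k\<^sup>2) + 3 * (C0 / k\<^sup>2)) + 2 * (40 / k\<^sup>2)"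
    using a b by linarith
  also have "\<dots> = (31760 + 3 * C0) / k\<^sup>2" by (simp add: add_divide_distrib)
  finally show "\<bar>expectation (\<lambda>\<omega>. (?g \<omega>)\<^sup>2) - (3 - 2 * \<Delta>) / k\<bar> \<le> (31760 + 3 * C0) / k\<^sup>2" .
qed

text \<open>The power is \<open>1 - \<Delta> * taylor_dev\<close> identically, so the mean error
  carries \<open>\<Delta>\<close> and the variance \<open>\<Delta>\<^sup>2\<close>. The squared mean
  of \<open>taylor_dev\<close> is of order \<open>1 / k\<^sup>2\<close>; it joins the error as
  \<open>(24 + C0)\<^sup>2\<close>.\<close>

lemma mean_powr_expansion:
  shows "integrable M (\<lambda>\<omega>. mean \<omega> powr (- \<Delta>))"
    and "integrable M (\<lambda>\<omega>. (mean \<omega> powr (- \<Delta>))\<^sup>2)"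
    and "\<bar>expectation (\<lambda>\<omega>. mean \<omega> powr (- \<Delta>)) - 1\<bar> \<le> \<Delta> * ((24 + C0) / k)"
    and "\<bar>variance (\<lambda>\<omega>. mean \<omega> powr (- \<Delta>)) - \<Delta>\<^sup>2 * ((3 - 2 * \<Delta>) / k)\<bar>
      \<le> \<Delta>\<^sup>2 * ((31760 + 3 * C0 + (24 + C0)\<^sup>2) / k\<^sup>2)"
proof -
  let ?g = "\<lambda>\<omega>. taylor_dev \<Delta> (mean \<omega>)"
  note g = taylor_dev_mean(1,2)
  have f: "mean \<omega> powr (- \<Delta>) = 1 - \<Delta> * ?g \<omega>" for \<omega>
    using \<Delta> by (simp add: taylor_dev_def)
  have f2: "(1 - \<Delta> * ?g \<omega>)\<^sup>2 = 1 - 2 * \<Delta> * ?g \<omega> + \<Delta>\<^sup>2 * (?g \<omega>)\<^sup>2" for \<omega>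
    by (simp add: power2_eq_square algebra_simps)
  have int1: "integrable M (\<lambda>\<omega>. 1 - \<Delta> * ?g \<omega>)" using g by auto
  have int2: "integrable M (\<lambda>\<omega>. (1 - \<Delta> * ?g \<omega>)\<^sup>2)" unfolding f2 using g by auto
  show "integrable M (\<lambda>\<omega>. mean \<omega> powr (- \<Delta>))" unfolding f by (rule int1)
  show "integrable M (\<lambda>\<omega>. (mean \<omega> powr (- \<Delta>))\<^sup>2)" unfolding f by (rule int2)
  have E: "expectation (\<lambda>\<omega>. 1 - \<Delta> * ?g \<omega>) = 1 - \<Delta> * expectation ?g"
    using g prob_space by simp
  show "\<bar>expectation (\<lambda>\<omega>. mean \<omega> powr (- \<Delta>)) - 1\<bar> \<le> \<Delta> * ((24 + C0) / k)"
  proof -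
    have "\<Delta> * \<bar>expectation ?g\<bar> \<le> \<Delta> * ((24 + C0) / k)"
      using \<Delta> taylor_dev_mean(3) by (intro mult_left_mono) auto
    moreover have "\<bar>1 - \<Delta> * expectation ?g - 1\<bar> = \<Delta> * \<bar>expectation ?g\<bar>"
      using \<Delta> by (simp add: abs_mult)
    ultimately show ?thesis unfolding f E by simp
  qed
  have "variance (\<lambda>\<omega>. 1 - \<Delta> * ?g \<omega>) = expectation (\<lambda>\<omega>. (1 - \<Delta> * ?g \<omega>)\<^sup>2) - (1 - \<Delta> * expectation ?g)\<^sup>2"
    unfolding E[symmetric] by (rule variance_eq[OF int1 int2])
  also have "expectation (\<lambda>\<omega>. (1 - \<Delta> * ?g \<omega>)\<^sup>2) = 1 - 2 * \<Delta> * expectation ?g + \<Delta>\<^sup>2 * expectation (\<lambda>\<omega>. (?g \<omega>)\<^sup>2)"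
    unfolding f2 using g prob_space by simp
  finally have V: "variance (\<lambda>\<omega>. 1 - \<Delta> * ?g \<omega>) = \<Delta>\<^sup>2 * (expectation (\<lambda>\<omega>. (?g \<omega>)\<^sup>2) - (expectation ?g)\<^sup>2)"
    by (simp add: power2_eq_square algebra_simps)
  have "(expectation ?g)\<^sup>2 = \<bar>expectation ?g\<bar>\<^sup>2" by simp
  also have "\<dots> \<le> ((24 + C0) / k)\<^sup>2" using taylor_dev_mean(3) by (intro power_mono) auto
  finally have sq: "(expectation ?g)\<^sup>2 \<le> (24 + C0)\<^sup>2 / k\<^sup>2" by (simp add: power_divide)
  have "\<bar>expectation (\<lambda>\<omega>. (?g \<omega>)\<^sup>2) - (expectation ?g)\<^sup>2 - (3 - 2 * \<Delta>) / k\<bar>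
      \<le> (31760 + 3 * C0) / k\<^sup>2 + (24 + C0)\<^sup>2 / k\<^sup>2"
    using taylor_dev_mean(4) sq zero_le_power2[of "expectation ?g"] by linarith
  then have "\<Delta>\<^sup>2 * \<bar>expectation (\<lambda>\<omega>. (?g \<omega>)\<^sup>2) - (expectation ?g)\<^sup>2 - (3 - 2 * \<Delta>) / k\<bar>
      \<le> \<Delta>\<^sup>2 * ((31760 + 3 * C0 + (24 + C0)\<^sup>2) / k\<^sup>2)"
    by (intro mult_left_mono) (auto simp: add_divide_distrib)
  moreover have "\<bar>\<Delta>\<^sup>2 * x - \<Delta>\<^sup>2 * y\<bar> = \<Delta>\<^sup>2 * \<bar>x - y\<bar>" for x y :: real
    by (simp add: right_diff_distrib[symmetric] abs_mult)
  ultimately show "\<bar>variance (\<lambda>\<omega>. mean \<omega> powr (- \<Delta>)) - \<Delta>\<^sup>2 * ((3 - 2 * \<Delta>) / k)\<bar>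
      \<le> \<Delta>\<^sup>2 * ((31760 + 3 * C0 + (24 + C0)\<^sup>2) / k\<^sup>2)"
    unfolding f V by (simp only:)
qed

end

section \<open>Projections\<close>

lemma AE_stable_weight_pos:
  assumes "0 < \<Delta>" "\<Delta> < 1"
  shows "AE x in weight_law. 0 < stable_weight \<Delta> (fst x) (snd x)"
  using AE_weight_law by eventually_elim (auto intro: stable_weight_pos assms)

lemma unit_score_integral:
  assumes "0 < \<Delta>" "\<Delta> < 1" "0 < m"
  shows "integrable weight_law (\<lambda>x. unit_score \<Delta> x ^ m)"
    and "(\<integral>x. unit_score \<Delta> x ^ m \<partial>weight_law) = (\<Prod>l<m. real m - real l * \<Delta>)"
proof -
  have nn: "AE x in weight_law. 0 \<le> unit_score \<Delta> x ^ m"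
    using AE_unit_score_pos[OF assms(1,2)] by eventually_elim simp
  have P: "0 \<le> (\<Prod>l<m. real m - real l * \<Delta>)"
  proof (intro prod_nonneg ballI)
    fix l assume "l \<in> {..<m}"
    then have "real l * \<Delta> \<le> real m * 1" using assms by (intro mult_mono) auto
    then show "0 \<le> real m - real l * \<Delta>" by simp
  qed
  show "integrable weight_law (\<lambda>x. unit_score \<Delta> x ^ m)"
    using nn unit_score_moment[OF assms] by (intro integrableI_nonneg) auto
  show "(\<integral>x. unit_score \<Delta> x ^ m \<partial>weight_law) = (\<Prod>l<m. real m - real l * \<Delta>)"
    using nn unit_score_moment[OF assms] P by (subst integral_eq_nn_integral) auto
qed

text \<open>The blocks \<open>{Inl p, Inr p}\<close> of the disjoint-sum index are pairwise
  disjoint, which gives independence across \<open>p\<close>. Independence within a pair comes from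
  \<open>indep_var_of_indep_vars\<close>.\<close>

lemma (in prob_space) indep_vars_Pair:
  assumes "indep_vars (\<lambda>_. borel) (case_sum X Y) (A <+> A)"
  shows "indep_vars (\<lambda>_. borel \<Otimes>\<^sub>M borel) (\<lambda>p \<omega>. (X p \<omega>, Y p \<omega>)) A"
proof -
  have "indep_vars (\<lambda>p. PiM {Inl p, Inr p} (\<lambda>_. borel))
      (\<lambda>p \<omega>. restrict (\<lambda>i. case_sum X Y i \<omega>) {Inl p, Inr p}) A"
    using assms by (rule indep_vars_restrict) (auto simp: disjoint_family_on_def)
  from indep_vars_compose2[OF this, of "\<lambda>p f. (f (Inl p), f (Inr p))" "\<lambda>_. borel \<Otimes>\<^sub>M borel"]
  show ?thesis by simp
qed

lemma (in prob_space) indep_var_of_indep_vars: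
  assumes ind: "indep_vars (\<lambda>_. borel) X I" and "i \<in> I" "j \<in> I" "i \<noteq> j"
  shows "indep_var borel (X i) borel (X j)"
proof -
  have "indep_var
    borel ((\<lambda>f. f i) \<circ> (\<lambda>\<omega>. restrict (\<lambda>i. X i \<omega>) {i}))
    borel ((\<lambda>f. f j) \<circ> (\<lambda>\<omega>. restrict (\<lambda>i. X i \<omega>) {j}))"
    using assms by (intro indep_var_compose[OF indep_var_restrict[OF ind]]) auto
  then show ?thesis by (simp add: comp_def)
qed

section \<open>Laws of the projections and form of the estimator\<close>

locale projection_sample = prob_space M for M :: "'a measure" +
  fixes \<Delta> :: real and D k :: nat and A :: "nat \<Rightarrow> real"
    and v w :: "nat \<Rightarrow> nat \<Rightarrow> 'a \<Rightarrow> real"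
  assumes \<Delta>: "0 < \<Delta>" "\<Delta> < 1"
    and A_nonneg: "\<And>i. i \<in> {1..D} \<Longrightarrow> 0 \<le> A i" and A_nonzero: "\<exists>i\<in>{1..D}. A i \<noteq> 0"
    and arrays: "uniform_exponential_arrays M D k v w"
begin

abbreviation F :: real where "F \<equiv> frequency_moment (1 - \<Delta>) D A"

abbreviation pairs :: "(nat \<times> nat) set" where "pairs \<equiv> {1..D} \<times> {1..k}"

lemma F_pos: "0 < F"
proof -
  obtain i where i: "i \<in> {1..D}" "A i \<noteq> 0" using A_nonzero by blast
  then have "0 < A i powr (1 - \<Delta>)" by simp
  then show ?thesis
    unfolding frequency_moment_def using i by (intro sum_pos2[of _ i]) auto
qed

lemma indep_all: "indep_vars (\<lambda>_. borel) (case_sum (\<lambda>(i, j). v i j) (\<lambda>(i, j). w i j)) (pairs <+> pairs)"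
  using arrays by (simp add: uniform_exponential_arrays_def)

lemma indep_pairs: "indep_vars (\<lambda>_. borel \<Otimes>\<^sub>M borel) (\<lambda>p \<omega>. (v (fst p) (snd p) \<omega>, w (fst p) (snd p) \<omega>)) pairs"
  using indep_vars_Pair[OF indep_all] by (simp add: case_prod_beta')

lemma distr_pair:
  assumes "p \<in> pairs"
  shows "distr M (borel \<Otimes>\<^sub>M borel) (\<lambda>\<omega>. (v (fst p) (snd p) \<omega>, w (fst p) (snd p) \<omega>)) = weight_law"
proof -
  obtain i j where p: "p = (i, j)" "i \<in> {1..D}" "j \<in> {1..k}" using assms by auto
  have "distributed M lborel (v i j) (\<lambda>x. indicator {0<..<pi} x / ennreal pi)"
    "distributed M lborel (w i j) (\<lambda>x. ennreal (exponential_density 1 x))"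
    using arrays p by (auto simp: uniform_exponential_arrays_def)
  then have d: "distr M lborel (v i j) = angle_law" "distr M lborel (w i j) = exp_law"
    by (auto simp: distributed_def angle_law_def exp_law_def)
  have "distr M borel (v i j) = distr M lborel (v i j)" "distr M borel (w i j) = distr M lborel (w i j)"
    by (auto intro!: distr_cong)
  with d have d: "distr M borel (v i j) = angle_law" "distr M borel (w i j) = exp_law"
    by auto
  have "indep_var borel (v i j) borel (w i j)"
    using indep_var_of_indep_vars[OF indep_all, of "Inl p" "Inr p"] p by (auto simp: Plus_def)
  then show ?thesis
    unfolding indep_var_distribution_eq d weight_law_def using p by simp
qed

definition weight :: "nat \<times> nat \<Rightarrow> 'a \<Rightarrow> real" where
  "weight p \<omega> = stable_weight \<Delta> (v (fst p) (snd p) \<omega>) (w (fst p) (snd p) \<omega>)"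

lemma indep_weight: "indep_vars (\<lambda>_. borel) weight pairs"
proof -
  have "indep_vars (\<lambda>_. borel) (\<lambda>p \<omega>. (\<lambda>x. stable_weight \<Delta> (fst x) (snd x)) (v (fst p) (snd p) \<omega>, w (fst p) (snd p) \<omega>)) pairs"
    by (rule indep_vars_compose2[OF indep_pairs]) measurable
  then show ?thesis by (simp add: weight_def[abs_def])
qed

lemma distr_weight:
  assumes "p \<in> pairs"
  shows "distr M borel (weight p) = distr weight_law borel (\<lambda>x. stable_weight \<Delta> (fst x) (snd x))"
proof -
  have [measurable]: "(\<lambda>\<omega>. (v (fst p) (snd p) \<omega>, w (fst p) (snd p) \<omega>)) \<in> M \<rightarrow>\<^sub>M borel \<Otimes>\<^sub>M borel"
    using indep_pairs assms by (auto simp: indep_vars_def)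
  show ?thesis
    unfolding distr_pair[OF assms, symmetric]
    by (subst distr_distr) (auto simp: comp_def weight_def[abs_def])
qed

lemma weight_rv: "p \<in> pairs \<Longrightarrow> weight p \<in> borel_measurable M"
  using indep_weight by (auto simp: indep_vars_def)

lemma weight_pos: "p \<in> pairs \<Longrightarrow> AE \<omega> in M. 0 < weight p \<omega>"
proof -
  assume p: "p \<in> pairs"
  have "AE x in distr weight_law borel (\<lambda>x. stable_weight \<Delta> (fst x) (snd x)). 0 < x"
    using AE_stable_weight_pos[OF \<Delta>] by (subst AE_distr_iff) auto
  then show ?thesis
    using weight_rv[OF p] unfolding distr_weight[OF p, symmetric] by (subst (asm) AE_distr_iff) auto
qed

abbreviation proj :: "nat \<Rightarrow> 'a \<Rightarrow> real" where "proj \<equiv> projection \<Delta> D A v w"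

lemma proj_eq: "proj j \<omega> = (\<Sum>i=1..D. weight (i, j) \<omega> * A i)"
  by (simp add: projection_def weight_def)

lemma indep_proj: "indep_vars (\<lambda>_. borel) proj {1..k}"
proof -
  let ?K = "\<lambda>j. {1..D} \<times> {j}"
  have "indep_vars (\<lambda>j. PiM (?K j) (\<lambda>_. borel)) (\<lambda>j \<omega>. restrict (\<lambda>p. weight p \<omega>) (?K j)) {1..k}"
    using indep_weight by (rule indep_vars_restrict) (auto simp: disjoint_family_on_def)
  then have "indep_vars (\<lambda>_. borel)
      (\<lambda>j \<omega>. (\<lambda>f. \<Sum>i=1..D. f (i, j) * A i) (restrict (\<lambda>p. weight p \<omega>) (?K j))) {1..k}"
    by (rule indep_vars_compose2) (auto intro!: borel_measurable_sum borel_measurable_times measurable_component_singleton)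
  then show ?thesis
    by (rule indep_vars_cong[THEN iffD1, rotated -1]) (auto simp: proj_eq fun_eq_iff)
qed

lemma proj_rv: "j \<in> {1..k} \<Longrightarrow> proj j \<in> borel_measurable M"
  using indep_proj by (auto simp: indep_vars_def)

text \<open>Independence over \<open>i\<close> gives a product whose factors are the transform of
  one weight at \<open>real n * A i\<close>. A zero entry contributes the factor 1, in accordance
  with \<open>0 powr (1 - \<Delta>) = 0\<close>.\<close>

lemma proj_laplace:
  assumes j: "j \<in> {1..k}"
  shows "expectation (\<lambda>\<omega>. exp (- (real n * proj j \<omega>))) = exp (- (real n powr (1 - \<Delta>) * F))"
proof -
  let ?f = "\<lambda>i \<omega>. exp (- (real n * A i * weight (i, j) \<omega>))"
  have ind: "indep_vars (\<lambda>_. borel) ?f {1..D}"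
  proof -
    let ?K = "\<lambda>i. {(i, j)}"
    have "indep_vars (\<lambda>i. PiM (?K i) (\<lambda>_. borel)) (\<lambda>i \<omega>. restrict (\<lambda>p. weight p \<omega>) (?K i)) {1..D}"
      using indep_weight by (rule indep_vars_restrict) (use j in \<open>auto simp: disjoint_family_on_def\<close>)
    then have "indep_vars (\<lambda>_. borel)
        (\<lambda>i \<omega>. (\<lambda>f. exp (- (real n * A i * f (i, j)))) (restrict (\<lambda>p. weight p \<omega>) (?K i))) {1..D}"
    proof (rule indep_vars_compose2)
      fix i :: nat
      have [measurable]: "(\<lambda>f. f (i, j)) \<in> borel_measurable (PiM {(i, j)} (\<lambda>_. borel :: real measure))"
        by (rule measurable_component_singleton) simp
      show "(\<lambda>f. exp (- (real n * A i * f (i, j)))) \<in> borel_measurable (PiM {(i, j)} (\<lambda>_. borel))"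
        by measurable
    qed
    then show ?thesis by simp
  qed
  have rv: "?f i \<in> borel_measurable M" if "i \<in> {1..D}" for i
    using ind that by (auto simp: indep_vars_def)
  have int: "integrable M (?f i)" if i: "i \<in> {1..D}" for i
  proof (rule integrable_const_bound[of _ 1])
    have "AE \<omega> in M. 0 < weight (i, j) \<omega>" using i j by (intro weight_pos) auto
    then show "AE \<omega> in M. norm (?f i \<omega>) \<le> 1"
      by eventually_elim (use A_nonneg[OF i] in auto)
  qed (rule rv[OF i])
  have E: "expectation (?f i) = exp (- (real n powr (1 - \<Delta>) * A i powr (1 - \<Delta>)))" if i: "i \<in> {1..D}" for i
  proof -
    have p: "(i, j) \<in> pairs" using i j by simp
    have "expectation (?f i) = (\<integral>s. exp (- (real n * A i * s)) \<partial>distr M borel (weight (i, j)))"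
      using weight_rv[OF p] by (subst integral_distr) auto
    also have "\<dots> = (\<integral>x. exp (- ((real n * A i) * stable_weight \<Delta> (fst x) (snd x))) \<partial>weight_law)"
      unfolding distr_weight[OF p] by (subst integral_distr) auto
    also have "\<dots> = exp (- ((real n * A i) powr (1 - \<Delta>)))"
      using \<Delta> A_nonneg[OF i] by (intro stable_weight_laplace) auto
    finally show ?thesis using A_nonneg[OF i] by (simp add: powr_mult)
  qed
  have "expectation (\<lambda>\<omega>. exp (- (real n * proj j \<omega>))) = expectation (\<lambda>\<omega>. \<Prod>i=1..D. ?f i \<omega>)"
    by (intro Bochner_Integration.integral_cong refl)
       (simp add: proj_eq exp_sum[symmetric] sum_distrib_left sum_negf mult_ac)
  also have "\<dots> = (\<Prod>i=1..D. expectation (?f i))"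
    by (rule indep_vars_lebesgue_integral[OF _ ind int]) auto
  also have "\<dots> = (\<Prod>i=1..D. exp (- (real n powr (1 - \<Delta>) * A i powr (1 - \<Delta>))))"
    by (intro prod.cong refl E)
  also have "\<dots> = exp (- (real n powr (1 - \<Delta>) * F))"
    by (simp add: exp_sum[symmetric] frequency_moment_def sum_distrib_left sum_negf)
  finally show ?thesis .
qed

text \<open>Both Laplace transforms are \<open>exp (- (real n powr (1 - \<Delta>) * F))\<close>, the
  scale being chosen so that its power \<open>1 - \<Delta>\<close> is \<open>F\<close>. From here on
  \<open>D\<close> and \<open>A\<close> enter only through \<open>F\<close>.\<close>

lemma distr_proj:
  assumes j: "j \<in> {1..k}"
  shows "distr M borel (proj j)
    = distr weight_law borel (\<lambda>x. F powr (1 / (1 - \<Delta>)) * stable_weight \<Delta> (fst x) (snd x))"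
    (is "_ = distr _ _ ?S")
proof (rule laplace_unique)
  interpret W: prob_space weight_law by (rule prob_space_weight_law)
  show "real_distribution (distr M borel (proj j))"
    by (rule real_distribution_distr[OF proj_rv[OF j]])
  show "real_distribution (distr weight_law borel ?S)"
    by (rule W.real_distribution_distr) measurable
  show "AE x in distr M borel (proj j). 0 \<le> x"
  proof -
    have "AE \<omega> in M. \<forall>i\<in>{1..D}. 0 < weight (i, j) \<omega>"
      using j by (subst AE_finite_all) (auto intro!: weight_pos)
    then have "AE \<omega> in M. 0 \<le> proj j \<omega>"
      by eventually_elim (auto simp: proj_eq less_imp_le intro!: sum_nonneg A_nonneg mult_nonneg_nonneg)
    then show ?thesis using proj_rv[OF j] by (subst AE_distr_iff) auto
  qed
  show "AE x in distr weight_law borel ?S. 0 \<le> x"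
  proof -
    have "AE x in weight_law. 0 \<le> ?S x"
      using AE_stable_weight_pos[OF \<Delta>] by eventually_elim simp
    then show ?thesis by (subst AE_distr_iff) auto
  qed
  fix n :: nat
  have "(\<integral>x. exp (- (real n * x)) \<partial>distr M borel (proj j)) = exp (- (real n powr (1 - \<Delta>) * F))"
    using proj_rv[OF j] by (subst integral_distr) (auto simp: proj_laplace[OF j])
  moreover have "(\<integral>x. exp (- (real n * x)) \<partial>distr weight_law borel ?S) = exp (- (real n powr (1 - \<Delta>) * F))"
  proof -
    have "(\<integral>x. exp (- (real n * x)) \<partial>distr weight_law borel ?S)
        = (\<integral>x. exp (- ((real n * F powr (1 / (1 - \<Delta>))) * stable_weight \<Delta> (fst x) (snd x))) \<partial>weight_law)"
      by (subst integral_distr) (auto simp: mult.assoc)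
    also have "\<dots> = exp (- ((real n * F powr (1 / (1 - \<Delta>))) powr (1 - \<Delta>)))"
      using \<Delta> by (intro stable_weight_laplace) auto
    also have "(real n * F powr (1 / (1 - \<Delta>))) powr (1 - \<Delta>) = real n powr (1 - \<Delta>) * F"
      using \<Delta> F_pos by (simp add: powr_mult powr_powr)
    finally show ?thesis .
  qed
  ultimately show "(\<integral>x. exp (- (real n * x)) \<partial>distr M borel (proj j))
      = (\<integral>x. exp (- (real n * x)) \<partial>distr weight_law borel ?S)" by simp
qed

text \<open>\<open>F powr (1 / \<Delta>)\<close> cancels the scale of the projection, because
  \<open>1 / (1 - \<Delta>)\<close> times \<open>- (1 - \<Delta>) / \<Delta>\<close> is
  \<open>- 1 / \<Delta>\<close>; the factor \<open>\<Delta>\<close> normalises the mean to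
  1.\<close>

definition score :: "nat \<Rightarrow> 'a \<Rightarrow> real" where
  "score j \<omega> = \<Delta> * F powr (1 / \<Delta>) * proj j \<omega> powr (- (1 - \<Delta>) / \<Delta>)"

lemma indep_score: "indep_vars (\<lambda>_. borel) score {1..k}"
  unfolding score_def[abs_def] by (rule indep_vars_compose2[OF indep_proj]) measurable

lemma score_rv: "j \<in> {1..k} \<Longrightarrow> score j \<in> borel_measurable M"
  using indep_score by (auto simp: indep_vars_def)

lemma distr_score:
  assumes j: "j \<in> {1..k}"
  shows "distr M borel (score j) = distr weight_law borel (unit_score \<Delta>)"
proof -
  let ?h = "\<lambda>x. \<Delta> * F powr (1 / \<Delta>) * x powr (- (1 - \<Delta>) / \<Delta>)"
  have "distr M borel (score j) = distr (distr M borel (proj j)) borel ?h"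
    using proj_rv[OF j] by (subst distr_distr) (auto simp: comp_def score_def[abs_def])
  also have "\<dots> = distr weight_law borel (\<lambda>x. ?h (F powr (1 / (1 - \<Delta>)) * stable_weight \<Delta> (fst x) (snd x)))"
    unfolding distr_proj[OF j] by (subst distr_distr) (auto simp: comp_def)
  also have "\<dots> = distr weight_law borel (unit_score \<Delta>)"
  proof (rule distr_cong_AE)
    show "AE x in weight_law. ?h (F powr (1 / (1 - \<Delta>)) * stable_weight \<Delta> (fst x) (snd x)) = unit_score \<Delta> x"
      using AE_weight_law
    proof eventually_elim
      case (elim x)
      then have S: "0 < stable_weight \<Delta> (fst x) (snd x)"
        using \<Delta> by (intro stable_weight_pos) auto
      have e: "1 / (1 - \<Delta>) * (- (1 - \<Delta>) / \<Delta>) = - (1 / \<Delta>)"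
        using \<Delta> by (simp add: field_simps)
      have "(F powr (1 / (1 - \<Delta>)) * stable_weight \<Delta> (fst x) (snd x)) powr (- (1 - \<Delta>) / \<Delta>)
          = F powr (- (1 / \<Delta>)) * stable_weight \<Delta> (fst x) (snd x) powr (- (1 - \<Delta>) / \<Delta>)"
        using S F_pos by (subst powr_mult) (auto simp only: powr_powr e powr_ge_zero less_imp_le)
      moreover have "F powr (1 / \<Delta>) * F powr (- (1 / \<Delta>)) = 1"
        using F_pos by (simp add: powr_add[symmetric])
      ultimately show ?case
        by (simp add: unit_score_def mult.assoc[symmetric])
    qed
  qed auto
  finally show ?thesis .
qed

lemma score_integral:
  assumes j: "j \<in> {1..k}" and m: "0 < m"
  shows "integrable M (\<lambda>\<omega>. score j \<omega> ^ m)"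
    and "expectation (\<lambda>\<omega>. score j \<omega> ^ m) = (\<Prod>l<m. real m - real l * \<Delta>)"
proof -
  have [measurable]: "score j \<in> borel_measurable M" by (rule score_rv[OF j])
  have "integrable (distr M borel (score j)) (\<lambda>x. x ^ m)"
    unfolding distr_score[OF j] using unit_score_integral[OF \<Delta> m] by (subst integrable_distr_eq) auto
  then show "integrable M (\<lambda>\<omega>. score j \<omega> ^ m)"
    by (subst (asm) integrable_distr_eq) auto
  have "expectation (\<lambda>\<omega>. score j \<omega> ^ m) = (\<integral>x. x ^ m \<partial>distr M borel (score j))"
    by (subst integral_distr) auto
  also have "\<dots> = (\<Prod>l<m. real m - real l * \<Delta>)"
    unfolding distr_score[OF j] using unit_score_integral[OF \<Delta> m] by (subst integral_distr) auto
  finally show "expectation (\<lambda>\<omega>. score j \<omega> ^ m) = (\<Prod>l<m. real m - real l * \<Delta>)" .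
qed

lemma score_sample:
  assumes k: "8 \<le> k" and K: "1 \<le> K"
    "(\<integral>\<^sup>+x. ennreal ((1 + lower_dev \<Delta> (unit_score \<Delta> x)) powr (1 / 4)) \<partial>weight_law) \<le> ennreal K"
  shows "score_sample M score \<Delta> K (\<Prod>l<3. 3 - real l * \<Delta>) (\<Prod>l<4. 4 - real l * \<Delta>) k"
proof
  show "AE \<omega> in M. 0 < score j \<omega>" if j: "j \<in> {1..k}" for j
  proof -
    have "AE x in distr M borel (score j). 0 < x"
      unfolding distr_score[OF j] using AE_unit_score_pos[OF \<Delta>] by (subst AE_distr_iff) auto
    then show ?thesis using score_rv[OF j] by (subst (asm) AE_distr_iff) auto
  qed
  show "integrable M (\<lambda>\<omega>. score j \<omega> ^ m)" if j: "j \<in> {1..k}" for j m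
    using score_integral(1)[OF j, of m] by (cases "m = 0") auto
  fix j assume j: "j \<in> {1..k}"
  show "expectation (score j) = 1"
    using score_integral(2)[OF j, of 1] by simp
  show "expectation (\<lambda>\<omega>. score j \<omega> ^ 2) = 4 - 2 * \<Delta>"
    using score_integral(2)[OF j, of 2] by (simp add: numeral_2_eq_2)
  show "expectation (\<lambda>\<omega>. score j \<omega> ^ 3) = (\<Prod>l<3. 3 - real l * \<Delta>)"
    "expectation (\<lambda>\<omega>. score j \<omega> ^ 4) = (\<Prod>l<4. 4 - real l * \<Delta>)"
    using score_integral(2)[OF j, of 3] score_integral(2)[OF j, of 4] by auto
  have "(\<integral>\<^sup>+\<omega>. ennreal ((1 + lower_dev \<Delta> (score j \<omega>)) powr (1 / 4)) \<partial>M)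
      = (\<integral>\<^sup>+x. ennreal ((1 + lower_dev \<Delta> x) powr (1 / 4)) \<partial>distr M borel (score j))"
    using score_rv[OF j] by (subst nn_integral_distr) auto
  also have "\<dots> \<le> ennreal K"
    unfolding distr_score[OF j] using K(2) by (subst nn_integral_distr) auto
  finally show "(\<integral>\<^sup>+\<omega>. ennreal ((1 + lower_dev \<Delta> (score j \<omega>)) powr (1 / 4)) \<partial>M) \<le> ennreal K" .
next
  have b: "0 \<le> real n - real l * \<Delta> \<and> real n - real l * \<Delta> \<le> real n" if "l < n" for l n :: nat
  proof -
    have "real l * \<Delta> \<le> real n * 1" using \<Delta> that by (intro mult_mono) auto
    then show ?thesis using \<Delta> by simp
  qed
  have n: "0 \<le> (\<Prod>l<n. real n - real l * \<Delta>)" for n :: nat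
    by (rule prod_nonneg) (use b lessThan_iff in blast)
  \<comment> \<open>The bounds 27 and 256 of the locale are \<open>3 ^ 3\<close> and
    \<open>4 ^ 4\<close>.\<close>
  have u: "(\<Prod>l<n. real n - real l * \<Delta>) \<le> (\<Prod>l<n. real n)" for n :: nat
    by (rule prod_mono) (use b lessThan_iff in blast)
  from n[of 3] u[of 3] n[of 4] u[of 4]
  show "0 \<le> (\<Prod>l<3. 3 - real l * \<Delta>)" "0 \<le> (\<Prod>l<4. 4 - real l * \<Delta>)"
    "(\<Prod>l<3. 3 - real l * \<Delta>) \<le> 27" "(\<Prod>l<4. 4 - real l * \<Delta>) \<le> 256"
    by simp_all
qed (use \<Delta> k K indep_score in auto)

text \<open>Valid at every point, also where the sum of the negative powers vanishes: both sides are
  then 0 by the conventions for division by 0 and for \<open>powr\<close> at 0.\<close>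

lemma moment_estimator_eq:
  assumes "0 < k"
  shows "moment_estimator \<Delta> D k A v w \<omega> = F * ((\<Sum>j=1..k. score j \<omega>) / k) powr (- \<Delta>)"
proof -
  define s where "s = (\<Sum>j=1..k. proj j \<omega> powr (- (1 - \<Delta>) / \<Delta>))"
  have s: "0 \<le> s" unfolding s_def by (intro sum_nonneg) auto
  have "((\<Sum>j=1..k. score j \<omega>) / k) powr (- \<Delta>) = ((\<Delta> * F powr (1 / \<Delta>)) * s / k) powr (- \<Delta>)"
    by (simp add: score_def s_def sum_distrib_left)
  also have "\<dots> = \<Delta> powr (- \<Delta>) * (F powr (1 / \<Delta>)) powr (- \<Delta>) * s powr (- \<Delta>) / real k powr (- \<Delta>)"
    using s \<Delta> by (simp add: powr_mult powr_divide)
  also have "(F powr (1 / \<Delta>)) powr (- \<Delta>) = 1 / F"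
    using \<Delta> F_pos by (simp add: powr_powr powr_minus_divide)
  also have "F * (\<Delta> powr (- \<Delta>) * (1 / F) * s powr (- \<Delta>) / real k powr (- \<Delta>))
      = 1 / \<Delta> powr \<Delta> * (real k / s) powr \<Delta>"
    using F_pos s assms by (simp add: powr_minus_divide powr_divide)
  finally show ?thesis
    by (simp add: moment_estimator_def s_def)
qed

end

text \<open>The constant and the threshold on \<open>k\<close> precede \<open>\<Delta>\<close>,
  \<open>D\<close>, \<open>A\<close> and the probability space, which makes both error terms
  uniform. Some threshold is unavoidable: for \<open>k = 1\<close> the estimator is a multiple of
  \<open>Y powr (- \<Delta>)\<close>, whose mean is infinite. Integrability is asserted because the
  integral of a non-integrable function is 0 by convention.\<close>

theorem theorem1:
  "\<exists>C::real. \<forall>\<^sub>F k in sequentially.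
     \<forall>(\<Delta>::real) (D::nat) (A::nat \<Rightarrow> real) (M::'a measure)
       (v::nat \<Rightarrow> nat \<Rightarrow> 'a \<Rightarrow> real) (w::nat \<Rightarrow> nat \<Rightarrow> 'a \<Rightarrow> real).
       0 < \<Delta> \<longrightarrow> \<Delta> < 1 \<longrightarrow>
       (\<forall>i\<in>{1..D}. 0 \<le> A i) \<longrightarrow> (\<exists>i\<in>{1..D}. A i \<noteq> 0) \<longrightarrow>
       uniform_exponential_arrays M D k v w \<longrightarrow>
       (let F = frequency_moment (1 - \<Delta>) D A;
            F_hat = moment_estimator \<Delta> D k A v w
        in integrable M F_hat \<and> integrable M (\<lambda>\<omega>. (F_hat \<omega>)\<^sup>2) \<and>
           (\<exists>\<epsilon>1 \<epsilon>2. \<bar>\<epsilon>1\<bar> \<le> C * (\<Delta> / real k) \<and> \<bar>\<epsilon>2\<bar> \<le> C * (1 / real k) \<and>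
              prob_space.expectation M F_hat = F * (1 + \<epsilon>1) \<and>
              prob_space.variance M F_hat
                = \<Delta>\<^sup>2 / real k * F\<^sup>2 * (3 - 2 * \<Delta> + \<epsilon>2)))"
proof -
  obtain K :: real where K: "1 \<le> K" "\<And>\<Delta>. 0 < \<Delta> \<Longrightarrow> \<Delta> < 1 \<Longrightarrow>
    (\<integral>\<^sup>+x. ennreal ((1 + lower_dev \<Delta> (unit_score \<Delta> x)) powr (1 / 4)) \<partial>weight_law) \<le> ennreal K"
    using lower_dev_unit_score_bound by metis
  define c where "c = tail_const K"
  have c: "0 \<le> c" using K by (simp add: c_def tail_const_def)
  \<comment> \<open>Dominates the constants of both expansions and depends on \<open>K\<close>
    alone.\<close>
  define C where "C = 31760 + 3 * c + (24 + c)\<^sup>2"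
  have C: "24 + c \<le> C" using c zero_le_power2[of "24 + c"] unfolding C_def by linarith
  show ?thesis
    unfolding Let_def
  proof (intro exI[of _ C] eventually_sequentiallyI[of 8] allI impI)
    fix k :: nat and \<Delta> :: real and D :: nat and A :: "nat \<Rightarrow> real" and M :: "'a measure"
      and v w :: "nat \<Rightarrow> nat \<Rightarrow> 'a \<Rightarrow> real"
    assume k: "8 \<le> k" and \<Delta>: "0 < \<Delta>" "\<Delta> < 1" and A: "\<forall>i\<in>{1..D}. 0 \<le> A i" "\<exists>i\<in>{1..D}. A i \<noteq> 0"
      and arrays: "uniform_exponential_arrays M D k v w"
    interpret prob_space M using arrays by (simp add: uniform_exponential_arrays_def)
    interpret P: projection_sample M \<Delta> D k A v w
      by standard (use \<Delta> A arrays in auto)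
    interpret S: score_sample M P.score \<Delta> K "\<Prod>l<3. 3 - real l * \<Delta>" "\<Prod>l<4. 4 - real l * \<Delta>" k
      using k K \<Delta> by (intro P.score_sample) auto
    let ?f = "\<lambda>\<omega>. S.mean \<omega> powr (- \<Delta>)" and ?F = "frequency_moment (1 - \<Delta>) D A"
    note f = S.mean_powr_expansion[folded c_def]
    have k0: "0 < real k" using k by simp
    have eq: "moment_estimator \<Delta> D k A v w = (\<lambda>\<omega>. ?F * ?f \<omega>)"
      using P.moment_estimator_eq k by (simp add: fun_eq_iff S.mean_def)
    have int: "integrable M (\<lambda>\<omega>. ?F * ?f \<omega>)" "integrable M (\<lambda>\<omega>. (?F * ?f \<omega>)\<^sup>2)"
      using f(1,2) by (auto simp: power_mult_distrib)
    define \<epsilon>1 where "\<epsilon>1 = expectation ?f - 1"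
    \<comment> \<open>The variance error is at most \<open>C * \<Delta>\<^sup>2 / k\<^sup>2\<close>,
      so dividing by the leading factor \<open>\<Delta>\<^sup>2 / k\<close> leaves
      \<open>C / k\<close>.\<close>
    define \<epsilon>2 where "\<epsilon>2 = (variance ?f - \<Delta>\<^sup>2 * ((3 - 2 * \<Delta>) / k)) * (k / \<Delta>\<^sup>2)"
    have E: "expectation (\<lambda>\<omega>. ?F * ?f \<omega>) = ?F * (1 + \<epsilon>1)"
      by (simp add: \<epsilon>1_def)
    have "variance (\<lambda>\<omega>. ?F * ?f \<omega>) = expectation (\<lambda>\<omega>. ?F\<^sup>2 * (?f \<omega> - expectation ?f)\<^sup>2)"
      by (simp add: power_mult_distrib[symmetric] right_diff_distrib)
    also have "\<dots> = ?F\<^sup>2 * variance ?f" by simp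
    also have "variance ?f = \<Delta>\<^sup>2 / real k * (3 - 2 * \<Delta> + \<epsilon>2)"
      using \<Delta> k0 by (simp add: \<epsilon>2_def field_simps)
    finally have V: "variance (\<lambda>\<omega>. ?F * ?f \<omega>) = \<Delta>\<^sup>2 / real k * ?F\<^sup>2 * (3 - 2 * \<Delta> + \<epsilon>2)"
      by (simp add: mult_ac)
    have e1: "\<bar>\<epsilon>1\<bar> \<le> C * (\<Delta> / real k)"
    proof -
      have "\<bar>\<epsilon>1\<bar> \<le> \<Delta> * ((24 + c) / k)" using f(3) by (simp only: \<epsilon>1_def)
      also have "\<dots> \<le> \<Delta> * (C / k)" using C \<Delta> by (intro mult_left_mono divide_right_mono) auto
      finally show ?thesis by (simp add: mult_ac)
    qed
    have e2: "\<bar>\<epsilon>2\<bar> \<le> C * (1 / real k)"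
    proof -
      have "\<bar>\<epsilon>2\<bar> = \<bar>variance ?f - \<Delta>\<^sup>2 * ((3 - 2 * \<Delta>) / k)\<bar> * (k / \<Delta>\<^sup>2)"
        unfolding \<epsilon>2_def abs_mult by simp
      also have "\<dots> \<le> \<Delta>\<^sup>2 * (C / k\<^sup>2) * (k / \<Delta>\<^sup>2)"
        using f(4) unfolding C_def by (intro mult_right_mono) auto
      also have "\<dots> = C * (1 / real k)"
        using \<Delta> k0 by (simp add: power2_eq_square)
      finally show ?thesis .
    qed
    show "integrable M (moment_estimator \<Delta> D k A v w) \<and> integrable M (\<lambda>\<omega>. (moment_estimator \<Delta> D k A v w \<omega>)\<^sup>2) \<and>
      (\<exists>\<epsilon>1 \<epsilon>2. \<bar>\<epsilon>1\<bar> \<le> C * (\<Delta> / real k) \<and> \<bar>\<epsilon>2\<bar> \<le> C * (1 / real k) \<and>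
        expectation (moment_estimator \<Delta> D k A v w) = ?F * (1 + \<epsilon>1) \<and>
        variance (moment_estimator \<Delta> D k A v w) = \<Delta>\<^sup>2 / real k * ?F\<^sup>2 * (3 - 2 * \<Delta> + \<epsilon>2))"
      unfolding eq using int E V e1 e2 by blast
  qed
qed

end
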